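(* Let $\Omega\subset\mathbb{R}^n$ be a bounded domain. Assume that $1<p_{\min}\le p(x)\le p_{\max}<\infty$ in $\Omega$, with $p$ Lipschitz continuous in $\Omega$ and $\|\nabla p\|_{L^\infty(\Omega)}\le L$ for some $L>0$, and $f\in L^\infty(\Omega)$. Assume moreover that $f\in C(\Omega)$ and $p\in C^1(\Omega)$. Let $u\in W^{1,p(\cdot)}(\Omega)\cap C(\Omega)$ be a weak solution to $\Delta_{p(x)}u=f$ in $\Omega$. Then $u$ is a viscosity solution to $\Delta_{p(x)}u=f$ in $\Omega$.
   Context: $\Delta_{p(x)}u=\mathrm{div}(|\nabla u|^{p(x)-2}\nabla u)$. For a $C^2$ function $\varphi$ with $\nabla\varphi(x)\neq0$, $$\Delta_{p(x)}\varphi(x)=|\nabla\varphi(x)|^{p(x)-2}\Big(\Delta\varphi(x)+(p(x)-2)\Big\langle D^2\varphi(x)\tfrac{\nabla\varphi(x)}{|\nabla\varphi(x)|},\tfrac{\nabla\varphi(x)}{|\nabla\varphi(x)|}\Big\rangle+\langle\nabla p(x),\nabla\varphi(x)\rangle\log|\nabla\varphi(x)|\Big),$$ and $\Delta_{p(x_0)}\varphi(x_0)$ denotes this expression evaluated at $x=x_0$. $L^{p(\cdot)}(\Omega)$ is the set of measurable $u$ with $\int_\Omega|u|^{p(x)}dx<\infty$; $W^{1,p(\cdot)}(\Omega)$ is the set of $u\in L^{p(\cdot)}(\Omega)$ whose distributional gradient is in $L^{p(\cdot)}(\Omega)$. Weak solution: $u\in W^{1,p(\cdot)}(\Omega)$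 and $-\int_\Omega|\nabla u|^{p(x)-2}\nabla u\cdot\nabla\varphi\,dx=\int_\Omega\varphi f\,dx$ for every $\varphi\in C_0^\infty(\Omega)$. $\varphi$ touches $u$ from below (resp. above) at $x_0\in\Omega$ if $u(x_0)=\varphi(x_0)$ and $u\ge\varphi$ (resp. $u\le\varphi$) in a neighborhood of $x_0$. Viscosity solution to $\Delta_{p(x)}u=f$ in $\Omega$: $u\in C(\Omega)$ which is both a viscosity subsolution (for every $\varphi\in C^2(\Omega)$ and $x_0\in\Omega$, if $\varphi$ touches $u$ from above at $x_0$ and $\nabla\varphi(x_0)\ne0$, then $\Delta_{p(x_0)}\varphi(x_0)\ge f(x_0)$) and a viscosity supersolution (for every $\varphi\in C^2(\Omega)$ and $x_0\in\Omega$, if $\varphi$ touches $u$ from below at $x_0$ and $\nabla\varphi(x_0)\ne0$, then $\Delta_{p(x_0)}\varphi(x_0)\le f(x_0)$). *)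

theory Defs
  imports "HOL-Analysis.Analysis" "HOL-Probability.Essential_Supremum"
begin

text \<open>
  Functions on an open set \<open>\<Omega>\<close> are modelled by total functions of which only the values on
  \<open>\<Omega>\<close> matter. Measurability and integrals refer to Lebesgue measure.
\<close>

definition grad :: "('a::euclidean_space \<Rightarrow> real) \<Rightarrow> 'a \<Rightarrow> 'a" where
  "grad f x = (\<Sum>b\<in>Basis. frechet_derivative f (at x) b *\<^sub>R b)"

lemma GDERIV_grad:
  fixes f :: "'a::euclidean_space \<Rightarrow> real"
  assumes "f differentiable at x"
  shows "GDERIV f x :> grad f x"
proof -
  have D: "(f has_derivative frechet_derivative f (at x)) (at x)"
    using assms by (simp add: frechet_derivative_works)
  then interpret linear "frechet_derivative f (at x)"
    by (rule has_derivative_linear)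
  have "frechet_derivative f (at x) h = h \<bullet> grad f x" for h
  proof -
    have "frechet_derivative f (at x) h
        = frechet_derivative f (at x) (\<Sum>b\<in>Basis. (h \<bullet> b) *\<^sub>R b)"
      by (simp add: euclidean_representation)
    also have "\<dots> = h \<bullet> grad f x"
      by (simp add: sum scale grad_def inner_sum_right mult.commute)
    finally show ?thesis .
  qed
  then show ?thesis
    using D unfolding gderiv_def by (metis (no_types, lifting) ext)
qed

definition hessian :: "('a::euclidean_space \<Rightarrow> real) \<Rightarrow> 'a \<Rightarrow> 'a \<Rightarrow> 'a" where
  "hessian f x = frechet_derivative (grad f) (at x)"

definition laplacian :: "('a::euclidean_space \<Rightarrow> real) \<Rightarrow> 'a \<Rightarrow> real" where
  "laplacian f x = (\<Sum>b\<in>Basis. hessian f x b \<bullet> b)"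

text \<open>
  The derivatives are taken at points of the whole space, so \<open>S\<close> is meant to be open;
  continuity of lower-order derivatives follows from differentiability.
\<close>

fun Ck_on :: "nat \<Rightarrow> ('a::euclidean_space \<Rightarrow> real) \<Rightarrow> 'a set \<Rightarrow> bool" where
  "Ck_on 0 f S \<longleftrightarrow> continuous_on S f"
| "Ck_on (Suc k) f S \<longleftrightarrow>
     (\<forall>x\<in>S. f differentiable at x) \<and>
     (\<forall>b\<in>Basis. Ck_on k (\<lambda>x. frechet_derivative f (at x) b) S)"

text \<open>The space \<open>C\<^sub>0\<^sup>\<infinity>(\<Omega>)\<close>; its elements are extended by zero to the whole space.\<close>

definition test_functions :: "'a::euclidean_space set \<Rightarrow> ('a \<Rightarrow> real) set" where
  "test_functions \<Omega> =
     {\<phi>. (\<forall>k. Ck_on k \<phi> UNIV) \<and>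
         compact (closure {x. \<phi> x \<noteq> 0}) \<and> closure {x. \<phi> x \<noteq> 0} \<subseteq> \<Omega>}"

definition Linf_norm :: "'a::euclidean_space set \<Rightarrow> ('a \<Rightarrow> 'b::real_normed_vector) \<Rightarrow> ereal" where
  "Linf_norm \<Omega> g = esssup (lebesgue_on \<Omega>) (\<lambda>x. ereal (norm (g x)))"

definition Linf :: "'a::euclidean_space set \<Rightarrow> ('a \<Rightarrow> real) set" where
  "Linf \<Omega> = {g. g \<in> borel_measurable (lebesgue_on \<Omega>) \<and> Linf_norm \<Omega> g < \<infinity>}"

definition Lvar :: "'a::euclidean_space set \<Rightarrow> ('a \<Rightarrow> real) \<Rightarrow> ('a \<Rightarrow> 'b::euclidean_space) set" where
  "Lvar \<Omega> p =
     {u. u \<in> borel_measurable (lebesgue_on \<Omega>) \<and>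
         (\<integral>\<^sup>+x. ennreal (norm (u x) powr p x) \<partial>lebesgue_on \<Omega>) < \<infinity>}"

definition locally_integrable ::
    "'a::euclidean_space set \<Rightarrow> ('a \<Rightarrow> 'b::euclidean_space) \<Rightarrow> bool" where
  "locally_integrable \<Omega> g \<longleftrightarrow> (\<forall>K. compact K \<and> K \<subseteq> \<Omega> \<longrightarrow> set_integrable lebesgue K g)"

definition weak_gradient :: "'a::euclidean_space set \<Rightarrow> ('a \<Rightarrow> real) \<Rightarrow> ('a \<Rightarrow> 'a) \<Rightarrow> bool" where
  "weak_gradient \<Omega> u G \<longleftrightarrow>
     locally_integrable \<Omega> u \<and> locally_integrable \<Omega> G \<and>
     (\<forall>\<phi>\<in>test_functions \<Omega>. \<forall>b\<in>Basis.
        (LINT x|lebesgue_on \<Omega>. u x * frechet_derivative \<phi> (at x) b)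
          = - (LINT x|lebesgue_on \<Omega>. (G x \<bullet> b) * \<phi> x))"

definition W1var :: "'a::euclidean_space set \<Rightarrow> ('a \<Rightarrow> real) \<Rightarrow> ('a \<Rightarrow> real) set" where
  "W1var \<Omega> p = {u. u \<in> Lvar \<Omega> p \<and> (\<exists>G. weak_gradient \<Omega> u G \<and> G \<in> Lvar \<Omega> p)}"

text \<open>
  The weak gradient is unique up to null sets, so the choice of \<open>G\<close> is immaterial. Since
  \<open>0 powr a = 0\<close>, the field \<open>\<bar>G\<bar>\<^bsup>p-2\<^esup> G\<close> vanishes where \<open>G\<close> does.
\<close>

definition weak_solution ::
    "'a::euclidean_space set \<Rightarrow> ('a \<Rightarrow> real) \<Rightarrow> ('a \<Rightarrow> real) \<Rightarrow> ('a \<Rightarrow> real) \<Rightarrow> bool" where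
  "weak_solution \<Omega> p f u \<longleftrightarrow>
     u \<in> W1var \<Omega> p \<and>
     (\<exists>G. weak_gradient \<Omega> u G \<and> G \<in> Lvar \<Omega> p \<and>
        (\<forall>\<phi>\<in>test_functions \<Omega>.
           - (LINT x|lebesgue_on \<Omega>. (norm (G x) powr (p x - 2) *\<^sub>R G x) \<bullet> grad \<phi> x)
             = (LINT x|lebesgue_on \<Omega>. \<phi> x * f x)))"

definition px_laplacian ::
    "('a::euclidean_space \<Rightarrow> real) \<Rightarrow> ('a \<Rightarrow> real) \<Rightarrow> 'a \<Rightarrow> real" where
  "px_laplacian p \<phi> x =
     norm (grad \<phi> x) powr (p x - 2) *
       (laplacian \<phi> x
        + (p x - 2) * (hessian \<phi> x (grad \<phi> x /\<^sub>R norm (grad \<phi> x))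
                         \<bullet> (grad \<phi> x /\<^sub>R norm (grad \<phi> x)))
        + (grad p x \<bullet> grad \<phi> x) * ln (norm (grad \<phi> x)))"

definition touches_from_below ::
    "('a::euclidean_space \<Rightarrow> real) \<Rightarrow> ('a \<Rightarrow> real) \<Rightarrow> 'a \<Rightarrow> bool" where
  "touches_from_below \<phi> u x \<longleftrightarrow> u x = \<phi> x \<and> (\<forall>\<^sub>F y in nhds x. u y \<ge> \<phi> y)"

definition touches_from_above ::
    "('a::euclidean_space \<Rightarrow> real) \<Rightarrow> ('a \<Rightarrow> real) \<Rightarrow> 'a \<Rightarrow> bool" where
  "touches_from_above \<phi> u x \<longleftrightarrow> u x = \<phi> x \<and> (\<forall>\<^sub>F y in nhds x. u y \<le> \<phi> y)"

definition viscosity_subsolution ::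
    "'a::euclidean_space set \<Rightarrow> ('a \<Rightarrow> real) \<Rightarrow> ('a \<Rightarrow> real) \<Rightarrow> ('a \<Rightarrow> real) \<Rightarrow> bool" where
  "viscosity_subsolution \<Omega> p f u \<longleftrightarrow>
     (\<forall>\<phi> x. Ck_on 2 \<phi> \<Omega> \<longrightarrow> x \<in> \<Omega> \<longrightarrow> touches_from_above \<phi> u x \<longrightarrow> grad \<phi> x \<noteq> 0 \<longrightarrow>
            px_laplacian p \<phi> x \<ge> f x)"

definition viscosity_supersolution ::
    "'a::euclidean_space set \<Rightarrow> ('a \<Rightarrow> real) \<Rightarrow> ('a \<Rightarrow> real) \<Rightarrow> ('a \<Rightarrow> real) \<Rightarrow> bool" where
  "viscosity_supersolution \<Omega> p f u \<longleftrightarrow>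
     (\<forall>\<phi> x. Ck_on 2 \<phi> \<Omega> \<longrightarrow> x \<in> \<Omega> \<longrightarrow> touches_from_below \<phi> u x \<longrightarrow> grad \<phi> x \<noteq> 0 \<longrightarrow>
            px_laplacian p \<phi> x \<le> f x)"

definition viscosity_solution ::
    "'a::euclidean_space set \<Rightarrow> ('a \<Rightarrow> real) \<Rightarrow> ('a \<Rightarrow> real) \<Rightarrow> ('a \<Rightarrow> real) \<Rightarrow> bool" where
  "viscosity_solution \<Omega> p f u \<longleftrightarrow>
     continuous_on \<Omega> u \<and> viscosity_subsolution \<Omega> p f u \<and> viscosity_supersolution \<Omega> p f u"

end

theory Submission
  imports Defs
begin

text \<open>
  Write \<open>A(x, \<xi>) = |\<xi>|\<^bsup>p(x)-2\<^esup> \<xi>\<close>. Suppose that \<open>\<phi>\<close> touches \<open>u\<close> from below at \<open>z\<close> with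
  \<open>\<nabla>\<phi>(z) \<noteq> 0\<close> and, against the claim, that the p(x)-Laplacian of \<open>\<phi>\<close> exceeds \<open>f\<close> at \<open>z\<close>.
  Subtracting \<open>|x - z|\<^sup>4\<close> from \<open>\<phi>\<close> changes neither the gradient nor the Hessian at \<open>z\<close> but makes
  the contact strict; the new function \<open>\<psi>\<close> satisfies \<open>div A(x, \<nabla>\<psi>) \<ge> f + c\<close> in a small ball, for
  some \<open>c > 0\<close> (\<open>touching_neighbourhood\<close>). For small \<open>m > 0\<close> the function \<open>w = \<psi> + m - u\<close> is
  positive near \<open>z\<close> and negative near the boundary of the ball. Let \<open>\<theta> = H(w)\<close> with \<open>H\<close>
  nondecreasing, zero on the negative axis and positive on the positive one. Testing both equations
  in divergence form gives

  \<open>\<integral> (A(x, \<nabla>\<psi>) - A(x, \<nabla>u)) \<bullet> \<nabla>\<theta> = \<integral> \<theta> (f - div A(x, \<nabla>\<psi>)) \<le> - c \<integral> \<theta> < 0\<close>.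

  But \<open>\<nabla>\<theta> = H'(w) (\<nabla>\<psi> - \<nabla>u)\<close>, and \<open>A(x, \<cdot>)\<close> is monotone (\<open>pflux_monotone\<close>), so the left side is
  nonnegative. This contradiction shows that \<open>u\<close> is a supersolution; applied to \<open>- u\<close> and \<open>- f\<close> it
  shows that \<open>u\<close> is a subsolution.

  The function \<open>H(w)\<close> is only of Sobolev class. Instead of extending the class of admissible test
  functions, the proof uses \<open>\<theta> = H(w\<^sub>\<epsilon>)\<close> with the mollification \<open>w\<^sub>\<epsilon>\<close> of \<open>w\<close> and the smooth
  \<open>H(t) = exp(-1/t)\<close> for \<open>t > 0\<close>. Since \<open>w\<close> is continuous, \<open>w\<^sub>\<epsilon>\<close> is uniformly close to \<open>w\<close>, so that
  \<open>\<theta>\<close> is a smooth function with compact support in the ball (\<open>cutoff_test_function\<close>). Its gradient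
  contains \<open>(\<nabla>w)\<^sub>\<epsilon>\<close> in place of \<open>\<nabla>w\<close> (\<open>weak_gradient_mollification\<close>), and this costs an error of
  the size of \<open>\<integral> |A(x, \<nabla>\<psi>) - A(x, \<nabla>u)| |(\<nabla>w)\<^sub>\<epsilon> - \<nabla>w|\<close>.

  That this error tends to zero (\<open>mollification_error\<close>) is the analytic core. Translations are not
  bounded on variable exponent spaces, since they move a function to points with another exponent.
  Mollification is nevertheless bounded there when \<open>p\<close> is Lipschitz: exponents at distance
  \<open>\<epsilon>\<close> differ by \<open>O(\<epsilon>)\<close>, the relevant values \<open>a\<close> lie between \<open>\<epsilon>\<close> and a multiple of \<open>\<epsilon>\<^bsup>-n\<^esup>\<close>, and
  for these \<open>a\<^bsup>O(\<epsilon>)\<^esup>\<close> stays bounded (\<open>mollification_powr_le\<close>).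
\<close>

section \<open>Calculus of k times continuously differentiable functions\<close>

lemma grad_inner_Basis:
  "b \<in> Basis \<Longrightarrow> grad f x \<bullet> b = frechet_derivative f (at x) b"
  by (simp add: grad_def inner_sum_left inner_Basis if_distrib if_distribR cong: if_cong)

lemma has_derivative_grad:
  assumes "f differentiable at x"
  shows "(f has_derivative (\<lambda>h. h \<bullet> grad f x)) (at x)"
  using GDERIV_grad[OF assms] by (simp add: gderiv_def)

lemma grad_eqI:
  assumes "(f has_derivative (\<lambda>h. h \<bullet> v)) (at x)"
  shows "grad f x = v"
proof -
  have "frechet_derivative f (at x) = (\<lambda>h. h \<bullet> v)"
    using frechet_derivative_at[OF assms] by simp
  then show ?thesis
    unfolding grad_def by (simp add: inner_commute[of _ v] euclidean_representation)
qed

lemma Ck_on_SucI: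
  assumes "\<And>x. x \<in> S \<Longrightarrow> (f has_derivative f' x) (at x)"
    and "\<And>b. b \<in> Basis \<Longrightarrow> Ck_on k (\<lambda>x. frechet_derivative f (at x) b) S"
  shows "Ck_on (Suc k) f S"
  using assms by (auto simp: differentiable_def)

lemma Ck_on_subset: "Ck_on k f S \<Longrightarrow> T \<subseteq> S \<Longrightarrow> Ck_on k f T"
  by (induction k arbitrary: f) (auto intro: continuous_on_subset)

text \<open>
  The sum, product and composition rules below rest on this lemma: they give the derivative only at
  points of \<open>S\<close>, and openness of \<open>S\<close> is what allows \<open>f\<close> to be replaced by \<open>g\<close> under a derivative.
\<close>

lemma Ck_on_cong:
  assumes "open S" "Ck_on k g S" "\<And>x. x \<in> S \<Longrightarrow> f x = g x"
  shows "Ck_on k f S"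
  using assms(2,3)
proof (induction k arbitrary: f g)
  case 0
  then show ?case using continuous_on_cong by (metis Ck_on.simps(1))
next
  case (Suc k)
  have d: "f differentiable at x" "frechet_derivative f (at x) = frechet_derivative g (at x)"
    if "x \<in> S" for x
  proof -
    have g: "g differentiable at x" using Suc.prems that by simp
    then show "frechet_derivative f (at x) = frechet_derivative g (at x)"
      using frechet_derivative_transform_within_open[OF g assms(1) that Suc.prems(2)[symmetric]]
      by metis
    show "f differentiable at x"
      using g has_derivative_transform_within_open[OF _ assms(1) that] Suc.prems(2)
      unfolding differentiable_def by metis
  qed
  have "Ck_on k (\<lambda>x. frechet_derivative f (at x) b) S" if "b \<in> Basis" for b
  proof (rule Suc.IH[of "\<lambda>x. frechet_derivative g (at x) b"])
    show "Ck_on k (\<lambda>x. frechet_derivative g (at x) b) S"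
      using Suc.prems(1) that by simp
    show "frechet_derivative f (at x) b = frechet_derivative g (at x) b" if "x \<in> S" for x
      using d(2)[OF that] by (rule fun_cong)
  qed
  then show ?case using d by simp
qed

lemma Ck_on_SucI':
  assumes "open S" "\<And>x. x \<in> S \<Longrightarrow> (f has_derivative f' x) (at x)"
    and "\<And>b. b \<in> Basis \<Longrightarrow> Ck_on k (\<lambda>x. f' x b) S"
  shows "Ck_on (Suc k) f S"
proof (rule Ck_on_SucI[OF assms(2)])
  fix b :: 'a assume "b \<in> Basis"
  show "Ck_on k (\<lambda>x. frechet_derivative f (at x) b) S"
    by (rule Ck_on_cong[OF assms(1) assms(3)[OF \<open>b \<in> Basis\<close>]])
      (simp add: frechet_derivative_at[OF assms(2), symmetric])
qed

lemma Ck_on_Suc_has_derivative: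
  assumes "Ck_on (Suc k) f S" "x \<in> S"
  shows "(f has_derivative frechet_derivative f (at x)) (at x)"
  using assms by (simp add: frechet_derivative_works)

lemma Ck_on_Suc_continuous: "Ck_on (Suc k) f S \<Longrightarrow> continuous_on S f"
  by (auto intro!: differentiable_imp_continuous_on
      simp: differentiable_on_def differentiable_at_withinI)

lemma Ck_on_Suc_imp: "Ck_on (Suc k) f S \<Longrightarrow> Ck_on k f S"
proof (induction k arbitrary: f)
  case 0
  then show ?case using Ck_on_Suc_continuous[OF 0] by simp
next
  case (Suc k)
  then show ?case by auto
qed

lemma Ck_on_mono: "Ck_on k f S \<Longrightarrow> j \<le> k \<Longrightarrow> Ck_on j f S"
proof (induction k)
  case (Suc k)
  then show ?case using Ck_on_Suc_imp le_Suc_eq by metis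
qed simp

lemma Ck_on_imp_continuous_on: "Ck_on k f S \<Longrightarrow> continuous_on S f"
  using Ck_on_mono[of k f S 0] by simp

lemma Ck_on_continuous_grad:
  assumes "Ck_on (Suc k) f S"
  shows "continuous_on S (grad f)"
  unfolding grad_def
  by (intro continuous_on_sum continuous_on_scaleR continuous_on_const
      Ck_on_imp_continuous_on[where k=k]) (use assms in simp)

lemma Ck_on_open_Un:
  assumes "open S" "open T" "Ck_on k f S" "Ck_on k f T"
  shows "Ck_on k f (S \<union> T)"
  using assms(3,4)
  by (induction k arbitrary: f) (auto intro!: continuous_on_open_Un assms)

lemma Ck_on_const: "open S \<Longrightarrow> Ck_on k (\<lambda>x. c) S"
  by (induction k arbitrary: c) auto

lemma Ck_on_add:
  assumes "open S" "Ck_on k f S" "Ck_on k g S"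
  shows "Ck_on k (\<lambda>x. f x + g x) S"
  using assms(2,3)
proof (induction k arbitrary: f g)
  case 0
  then show ?case by (auto intro: continuous_intros)
next
  case (Suc k)
  show ?case
    by (rule Ck_on_SucI'[OF assms(1) has_derivative_add[OF
        Ck_on_Suc_has_derivative[OF Suc.prems(1)] Ck_on_Suc_has_derivative[OF Suc.prems(2)]]])
      (use Suc.prems in \<open>auto intro!: Suc.IH\<close>)
qed

lemma Ck_on_mult:
  assumes "open S" "Ck_on k f S" "Ck_on k g S"
  shows "Ck_on k (\<lambda>x. f x * g x) S"
  using assms(2,3)
proof (induction k arbitrary: f g)
  case 0
  then show ?case by (auto intro: continuous_intros)
next
  case (Suc k)
  note imp = Suc.prems[THEN Ck_on_Suc_imp]
  show ?case
    by (rule Ck_on_SucI'[OF assms(1) has_derivative_mult[OF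
        Ck_on_Suc_has_derivative[OF Suc.prems(1)] Ck_on_Suc_has_derivative[OF Suc.prems(2)]]])
     (use Suc.prems imp in \<open>auto intro!: Ck_on_add[OF assms(1)] Suc.IH\<close>)
qed

lemma Ck_on_cmult: "open S \<Longrightarrow> Ck_on k f S \<Longrightarrow> Ck_on k (\<lambda>x. c * f x) S"
  by (intro Ck_on_mult Ck_on_const)

lemma Ck_on_minus: "open S \<Longrightarrow> Ck_on k f S \<Longrightarrow> Ck_on k (\<lambda>x. - f x) S"
  using Ck_on_cmult[of S k f "-1"] by simp

lemma Ck_on_diff:
  "open S \<Longrightarrow> Ck_on k f S \<Longrightarrow> Ck_on k g S \<Longrightarrow> Ck_on k (\<lambda>x. f x - g x) S"
  using Ck_on_add[of S k f "\<lambda>x. - g x"] Ck_on_minus[of S k g] by simp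

lemma Ck_on_sum:
  assumes "open S" "\<And>i. i \<in> I \<Longrightarrow> Ck_on k (f i) S"
  shows "Ck_on k (\<lambda>x. \<Sum>i\<in>I. f i x) S"
  using assms(2)
  by (induction I rule: infinite_finite_induct) (auto intro!: Ck_on_add Ck_on_const assms(1))

lemma Ck_on_inner_const:
  assumes "open S"
  shows "Ck_on k (\<lambda>x. x \<bullet> v) S"
proof (cases k)
  case 0
  then show ?thesis by (auto intro: continuous_intros)
next
  case (Suc j)
  have "((\<lambda>x. x \<bullet> v) has_derivative (\<lambda>h. h \<bullet> v)) (at x)" for x
    by (auto intro!: derivative_eq_intros)
  then show ?thesis
    unfolding Suc by (rule Ck_on_SucI'[OF assms]) (rule Ck_on_const[OF assms])
qed

lemma Ck_on_compose_real:
  fixes h :: "real \<Rightarrow> real" and g :: "'a::euclidean_space \<Rightarrow> real"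
  assumes "open S" "open T" "\<And>x. x \<in> S \<Longrightarrow> g x \<in> T" "Ck_on k h T" "Ck_on k g S"
  shows "Ck_on k (\<lambda>x. h (g x)) S"
  using assms(4,5)
proof (induction k arbitrary: h)
  case 0
  then show ?case
    using assms(3) by (auto intro: continuous_on_compose2)
next
  case (Suc k)
  note g = Ck_on_Suc_has_derivative[OF Suc.prems(2)]
  note h = Ck_on_Suc_has_derivative[OF Suc.prems(1)]
  have d: "((\<lambda>x. h (g x)) has_derivative
      (\<lambda>v. frechet_derivative g (at x) v * frechet_derivative h (at (g x)) 1)) (at x)"
    if "x \<in> S" for x
  proof -
    have "frechet_derivative h (at (g x)) t = t * frechet_derivative h (at (g x)) 1" for t
      using linear_scale[OF has_derivative_linear[OF h[OF assms(3)[OF that]]], of t 1] by simp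
    then have "(\<lambda>v. frechet_derivative h (at (g x)) (frechet_derivative g (at x) v)) =
        (\<lambda>v. frechet_derivative g (at x) v * frechet_derivative h (at (g x)) 1)"
      by (intro ext)
    then show ?thesis
      using has_derivative_compose[OF g[OF that] h[OF assms(3)[OF that]]] by (simp only:)
  qed
  have h': "Ck_on k (\<lambda>t. frechet_derivative h (at t) 1) T"
    using Suc.prems(1) by simp
  have g': "Ck_on k (\<lambda>x. frechet_derivative g (at x) b) S" if "b \<in> Basis" for b
    using Suc.prems(2) that by simp
  show ?case
  proof (rule Ck_on_SucI'[OF assms(1) d])
    fix b :: 'a assume "b \<in> Basis"
    then show "Ck_on k (\<lambda>x. frechet_derivative g (at x) b *
        frechet_derivative h (at (g x)) 1) S"
      by (rule Ck_on_mult[OF assms(1) g' Suc.IH[OF h' Ck_on_Suc_imp[OF Suc.prems(2)]]])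
  qed
qed

lemma Ck_on_sq_dist:
  assumes "open S"
  shows "Ck_on k (\<lambda>x. (x - z) \<bullet> (x - z)) S"
proof -
  have "(\<lambda>x. (x - z) \<bullet> (x - z)) = (\<lambda>x. \<Sum>b\<in>Basis. (x \<bullet> b - z \<bullet> b) * (x \<bullet> b - z \<bullet> b))"
    by (rule ext) (subst euclidean_inner, simp add: inner_diff_left)
  moreover have "Ck_on k (\<lambda>x. \<Sum>b\<in>Basis. (x \<bullet> b - z \<bullet> b) * (x \<bullet> b - z \<bullet> b)) S"
    by (intro Ck_on_sum Ck_on_mult Ck_on_diff Ck_on_inner_const Ck_on_const assms)
  ultimately show ?thesis by simp
qed

lemma Ck_on_real_openI:
  fixes h h' :: "real \<Rightarrow> real"
  assumes "open S" "\<And>x. x \<in> S \<Longrightarrow> (h has_real_derivative h' x) (at x)" "Ck_on k h' S"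
  shows "Ck_on (Suc k) h S"
  by (rule Ck_on_SucI'[OF assms(1) assms(2)[unfolded has_field_derivative_def]])
    (use assms(3) in auto)

section \<open>A smooth cut-off of the positive part\<close>

text \<open>
  The functions \<open>t\<^bsup>-n\<^esup> exp(-1/t)\<close>, extended by zero. The case \<open>n = 0\<close> is the classical smooth function
  that is flat at the origin; the others make the family closed under differentiation, up to
  linear combinations.
\<close>

definition flat :: "nat \<Rightarrow> real \<Rightarrow> real" where
  "flat n t = (if t > 0 then (1 / t) ^ n * exp (- (1 / t)) else 0)"

text \<open>
  A single term of the exponential series at \<open>1/t\<close> is at most \<open>exp(1/t)\<close>.
\<close>

lemma flat_le: "flat n t \<le> fact n"
proof (cases "t > 0")
  case True
  have "(1 / t) ^ n / fact n \<le> exp (1 / t)"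
  proof -
    have "(1 / t) ^ n / fact n = (\<Sum>k\<in>{n}. inverse (fact k) * (1 / t) ^ k)"
      by (simp add: field_simps)
    also have "\<dots> \<le> (\<Sum>k. inverse (fact k) * (1 / t) ^ k)"
      using True exp_converges[of "1/t"]
      by (intro sum_le_suminf) (auto simp: sums_iff)
    also have "\<dots> = exp (1 / t)"
      using exp_converges[of "1/t"] by (simp add: sums_iff)
    finally show ?thesis .
  qed
  then show ?thesis
    using True by (simp add: flat_def exp_minus field_simps)
qed (simp add: flat_def)

lemma flat_nonneg: "flat n t \<ge> 0"
  by (simp add: flat_def)

lemma flat_pos: "t > 0 \<Longrightarrow> flat n t > 0"
  by (simp add: flat_def)

lemma flat_eq_0: "t \<le> 0 \<Longrightarrow> flat n t = 0"
  by (simp add: flat_def)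

lemma flat_deriv:
  "(flat n has_real_derivative (flat (n + 2) t - real n * flat (n + 1) t)) (at t)"
proof -
  consider "t > 0" | "t < 0" | "t = 0" by linarith
  then show ?thesis
  proof cases
    case 1
    have "((\<lambda>t. (1 / t) ^ n * exp (- (1 / t))) has_real_derivative
        (flat (n + 2) t - real n * flat (n + 1) t)) (at t)"
    proof (cases n)
      case 0
      then show ?thesis using 1
        by (auto intro!: derivative_eq_intros simp: flat_def field_simps power2_eq_square)
    next
      case (Suc m)
      have "((\<lambda>t. 1 / t) has_real_derivative - (1 / t\<^sup>2)) (at t)"
        using 1 by (auto intro!: derivative_eq_intros simp: power2_eq_square)
      from DERIV_power_Suc[OF this, of m] DERIV_fun_exp[OF DERIV_minus[OF this]]
      have "((\<lambda>t. (1 / t) ^ Suc m * exp (- (1 / t))) has_real_derivative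
          (1 / t) ^ Suc m * (exp (- (1 / t)) * - (- (1 / t\<^sup>2))) +
          (1 + real m) * (- (1 / t\<^sup>2) * (1 / t) ^ m) * exp (- (1 / t))) (at t)"
        by (rule DERIV_mult')
      moreover have "(1 / t) ^ Suc m * (exp (- (1 / t)) * - (- (1 / t\<^sup>2))) +
          (1 + real m) * (- (1 / t\<^sup>2) * (1 / t) ^ m) * exp (- (1 / t)) =
          flat (n + 2) t - real n * flat (n + 1) t"
        using 1 by (simp add: flat_def Suc field_simps power2_eq_square)
      ultimately show ?thesis by (simp only: Suc)
    qed
    then show ?thesis
      by (rule has_field_derivative_transform_within_open[of _ _ _ "{0<..}"])
         (use 1 in \<open>auto simp: flat_def\<close>)
  next
    case 2
    have "((\<lambda>t. 0) has_real_derivative (flat (n + 2) t - real n * flat (n + 1) t)) (at t)"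
      using 2 by (auto simp: flat_eq_0)
    then show ?thesis
      by (rule has_field_derivative_transform_within_open[of _ _ _ "{..<0}"])
         (use 2 in \<open>auto simp: flat_def\<close>)
  next
    case 3
    \<comment> \<open>\<open>flat n s = s\<^sup>2 flat (n + 2) s\<close> makes the difference quotient at 0 of size \<open>s\<close>.\<close>
    have "((\<lambda>s. flat n s / s) \<longlongrightarrow> 0) (at 0)"
    proof (rule Lim_null_comparison)
      show "\<forall>\<^sub>F s in at 0. norm (flat n s / s) \<le> fact (n + 2) * \<bar>s\<bar>"
      proof (rule always_eventually, rule allI)
        fix s :: real
        show "norm (flat n s / s) \<le> fact (n + 2) * \<bar>s\<bar>"
        proof (cases "s > 0")
          case True
          have "flat n s / s = s * flat (n + 2) s"
            using True by (simp add: flat_def field_simps power2_eq_square)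
          also have "\<dots> \<le> s * fact (n + 2)"
            using flat_le[of "n + 2" s] True by (intro mult_left_mono) auto
          finally show ?thesis using True flat_nonneg[of n s]
            by (simp add: mult.commute)
        next
          case False
          then have "norm (flat n s / s) = 0" by (simp add: flat_eq_0)
          also have "0 \<le> fact (n + 2) * \<bar>s\<bar>" by (intro mult_nonneg_nonneg) auto
          finally show ?thesis .
        qed
      qed
      show "((\<lambda>s. fact (n + 2) * \<bar>s\<bar>) \<longlongrightarrow> (0::real)) (at 0)"
        by (auto intro!: tendsto_eq_intros)
    qed
    then show ?thesis
      using 3 by (simp add: has_field_derivative_iff flat_eq_0)
  qed
qed

text \<open>
  By \<open>flat_deriv\<close> the derivative is again a combination of functions of the family, hence an
  induction that keeps \<open>n\<close> arbitrary.
\<close>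

lemma flat_smooth: "Ck_on k (flat n) UNIV"
proof (induction k arbitrary: n)
  case 0
  have "continuous_on UNIV (flat n)"
    using flat_deriv DERIV_isCont continuous_at_imp_continuous_on by blast
  then show ?case by simp
next
  case (Suc k)
  show ?case
    by (rule Ck_on_real_openI[OF _ flat_deriv])
       (auto intro!: Ck_on_diff Ck_on_cmult Suc)
qed

lemma flat_mono: "s \<le> t \<Longrightarrow> flat 0 s \<le> flat 0 t"
  by (auto simp: flat_def field_simps)

section \<open>Test functions and integration by parts\<close>

lemma test_functionsI:
  assumes "\<And>k. Ck_on k \<phi> UNIV" "compact K" "K \<subseteq> \<Omega>" "\<And>x. x \<notin> K \<Longrightarrow> \<phi> x = 0"
  shows "\<phi> \<in> test_functions \<Omega>"
proof -
  have "closure {x. \<phi> x \<noteq> 0} \<subseteq> K"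
    by (rule closure_minimal) (use assms compact_imp_closed in auto)
  moreover from this have "compact (closure {x. \<phi> x \<noteq> 0})"
    using compact_Int_closed[OF assms(2) closed_closure, of "{x. \<phi> x \<noteq> 0}"]
    by (simp add: Int_absorb1)
  ultimately show ?thesis
    using assms unfolding test_functions_def by auto
qed

lemma has_derivative_0_off_closed:
  fixes f :: "'a::euclidean_space \<Rightarrow> real"
  assumes "closed K" "\<And>x. x \<notin> K \<Longrightarrow> f x = 0" "x \<notin> K"
  shows "(f has_derivative (\<lambda>h. 0)) (at x)"
proof -
  have "((\<lambda>x. 0::real) has_derivative (\<lambda>h. 0)) (at x)" by simp
  then show ?thesis
    by (rule has_derivative_transform_within_open[OF _ open_Compl[OF assms(1)]])
      (simp_all add: assms(2,3))
qed

lemma test_functionsE: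
  assumes "\<phi> \<in> test_functions \<Omega>"
  obtains K where "compact K" "K \<subseteq> \<Omega>" "\<And>x. x \<notin> K \<Longrightarrow> \<phi> x = 0"
    "\<And>x. x \<notin> K \<Longrightarrow> frechet_derivative \<phi> (at x) = (\<lambda>h. 0)"
proof
  let ?K = "closure {x. \<phi> x \<noteq> 0}"
  show "compact ?K" "?K \<subseteq> \<Omega>" using assms by (auto simp: test_functions_def)
  show *: "\<phi> x = 0" if "x \<notin> ?K" for x
    using that closure_subset[of "{x. \<phi> x \<noteq> 0}"] by auto
  show "frechet_derivative \<phi> (at x) = (\<lambda>h. 0)" if "x \<notin> ?K" for x
  proof -
    have "(\<phi> has_derivative (\<lambda>h. 0)) (at x)"
      by (rule has_derivative_0_off_closed[OF closed_closure * that])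
    then show ?thesis by (simp add: frechet_derivative_at[symmetric])
  qed
qed

lemma test_functions_Ck: "\<phi> \<in> test_functions \<Omega> \<Longrightarrow> Ck_on k \<phi> UNIV"
  by (simp add: test_functions_def)

lemma test_functions_differentiable:
  "\<phi> \<in> test_functions \<Omega> \<Longrightarrow> \<phi> differentiable at x"
  using test_functions_Ck[of \<phi> \<Omega> "Suc 0"] by simp

lemma test_functions_mono: "\<phi> \<in> test_functions U \<Longrightarrow> U \<subseteq> \<Omega> \<Longrightarrow> \<phi> \<in> test_functions \<Omega>"
  by (auto simp: test_functions_def)

lemma test_functions_partial:
  assumes "\<phi> \<in> test_functions \<Omega>" "b \<in> Basis"
  shows "(\<lambda>x. frechet_derivative \<phi> (at x) b) \<in> test_functions \<Omega>"
proof -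
  obtain K where K: "compact K" "K \<subseteq> \<Omega>"
    "\<And>x. x \<notin> K \<Longrightarrow> frechet_derivative \<phi> (at x) = (\<lambda>h. 0)"
    using test_functionsE[OF assms(1)] by metis
  show ?thesis
  proof (rule test_functionsI[OF _ K(1,2)])
    show "Ck_on k (\<lambda>x. frechet_derivative \<phi> (at x) b) UNIV" for k
      using test_functions_Ck[OF assms(1), of "Suc k"] assms(2) by simp
  qed (simp add: K(3))
qed

lemma borel_measurable_lebesgue_continuous:
  fixes f :: "'a::euclidean_space \<Rightarrow> 'b::euclidean_space"
  assumes "continuous_on UNIV f"
  shows "f \<in> borel_measurable lebesgue"
  by (intro measurable_completion) (use borel_measurable_continuous_onI[OF assms] in simp)

lemma integrable_compact_support:
  fixes f :: "'a::euclidean_space \<Rightarrow> 'b::euclidean_space"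
  assumes "continuous_on UNIV f" "compact K" "\<And>x. x \<notin> K \<Longrightarrow> f x = 0"
  shows "integrable lebesgue f"
proof -
  have "integrable lborel (\<lambda>x. indicator K x *\<^sub>R f x)"
    by (intro borel_integrable_compact assms(2) continuous_on_subset[OF assms(1)]) simp
  also have "(\<lambda>x. indicator K x *\<^sub>R f x) = f"
    using assms(3) by (auto simp: indicator_def)
  finally show ?thesis
    using borel_measurable_continuous_onI[OF assms(1)]
    by (subst integrable_completion) auto
qed

lemma bounded_compact_support:
  fixes f :: "'a::euclidean_space \<Rightarrow> 'b::euclidean_space"
  assumes "continuous_on UNIV f" "compact K" "\<And>x. x \<notin> K \<Longrightarrow> f x = 0"
  obtains M where "M > 0" "\<And>x. norm (f x) \<le> M"
proof -
  have "bounded (f ` K)"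
    by (intro compact_imp_bounded compact_continuous_image assms(2)
        continuous_on_subset[OF assms(1)]) simp
  then obtain M where "M > 0" "\<And>x. x \<in> K \<Longrightarrow> norm (f x) \<le> M"
    by (auto simp: bounded_pos)
  then have "norm (f x) \<le> M" for x
    using assms(3)[of x] by (cases "x \<in> K") auto
  with \<open>M > 0\<close> show ?thesis using that by blast
qed

text \<open>
  Enlarging the support by the unit ball keeps it compact, and two points at distance less than one
  either both lie in the enlarged set or both lie outside the support.
\<close>

lemma uniformly_continuous_compact_support:
  fixes f :: "'a::euclidean_space \<Rightarrow> 'b::euclidean_space"
  assumes "continuous_on UNIV f" "compact K" "\<And>x. x \<notin> K \<Longrightarrow> f x = 0"
  shows "uniformly_continuous_on UNIV f"
  unfolding uniformly_continuous_on_def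
proof (intro allI impI)
  fix e :: real assume "e > 0"
  let ?K = "{x + y |x y. x \<in> K \<and> y \<in> cball 0 1}"
  have "compact ?K" using compact_sums[OF assms(2) compact_cball] .
  then have "uniformly_continuous_on ?K f"
    by (intro compact_uniformly_continuous continuous_on_subset[OF assms(1)]) simp_all
  then obtain d where d: "d > 0"
    "\<And>x y. x \<in> ?K \<Longrightarrow> y \<in> ?K \<Longrightarrow> dist y x < d \<Longrightarrow> dist (f y) (f x) < e"
    using \<open>e > 0\<close> unfolding uniformly_continuous_on_def by meson
  have K: "x \<in> ?K" if "z \<in> K" "dist x z \<le> 1" for x z
  proof -
    have "x = z + (x - z)" "x - z \<in> cball 0 1" using that by (auto simp: dist_norm norm_minus_commute)
    then show ?thesis using that by blast
  qed
  show "\<exists>d>0. \<forall>x\<in>UNIV. \<forall>y\<in>UNIV. dist y x < d \<longrightarrow> dist (f y) (f x) < e"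
  proof (intro exI[of _ "min d 1"] conjI ballI impI)
    fix x y :: 'a assume xy: "dist y x < min d 1"
    show "dist (f y) (f x) < e"
    proof (cases "x \<in> K \<or> y \<in> K")
      case True
      then have "x \<in> ?K" "y \<in> ?K"
        using xy K[of x x] K[of x y] K[of y x] K[of y y] by (auto simp: dist_commute)
      then show ?thesis using d(2) xy by simp
    next
      case False
      then show ?thesis using assms(3) \<open>e > 0\<close> by simp
    qed
  qed (use \<open>d > 0\<close> in auto)
qed

text \<open>
  A product with a test function of an open set may be extended by zero: the open set and the
  complement of the support cover the whole space.
\<close>

lemma Ck_on_mult_test_function:
  assumes "open U" "Ck_on k g U" "\<theta> \<in> test_functions U"
  shows "Ck_on k (\<lambda>x. if x \<in> U then g x * \<theta> x else 0) UNIV"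
proof -
  obtain K where K: "compact K" "K \<subseteq> U" "\<And>x. x \<notin> K \<Longrightarrow> \<theta> x = 0"
    using test_functionsE[OF assms(3)] by metis
  have o: "open (- K)" using K(1) by (simp add: compact_imp_closed open_Compl)
  have "Ck_on k (\<lambda>x. if x \<in> U then g x * \<theta> x else 0) (U \<union> - K)"
  proof (rule Ck_on_open_Un[OF assms(1) o])
    show "Ck_on k (\<lambda>x. if x \<in> U then g x * \<theta> x else 0) U"
      by (rule Ck_on_cong[OF assms(1) Ck_on_mult[OF assms(1,2)
              Ck_on_subset[OF test_functions_Ck[OF assms(3)] subset_UNIV]]]) simp
    show "Ck_on k (\<lambda>x. if x \<in> U then g x * \<theta> x else 0) (- K)"
      by (rule Ck_on_cong[OF o Ck_on_const[OF o, of k 0]]) (use K in auto)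
  qed
  also have "U \<union> - K = UNIV" using K by auto
  finally show ?thesis .
qed

lemma lebesgue_integral_translate:
  fixes f :: "'a::euclidean_space \<Rightarrow> real"
  assumes "f \<in> borel_measurable borel"
  shows "(LINT x|lborel. f (c + x)) = (LINT x|lborel. f x)"
proof -
  have "(LINT x|lborel. f x) = (LINT x|distr lborel borel ((+) c). f x)"
    by (simp add: lborel_distr_plus)
  also have "\<dots> = (LINT x|lborel. f (c + x))"
    by (rule integral_distr) (use assms in auto)
  finally show ?thesis by simp
qed

text \<open>
  Difference quotients of a compactly supported function have integral zero because Lebesgue measure
  is translation invariant. The mean value theorem bounds them by the maximum of the derivative, so
  dominated convergence transfers this to the derivative.
\<close>

lemma integral_partial_eq_0:
  fixes F :: "'a::euclidean_space \<Rightarrow> real"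
  assumes F: "Ck_on (Suc 0) F UNIV" and K: "compact K" "\<And>x. x \<notin> K \<Longrightarrow> F x = 0" and b: "b \<in> Basis"
  shows "(LINT x|lebesgue. frechet_derivative F (at x) b) = 0"
proof -
  let ?D = "\<lambda>x. frechet_derivative F (at x) b"
  let ?q = "\<lambda>n x. (F (inverse (real (Suc n)) *\<^sub>R b + x) - F x) * real (Suc n)"
  let ?K = "{x + y |x y. x \<in> K \<and> y \<in> cball 0 1}"
  have cF: "continuous_on UNIV F" and cD: "continuous_on UNIV ?D"
    using Ck_on_imp_continuous_on[OF F] F b by auto
  have mF: "F \<in> borel_measurable borel" and mD: "?D \<in> borel_measurable borel"
    using cF cD by (auto intro: borel_measurable_continuous_onI)
  have D: "(F has_derivative frechet_derivative F (at x)) (at x)" for x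
    using Ck_on_Suc_has_derivative[OF F] by simp
  have D0: "?D x = 0" if "x \<notin> K" for x
  proof -
    have "(F has_derivative (\<lambda>h. 0)) (at x)"
      by (rule has_derivative_0_off_closed[OF compact_imp_closed[OF K(1)] K(2) that])
    then show ?thesis by (simp add: frechet_derivative_at[symmetric])
  qed
  obtain M where M: "M > 0" "\<And>x. norm (?D x) \<le> M"
    using bounded_compact_support[OF cD K(1) D0] by blast
  have line: "((\<lambda>t. F (x + t *\<^sub>R b)) has_real_derivative ?D (x + t *\<^sub>R b)) (at t)" for x t
  proof -
    have "((\<lambda>t. F (x + t *\<^sub>R b)) has_derivative
        (\<lambda>s. frechet_derivative F (at (x + t *\<^sub>R b)) (s *\<^sub>R b))) (at t)"
      by (rule has_derivative_compose[OF _ D]) (auto intro!: derivative_eq_intros)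
    moreover have "frechet_derivative F (at y) (s *\<^sub>R b) = ?D y * s" for y s
      using linear_scale[OF has_derivative_linear[OF D]] by simp
    ultimately show ?thesis by (simp add: has_field_derivative_def)
  qed
  have lim: "(\<lambda>n. ?q n x) \<longlonglongrightarrow> ?D x" for x
  proof -
    have "((\<lambda>h. (F (x + (0 + h) *\<^sub>R b) - F (x + 0 *\<^sub>R b)) / h) \<longlongrightarrow> ?D (x + 0 *\<^sub>R b)) (at 0)"
      using line[of x 0] by (simp add: has_field_derivative_iff)
    moreover have "filterlim (\<lambda>n. inverse (real (Suc n))) (at 0) sequentially"
      unfolding filterlim_at using LIMSEQ_inverse_real_of_nat by auto
    ultimately have "(\<lambda>n. (F (x + (0 + inverse (real (Suc n))) *\<^sub>R b) - F (x + 0 *\<^sub>R b)) /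
        inverse (real (Suc n))) \<longlonglongrightarrow> ?D (x + 0 *\<^sub>R b)"
      by (rule filterlim_compose)
    then show ?thesis
      by (simp add: add.commute divide_inverse del: of_nat_Suc)
  qed
  have bd: "norm (?q n x) \<le> M * indicator ?K x" for n x
  proof -
    let ?h = "inverse (real (Suc n))"
    have h: "?h > 0" "?h \<le> 1" by (auto simp: field_simps)
    obtain z where z: "F (x + ?h *\<^sub>R b) - F (x + 0 *\<^sub>R b) = (?h - 0) * ?D (x + z *\<^sub>R b)"
      using MVT2[OF h(1), of "\<lambda>t. F (x + t *\<^sub>R b)" "\<lambda>t. ?D (x + t *\<^sub>R b)"] line by blast
    then have q: "?q n x = ?D (x + z *\<^sub>R b)"
      by (simp add: add.commute field_simps)
    show ?thesis
    proof (cases "x \<in> ?K")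
      case True
      then show ?thesis using M(2) q by simp
    next
      case False
      have "x = x + 0" "x = (?h *\<^sub>R b + x) + - (?h *\<^sub>R b)" by auto
      moreover have "- (?h *\<^sub>R b) \<in> cball 0 1" "0 \<in> cball (0::'a) 1"
        using h b by (auto simp del: of_nat_Suc)
      ultimately have "x \<notin> K" "?h *\<^sub>R b + x \<notin> K" using False by blast+
      then have "F x = 0" "F (?h *\<^sub>R b + x) = 0" using K(2) by blast+
      then show ?thesis using False by simp
    qed
  qed
  have cK: "compact ?K" using compact_sums[OF K(1) compact_cball] .
  have int: "integrable lborel F"
    using integrable_compact_support[OF cF K(1)] K(2) mF by (simp add: integrable_completion)
  have iq: "(LINT x|lborel. ?q n x) = 0" for n
  proof -
    let ?c = "inverse (real (Suc n)) *\<^sub>R b"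
    have "integrable (distr lborel borel ((+) ?c)) F"
      using int lborel_distr_plus[of ?c] by simp
    then have i2: "integrable lborel (\<lambda>x. F (?c + x))"
      by (subst (asm) integrable_distr_eq) (use mF in auto)
    show ?thesis
      using lebesgue_integral_translate[OF mF, of ?c] int i2 by (simp del: of_nat_Suc)
  qed
  have "(\<lambda>n. LINT x|lborel. ?q n x) \<longlonglongrightarrow> (LINT x|lborel. ?D x)"
  proof (rule integral_dominated_convergence)
    have "integrable lborel (\<lambda>x. indicator ?K x *\<^sub>R M)"
      by (rule borel_integrable_compact[OF cK]) auto
    then show "integrable lborel (\<lambda>x. M * indicator ?K x)"
      by (simp add: mult.commute)
    show "AE x in lborel. (\<lambda>n. ?q n x) \<longlonglongrightarrow> ?D x" using lim by simp
    show "AE x in lborel. norm (?q n x) \<le> M * indicator ?K x" for n using bd by blast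
  qed (use mF mD in auto)
  then have "(LINT x|lborel. ?D x) = 0"
    by (simp only: iq LIMSEQ_const_iff)
  then show ?thesis using mD by (simp add: integral_completion)
qed

lemma lebesgue_on_integral_eq:
  fixes f :: "'a::euclidean_space \<Rightarrow> real"
  assumes "S \<in> sets lebesgue"
  shows "(LINT x|lebesgue_on S. f x) = (LINT x|lebesgue. (if x \<in> S then f x else 0))"
  using assms by (subst integral_restrict_space) (auto intro!: Bochner_Integration.integral_cong)

lemma integration_by_parts_test_function:
  fixes g :: "'a::euclidean_space \<Rightarrow> real"
  assumes U: "open U" and g: "Ck_on (Suc 0) g U" and \<theta>: "\<theta> \<in> test_functions U" and b: "b \<in> Basis"
  shows "(LINT x|lebesgue_on U. g x * frechet_derivative \<theta> (at x) b)
       = - (LINT x|lebesgue_on U. frechet_derivative g (at x) b * \<theta> x)"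
proof -
  obtain K where K: "compact K" "K \<subseteq> U" "\<And>x. x \<notin> K \<Longrightarrow> \<theta> x = 0"
    "\<And>x. x \<notin> K \<Longrightarrow> frechet_derivative \<theta> (at x) = (\<lambda>h. 0)"
    using test_functionsE[OF \<theta>] by metis
  let ?F = "\<lambda>x. if x \<in> U then g x * \<theta> x else 0"
  let ?A = "\<lambda>x. if x \<in> U then g x * frechet_derivative \<theta> (at x) b else 0"
  let ?B = "\<lambda>x. if x \<in> U then frechet_derivative g (at x) b * \<theta> x else 0"
  have F: "Ck_on (Suc 0) ?F UNIV" by (rule Ck_on_mult_test_function[OF U g \<theta>])
  have A: "integrable lebesgue ?A"
  proof (rule integrable_compact_support[OF _ K(1)])
    show "continuous_on UNIV ?A"
      using Ck_on_mult_test_function[OF U Ck_on_Suc_imp[OF g] test_functions_partial[OF \<theta> b]]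
      by simp
  qed (use K in auto)
  have B: "integrable lebesgue ?B"
  proof (rule integrable_compact_support[OF _ K(1)])
    have "Ck_on 0 (\<lambda>x. frechet_derivative g (at x) b) U" using g b by simp
    from Ck_on_mult_test_function[OF U this \<theta>] show "continuous_on UNIV ?B" by simp
  qed (use K in auto)
  have "frechet_derivative ?F (at x) b = ?A x + ?B x" for x
  proof (cases "x \<in> U")
    case True
    have "(g has_derivative frechet_derivative g (at x)) (at x)"
      using Ck_on_Suc_has_derivative[OF g True] .
    moreover have "(\<theta> has_derivative frechet_derivative \<theta> (at x)) (at x)"
      using test_functions_differentiable[OF \<theta>] frechet_derivative_works by blast
    ultimately have "((\<lambda>x. g x * \<theta> x) has_derivative
       (\<lambda>h. g x * frechet_derivative \<theta> (at x) h + frechet_derivative g (at x) h * \<theta> x)) (at x)"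
      by (rule has_derivative_mult)
    then have "(?F has_derivative
       (\<lambda>h. g x * frechet_derivative \<theta> (at x) h + frechet_derivative g (at x) h * \<theta> x)) (at x)"
      by (rule has_derivative_transform_within_open[OF _ U True]) simp
    then show ?thesis using True by (simp add: frechet_derivative_at[symmetric])
  next
    case False
    have "(?F has_derivative (\<lambda>h. 0)) (at x)"
      by (rule has_derivative_0_off_closed[OF compact_imp_closed[OF K(1)]])
        (use False K in auto)
    then show ?thesis using False by (simp add: frechet_derivative_at[symmetric])
  qed
  then have "(LINT x|lebesgue. ?A x + ?B x) = 0"
    using integral_partial_eq_0[OF F K(1) _ b] K(3) by simp
  then have "(LINT x|lebesgue. ?A x) + (LINT x|lebesgue. ?B x) = 0"
    using A B by simp
  then show ?thesis
    using U by (simp add: lebesgue_on_integral_eq lmeasurable_open borel_open)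
qed

section \<open>Mollification\<close>

definition conv :: "('a::euclidean_space \<Rightarrow> real) \<Rightarrow> ('a \<Rightarrow> 'b::euclidean_space) \<Rightarrow> 'a \<Rightarrow> 'b" where
  "conv \<kappa> w x = (LINT y|lebesgue. \<kappa> (x - y) *\<^sub>R w y)"

lemma test_functions_continuous: "\<phi> \<in> test_functions \<Omega> \<Longrightarrow> continuous_on S \<phi>"
  using Ck_on_imp_continuous_on[OF test_functions_Ck, of \<phi> \<Omega>] continuous_on_subset by blast

lemma test_functions_bounded:
  assumes "\<kappa> \<in> test_functions \<Omega>"
  obtains M where "M > 0" "\<And>x. \<bar>\<kappa> x\<bar> \<le> M"
proof -
  obtain K where "compact K" "\<And>x. x \<notin> K \<Longrightarrow> \<kappa> x = 0"
    using test_functionsE[OF assms] by metis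
  then show ?thesis
    using bounded_compact_support[OF test_functions_continuous[OF assms]] that
    by (metis real_norm_def)
qed

lemma integrable_bounded_mult:
  fixes w :: "'a::euclidean_space \<Rightarrow> 'b::euclidean_space"
  assumes "\<kappa> \<in> borel_measurable lebesgue" "\<And>y. \<bar>\<kappa> y\<bar> \<le> M" "integrable lebesgue w"
  shows "integrable lebesgue (\<lambda>y. \<kappa> y *\<^sub>R w y)"
proof (rule Bochner_Integration.integrable_bound)
  show "integrable lebesgue (\<lambda>y. M * norm (w y))"
    using assms(3) by simp
  show "(\<lambda>y. \<kappa> y *\<^sub>R w y) \<in> borel_measurable lebesgue"
    using assms(1) borel_measurable_integrable[OF assms(3)] by simp
  have "\<bar>\<kappa> y\<bar> * norm (w y) \<le> \<bar>M * norm (w y)\<bar>" for y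
    using assms(2)[of y] by (simp add: abs_mult mult_right_mono)
  then show "AE y in lebesgue. norm (\<kappa> y *\<^sub>R w y) \<le> norm (M * norm (w y))"
    by simp
qed

lemma continuous_reflect_measurable:
  fixes \<kappa> :: "'a::euclidean_space \<Rightarrow> real"
  assumes "continuous_on UNIV \<kappa>"
  shows "(\<lambda>y. \<kappa> (x - y)) \<in> borel_measurable lebesgue"
  by (rule borel_measurable_lebesgue_continuous)
    (auto intro!: continuous_on_compose2[OF assms] continuous_intros)

lemma conv_integrable:
  fixes w :: "'a::euclidean_space \<Rightarrow> 'b::euclidean_space"
  assumes "\<kappa> \<in> test_functions \<Omega>" "integrable lebesgue w"
  shows "integrable lebesgue (\<lambda>y. \<kappa> (x - y) *\<^sub>R w y)"
proof -
  obtain M where "\<And>x. \<bar>\<kappa> x\<bar> \<le> M" using test_functions_bounded[OF assms(1)] by metis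
  then show ?thesis
    by (intro integrable_bounded_mult[OF _ _ assms(2), where M=M]
        continuous_reflect_measurable test_functions_continuous[OF assms(1)])
qed

text \<open>
  The remainder of the first order expansion is small uniformly in the base point, since
  the gradient is uniformly continuous.
\<close>

lemma test_function_linearization:
  fixes \<kappa> :: "'a::euclidean_space \<Rightarrow> real"
  assumes \<kappa>: "\<kappa> \<in> test_functions \<Omega>" and "e > 0"
  obtains d where "d > 0"
    "\<And>z h. norm h < d \<Longrightarrow> \<bar>\<kappa> (z + h) - \<kappa> z - h \<bullet> grad \<kappa> z\<bar> \<le> e * norm h"
proof -
  obtain K where K: "compact K" "\<And>x. x \<notin> K \<Longrightarrow> frechet_derivative \<kappa> (at x) = (\<lambda>h. 0)"
    using test_functionsE[OF \<kappa>] by metis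
  have "continuous_on UNIV (grad \<kappa>)"
    using Ck_on_continuous_grad[OF test_functions_Ck[OF \<kappa>, of "Suc 0"]] .
  from uniformly_continuous_compact_support[OF this K(1)]
  have "uniformly_continuous_on UNIV (grad \<kappa>)"
    using K(2) by (simp add: grad_def)
  then have "\<exists>d>0. \<forall>x y. dist y x < d \<longrightarrow> dist (grad \<kappa> y) (grad \<kappa> x) < e"
    using \<open>e > 0\<close> by (simp add: uniformly_continuous_on_def)
  then obtain d where d: "d > 0" "\<And>x y. dist y x < d \<Longrightarrow> dist (grad \<kappa> y) (grad \<kappa> x) < e"
    by auto
  show ?thesis
  proof (rule that[OF d(1)])
    fix z h :: 'a assume h: "norm h < d"
    have D: "((\<lambda>t. \<kappa> (z + t *\<^sub>R h) - t * (h \<bullet> grad \<kappa> z)) has_real_derivative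
        h \<bullet> (grad \<kappa> (z + t *\<^sub>R h) - grad \<kappa> z)) (at t)" for t
    proof -
      have "((\<lambda>t. \<kappa> (z + t *\<^sub>R h)) has_derivative
          (\<lambda>s. (s *\<^sub>R h) \<bullet> grad \<kappa> (z + t *\<^sub>R h))) (at t)"
        by (rule has_derivative_compose[OF _ has_derivative_grad[OF
                test_functions_differentiable[OF \<kappa>]]])
          (auto intro!: derivative_eq_intros)
      then have "((\<lambda>t. \<kappa> (z + t *\<^sub>R h)) has_real_derivative h \<bullet> grad \<kappa> (z + t *\<^sub>R h)) (at t)"
        by (simp add: has_field_derivative_def mult.commute[of _ "h \<bullet> _"])
      then show ?thesis
        by (auto intro!: derivative_eq_intros simp: inner_diff_right)
    qed
    obtain t where t: "0 < t" "t < 1"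
      "\<kappa> (z + 1 *\<^sub>R h) - 1 * (h \<bullet> grad \<kappa> z) - (\<kappa> (z + 0 *\<^sub>R h) - 0 * (h \<bullet> grad \<kappa> z))
        = (1 - 0) * (h \<bullet> (grad \<kappa> (z + t *\<^sub>R h) - grad \<kappa> z))"
      using MVT2[OF zero_less_one, of "\<lambda>t. \<kappa> (z + t *\<^sub>R h) - t * (h \<bullet> grad \<kappa> z)"
          "\<lambda>t. h \<bullet> (grad \<kappa> (z + t *\<^sub>R h) - grad \<kappa> z)"] D by blast
    have "dist (z + t *\<^sub>R h) z < d"
      using t h mult_left_le_one_le[of "norm h" t] by (simp add: dist_norm)
    then have "norm (grad \<kappa> (z + t *\<^sub>R h) - grad \<kappa> z) \<le> e"
      using d(2) by (fastforce simp: dist_norm)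
    then have "\<bar>h \<bullet> (grad \<kappa> (z + t *\<^sub>R h) - grad \<kappa> z)\<bar> \<le> norm h * e"
      using Cauchy_Schwarz_ineq2[of h "grad \<kappa> (z + t *\<^sub>R h) - grad \<kappa> z"]
      by (meson mult_left_mono norm_ge_zero order_trans)
    then show "\<bar>\<kappa> (z + h) - \<kappa> z - h \<bullet> grad \<kappa> z\<bar> \<le> e * norm h"
      using t(3) by (simp add: algebra_simps)
  qed
qed

text \<open>
  The uniform expansion of the kernel can be integrated against \<open>w\<close>; the error is at most
  \<open>e |h|\<close> times the integral of \<open>|w|\<close>.
\<close>

lemma conv_has_derivative:
  fixes w :: "'a::euclidean_space \<Rightarrow> real"
  assumes \<kappa>: "\<kappa> \<in> test_functions \<Omega>" and w: "integrable lebesgue w"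
  shows "(conv \<kappa> w has_derivative
    (\<lambda>h. h \<bullet> (\<Sum>b\<in>Basis. conv (\<lambda>z. frechet_derivative \<kappa> (at z) b) w x *\<^sub>R b))) (at x)"
    (is "(_ has_derivative ?D) _")
  unfolding has_derivative_at_alt
proof (intro conjI allI impI)
  show "bounded_linear ?D" by (rule bounded_linear_inner_left)
  fix e :: real assume "e > 0"
  let ?N = "LINT y|lebesgue. norm (w y)"
  have N: "?N \<ge> 0" by simp
  have "e / (?N + 1) > 0" using \<open>e > 0\<close> N by (simp add: add_nonneg_pos)
  then obtain d where d: "d > 0"
    "\<And>z h. norm h < d \<Longrightarrow> \<bar>\<kappa> (z + h) - \<kappa> z - h \<bullet> grad \<kappa> z\<bar> \<le> e / (?N + 1) * norm h"
    using test_function_linearization[OF \<kappa>] by metis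
  have D: "?D h = (LINT y|lebesgue. (h \<bullet> grad \<kappa> (x - y)) * w y)"
    and Di: "integrable lebesgue (\<lambda>y. (h \<bullet> grad \<kappa> (x - y)) * w y)" for h
  proof -
    have i: "integrable lebesgue (\<lambda>y. frechet_derivative \<kappa> (at (x - y)) b * w y)" if "b \<in> Basis" for b
      using conv_integrable[OF test_functions_partial[OF \<kappa> that] w, of x] by simp
    have eq: "(h \<bullet> grad \<kappa> (x - y)) * w y =
        (\<Sum>b\<in>Basis. (h \<bullet> b) * (frechet_derivative \<kappa> (at (x - y)) b * w y))" for y
      by (simp add: grad_def inner_sum_right sum_distrib_left sum_distrib_right mult_ac)
    show "integrable lebesgue (\<lambda>y. (h \<bullet> grad \<kappa> (x - y)) * w y)"
      unfolding eq by (intro Bochner_Integration.integrable_sum integrable_mult_right i)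
    have "(LINT y|lebesgue. (h \<bullet> grad \<kappa> (x - y)) * w y) =
        (\<Sum>b\<in>Basis. LINT y|lebesgue. (h \<bullet> b) * (frechet_derivative \<kappa> (at (x - y)) b * w y))"
      unfolding eq by (intro Bochner_Integration.integral_sum integrable_mult_right i)
    also have "\<dots> = ?D h"
      by (simp add: conv_def inner_sum_right mult.commute[of _ "h \<bullet> _"])
    finally show "?D h = (LINT y|lebesgue. (h \<bullet> grad \<kappa> (x - y)) * w y)" by simp
  qed
  show "\<exists>d>0. \<forall>y. norm (y - x) < d \<longrightarrow>
      norm (conv \<kappa> w y - conv \<kappa> w x - ?D (y - x)) \<le> e * norm (y - x)"
  proof (intro exI[of _ d] conjI allI impI d(1))
    fix z assume z: "norm (z - x) < d"
    let ?h = "z - x"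
    let ?r = "\<lambda>y. (\<kappa> (z - y) - \<kappa> (x - y) - ?h \<bullet> grad \<kappa> (x - y)) * w y"
    have i: "integrable lebesgue (\<lambda>y. \<kappa> (z - y) * w y)" "integrable lebesgue (\<lambda>y. \<kappa> (x - y) * w y)"
      using conv_integrable[OF \<kappa> w] by simp_all
    have ir: "integrable lebesgue ?r"
      unfolding left_diff_distrib by (intro Bochner_Integration.integrable_diff i Di)
    have "conv \<kappa> w z - conv \<kappa> w x - ?D ?h = (LINT y|lebesgue. ?r y)"
      unfolding D unfolding conv_def left_diff_distrib
      by (simp only: Bochner_Integration.integral_diff Bochner_Integration.integrable_diff
          i Di real_scaleR_def)
    then have "norm (conv \<kappa> w z - conv \<kappa> w x - ?D ?h) \<le> (LINT y|lebesgue. norm (?r y))"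
      by (simp only: integral_norm_bound)
    also have "\<dots> \<le> (LINT y|lebesgue. e / (?N + 1) * norm ?h * norm (w y))"
    proof (rule integral_mono)
      show "integrable lebesgue (\<lambda>y. norm (?r y))"
        by (rule integrable_norm[OF ir])
      show "integrable lebesgue (\<lambda>y. e / (?N + 1) * norm ?h * norm (w y))"
        by (intro integrable_mult_right integrable_norm w)
      fix y
      show "norm (?r y) \<le> e / (?N + 1) * norm ?h * norm (w y)"
        unfolding norm_mult
        by (rule mult_right_mono) (use d(2)[OF z, of "x - y"] in simp_all)
    qed
    also have "\<dots> = e / (?N + 1) * norm ?h * ?N"
      by (rule integral_mult_right_zero)
    also have "\<dots> = (e * norm ?h) * (?N / (?N + 1))"
      by (simp only: times_divide_eq_left times_divide_eq_right mult.assoc mult.commute)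
    also have "\<dots> \<le> (e * norm ?h) * 1"
      using \<open>e > 0\<close> N by (intro mult_left_mono) (simp_all add: divide_le_eq_1 add_nonneg_pos)
    finally show "norm (conv \<kappa> w z - conv \<kappa> w x - ?D ?h) \<le> e * norm ?h" by simp
  qed
qed

lemma frechet_derivative_conv:
  fixes w :: "'a::euclidean_space \<Rightarrow> real"
  assumes "\<kappa> \<in> test_functions \<Omega>" "integrable lebesgue w" "b \<in> Basis"
  shows "frechet_derivative (conv \<kappa> w) (at x) b = conv (\<lambda>z. frechet_derivative \<kappa> (at z) b) w x"
  by (subst frechet_derivative_at[OF conv_has_derivative[OF assms(1,2)], symmetric])
    (simp add: inner_sum_right inner_Basis assms(3) if_distrib cong: if_cong)

lemma Ck_on_conv:
  fixes w :: "'a::euclidean_space \<Rightarrow> real"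
  assumes "\<kappa> \<in> test_functions \<Omega>" "integrable lebesgue w"
  shows "Ck_on k (conv \<kappa> w) UNIV"
  using assms(1)
proof (induction k arbitrary: \<kappa>)
  case 0
  have "isCont (conv \<kappa> w) x" for x
    using has_derivative_continuous[OF conv_has_derivative[OF 0 assms(2)]] .
  then show ?case by (simp add: continuous_at_imp_continuous_on)
next
  case (Suc k)
  show ?case
    by (rule Ck_on_SucI[OF conv_has_derivative[OF Suc.prems assms(2)]])
      (simp add: frechet_derivative_conv[OF Suc.prems assms(2)]
        Suc.IH[OF test_functions_partial[OF Suc.prems]])
qed

lemma conv_inner:
  fixes w :: "'a::euclidean_space \<Rightarrow> 'b::euclidean_space"
  assumes "\<kappa> \<in> test_functions \<Omega>" "integrable lebesgue w"
  shows "conv \<kappa> w x \<bullet> b = conv \<kappa> (\<lambda>y. w y \<bullet> b) x"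
  unfolding conv_def
  using integral_inner_left[of b lebesgue "\<lambda>y. \<kappa> (x - y) *\<^sub>R w y"] conv_integrable[OF assms]
  by simp

lemma conv_measurable:
  fixes w :: "'a::euclidean_space \<Rightarrow> 'b::euclidean_space"
  assumes "\<kappa> \<in> test_functions \<Omega>" "integrable lebesgue w"
  shows "conv \<kappa> w \<in> borel_measurable lebesgue"
proof (subst borel_measurable_euclidean_space, intro ballI)
  fix b :: 'b
  have i: "integrable lebesgue (\<lambda>y. w y \<bullet> b)" using assms(2) by simp
  have "(\<lambda>x. conv \<kappa> w x \<bullet> b) = conv \<kappa> (\<lambda>y. w y \<bullet> b)"
    by (rule ext) (rule conv_inner[OF assms])
  then show "(\<lambda>x. conv \<kappa> w x \<bullet> b) \<in> borel_measurable lebesgue"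
    using Ck_on_imp_continuous_on[OF Ck_on_conv[OF assms(1) i, of 0]]
    by (simp add: borel_measurable_lebesgue_continuous)
qed

lemma conv_add:
  fixes v w :: "'a::euclidean_space \<Rightarrow> 'b::euclidean_space"
  assumes "\<kappa> \<in> test_functions \<Omega>" "integrable lebesgue v" "integrable lebesgue w"
  shows "conv \<kappa> (\<lambda>y. v y + w y) x = conv \<kappa> v x + conv \<kappa> w x"
  unfolding conv_def using conv_integrable[OF assms(1,2)] conv_integrable[OF assms(1,3)]
  by (simp add: scaleR_add_right)

section \<open>The standard kernel\<close>

definition bump :: "real \<Rightarrow> 'a::euclidean_space \<Rightarrow> real" where
  "bump \<epsilon> z = flat 0 (1 - (z \<bullet> z) / \<epsilon>\<^sup>2)"

definition mollifier :: "real \<Rightarrow> 'a::euclidean_space \<Rightarrow> real" where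
  "mollifier \<epsilon> z = bump \<epsilon> z / (LINT z|lebesgue. bump \<epsilon> (z::'a))"

lemma bump_eq_0: "\<epsilon> > 0 \<Longrightarrow> norm z \<ge> \<epsilon> \<Longrightarrow> bump \<epsilon> z = 0"
  unfolding bump_def
  by (rule flat_eq_0) (simp add: dot_square_norm power_mono)

lemma Ck_on_bump: "Ck_on k (\<lambda>y. bump \<epsilon> (y - x)) UNIV"
  unfolding bump_def
  by (rule Ck_on_compose_real[OF _ _ _ flat_smooth])
    (auto simp: divide_inverse intro!: Ck_on_diff Ck_on_const Ck_on_mult Ck_on_sq_dist)

lemma mollifier_test_function:
  assumes "\<epsilon> > 0" "cball x \<epsilon> \<subseteq> \<Omega>"
  shows "(\<lambda>y. mollifier \<epsilon> (y - x)) \<in> test_functions \<Omega>"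
  unfolding mollifier_def
proof (rule test_functionsI[OF _ compact_cball assms(2)])
  show "Ck_on k (\<lambda>y. bump \<epsilon> (y - x) / (LINT z|lebesgue. bump \<epsilon> (z::'a))) UNIV" for k
    by (auto simp: divide_inverse intro!: Ck_on_mult Ck_on_const Ck_on_bump)
qed (use assms in \<open>auto simp: bump_eq_0 dist_norm norm_minus_commute\<close>)

lemma mollifier_test_function_UNIV:
  "\<epsilon> > 0 \<Longrightarrow> mollifier \<epsilon> \<in> test_functions UNIV"
  using mollifier_test_function[of \<epsilon> 0 UNIV] by simp

lemma mollifier_minus: "mollifier \<epsilon> (- z) = mollifier \<epsilon> z"
  by (simp add: mollifier_def bump_def)

lemma mollifier_eq_0: "\<epsilon> > 0 \<Longrightarrow> norm z \<ge> \<epsilon> \<Longrightarrow> mollifier \<epsilon> z = 0"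
  by (simp add: mollifier_def bump_eq_0)

lemma bump_integrable: "\<epsilon> > 0 \<Longrightarrow> integrable lebesgue (bump \<epsilon> :: 'a::euclidean_space \<Rightarrow> real)"
  by (rule integrable_compact_support[OF _ compact_cball[of 0 \<epsilon>]])
    (use Ck_on_imp_continuous_on[OF Ck_on_bump[of 0 \<epsilon> 0]] in \<open>auto simp: bump_eq_0\<close>)

text \<open>
  On the ball of radius \<open>\<epsilon>/2\<close> the bump is at least \<open>exp(-4/3)\<close>, so its integral is at least a
  multiple of the volume \<open>\<epsilon>\<^bsup>n\<^esup>\<close> of that ball. This is what bounds the normalised kernel by a multiple
  of \<open>\<epsilon>\<^bsup>-n\<^esup>\<close>.
\<close>

lemma bump_integral_lower:
  obtains c where "c > 0"
    "\<And>\<epsilon>. \<epsilon> > 0 \<Longrightarrow> c * \<epsilon> ^ DIM('a) \<le> (LINT z|lebesgue. bump \<epsilon> (z::'a::euclidean_space))"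
proof
  let ?c = "flat 0 (3/4) * (unit_ball_vol (real DIM('a)) * (1/2) ^ DIM('a))"
  show "?c > 0" by (simp add: flat_pos unit_ball_vol_pos)
  fix \<epsilon> :: real assume "\<epsilon> > 0"
  have m: "measure lebesgue (ball (0::'a) (\<epsilon>/2)) = unit_ball_vol (real DIM('a)) * (\<epsilon>/2) ^ DIM('a)"
    using \<open>\<epsilon> > 0\<close> by (simp add: content_ball)
  have "?c * \<epsilon> ^ DIM('a) = flat 0 (3/4) * measure lebesgue (ball (0::'a) (\<epsilon>/2))"
    unfolding m by (simp add: power_divide power_one_over field_simps)
  also have "\<dots> = (LINT z|lebesgue. flat 0 (3/4) * indicator (ball (0::'a) (\<epsilon>/2)) z)"
    by simp
  also have "\<dots> \<le> (LINT z|lebesgue. bump \<epsilon> (z::'a))"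
  proof (rule integral_mono[OF _ bump_integrable[OF \<open>\<epsilon> > 0\<close>]])
    show "integrable lebesgue (\<lambda>z. flat 0 (3/4) * indicator (ball (0::'a) (\<epsilon>/2)) z :: real)"
      by (intro integrable_mult_right integrable_real_indicator)
        (use emeasure_lborel_ball_finite[of "0::'a" "\<epsilon>/2"] in \<open>auto simp: less_top\<close>)
    fix z :: 'a
    show "flat 0 (3/4) * indicator (ball 0 (\<epsilon>/2)) z \<le> bump \<epsilon> z"
    proof (cases "z \<in> ball 0 (\<epsilon>/2)")
      case True
      then have "norm z ^ 2 \<le> (\<epsilon>/2)^2" by (intro power_mono) auto
      then have "(z \<bullet> z) / \<epsilon>\<^sup>2 \<le> 1/4"
        using \<open>\<epsilon> > 0\<close> by (simp add: dot_square_norm power_divide field_simps)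
      then show ?thesis using True unfolding bump_def by (simp add: flat_mono)
    qed (simp add: bump_def flat_nonneg)
  qed
  finally show "?c * \<epsilon> ^ DIM('a) \<le> (LINT z|lebesgue. bump \<epsilon> (z::'a))" .
qed

lemma bump_integral_pos: "\<epsilon> > 0 \<Longrightarrow> (LINT z|lebesgue. bump \<epsilon> (z::'a::euclidean_space)) > 0"
  using bump_integral_lower[where 'a='a]
  by (metis mult_pos_pos order_less_le_trans zero_less_power)

lemma mollifier_nonneg: "mollifier \<epsilon> z \<ge> 0"
  unfolding mollifier_def bump_def
  by (intro divide_nonneg_nonneg Bochner_Integration.integral_nonneg flat_nonneg)

lemma mollifier_le:
  obtains M where "M > 0"
    "\<And>\<epsilon> z. \<epsilon> > 0 \<Longrightarrow> mollifier \<epsilon> (z::'a::euclidean_space) \<le> M / \<epsilon> ^ DIM('a)"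
proof -
  obtain c where c: "c > 0"
    "\<And>\<epsilon>. \<epsilon> > 0 \<Longrightarrow> c * \<epsilon> ^ DIM('a) \<le> (LINT z|lebesgue. bump \<epsilon> (z::'a))"
    using bump_integral_lower[where 'a='a] by metis
  have "mollifier \<epsilon> z \<le> (1 / c) / \<epsilon> ^ DIM('a)" if "\<epsilon> > 0" for \<epsilon> and z :: 'a
  proof -
    have "bump \<epsilon> z \<le> 1"
      using flat_le[of 0] by (simp add: bump_def)
    then have "mollifier \<epsilon> z \<le> 1 / (LINT z|lebesgue. bump \<epsilon> (z::'a))"
      unfolding mollifier_def
      by (rule divide_right_mono) (rule less_imp_le[OF bump_integral_pos[OF that]])
    also have "\<dots> \<le> 1 / (c * \<epsilon> ^ DIM('a))"
      using c that by (intro divide_left_mono) (auto intro!: mult_pos_pos bump_integral_pos)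
    finally show ?thesis by simp
  qed
  then show ?thesis using that[of "1 / c"] c(1) by simp
qed

lemma lborel_distr_reflect:
  "distr lborel borel (\<lambda>y. x - y) = (lborel :: 'a::euclidean_space measure)"
proof -
  show ?thesis
    using lborel_affine[of "-1" x] by (simp add: density_1)
qed

lemma integral_reflect_translate:
  fixes f :: "'a::euclidean_space \<Rightarrow> real"
  assumes "continuous_on UNIV f"
  shows "(LINT y|lebesgue. f (x - y)) = (LINT y|lebesgue. f y)"
proof -
  have m: "f \<in> borel_measurable borel" "(\<lambda>y. f (x - y)) \<in> borel_measurable borel"
    by (auto intro!: borel_measurable_continuous_onI assms continuous_on_compose2[OF assms]
        continuous_intros)
  have "(LINT y|lborel. f y) = (LINT y|distr lborel borel (\<lambda>y. x - y). f y)"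
    by (simp add: lborel_distr_reflect)
  also have "\<dots> = (LINT y|lborel. f (x - y))"
    by (rule integral_distr) (use m in auto)
  finally show ?thesis using m by (simp add: integral_completion)
qed

lemma mollifier_integral:
  fixes x y :: "'a::euclidean_space"
  assumes "\<epsilon> > 0"
  shows "(LINT y|lebesgue. mollifier \<epsilon> (x - y)) = 1"
    and "(LINT x|lebesgue. mollifier \<epsilon> (x - y)) = 1"
proof -
  have 1: "(LINT y|lebesgue. mollifier \<epsilon> (y::'a)) = 1"
    unfolding mollifier_def using bump_integral_pos[OF assms, where 'a='a] by simp
  have 2: "(LINT y|lebesgue. mollifier \<epsilon> (x - y)) = 1" for x :: 'a
    using integral_reflect_translate[OF
        test_functions_continuous[OF mollifier_test_function_UNIV[OF assms]], of x] 1 by simp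
  then show "(LINT y|lebesgue. mollifier \<epsilon> (x - y)) = 1" .
  show "(LINT x|lebesgue. mollifier \<epsilon> (x - y)) = 1"
    using 2[of y] mollifier_minus[of \<epsilon> "y - _"] by simp
qed

lemma mollifier_shift_integrable:
  assumes "\<epsilon> > 0"
  shows "integrable lebesgue (\<lambda>y. mollifier \<epsilon> (x - y :: 'a::euclidean_space))"
proof -
  have t: "(\<lambda>y. mollifier \<epsilon> (y - x)) \<in> test_functions UNIV"
    by (rule mollifier_test_function[OF assms]) simp
  have "integrable lebesgue (\<lambda>y. mollifier \<epsilon> (y - x))"
    by (rule integrable_compact_support[OF test_functions_continuous[OF t] compact_cball[of x \<epsilon>]])
      (use assms in \<open>simp add: mollifier_eq_0 dist_norm norm_minus_commute\<close>)
  then show ?thesis using mollifier_minus[of \<epsilon> "x - _"] by simp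
qed

text \<open>
  The mollification is an average with weights of total mass one over the ball of radius \<open>\<epsilon>\<close>.
\<close>

lemma mollification_close:
  fixes w :: "'a::euclidean_space \<Rightarrow> 'b::euclidean_space"
  assumes "\<epsilon> > 0" and w: "integrable lebesgue w"
    and e: "\<And>y. y \<in> cball x \<epsilon> \<Longrightarrow> norm (w y - c) \<le> e"
  shows "norm (conv (mollifier \<epsilon>) w x - c) \<le> e"
proof -
  note i = mollifier_shift_integrable[OF assms(1), of x]
  note iw = conv_integrable[OF mollifier_test_function_UNIV[OF assms(1)] w, of x]
  have ic: "integrable lebesgue (\<lambda>y. mollifier \<epsilon> (x - y) *\<^sub>R c)" using i by simp
  have "(LINT y|lebesgue. mollifier \<epsilon> (x - y) *\<^sub>R c) = c"
    using i mollifier_integral(1)[OF assms(1), of x] by simp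
  then have "conv (mollifier \<epsilon>) w x - c = (LINT y|lebesgue. mollifier \<epsilon> (x - y) *\<^sub>R (w y - c))"
    unfolding conv_def scaleR_diff_right
    by (subst Bochner_Integration.integral_diff[OF iw ic]) simp
  then have "norm (conv (mollifier \<epsilon>) w x - c) \<le>
      (LINT y|lebesgue. norm (mollifier \<epsilon> (x - y) *\<^sub>R (w y - c)))"
    by (simp only: integral_norm_bound)
  also have "\<dots> \<le> (LINT y|lebesgue. mollifier \<epsilon> (x - y) * e)"
  proof (rule integral_mono)
    show "integrable lebesgue (\<lambda>y. norm (mollifier \<epsilon> (x - y) *\<^sub>R (w y - c)))"
      using Bochner_Integration.integrable_diff[OF iw ic]
      by (intro integrable_norm) (simp add: scaleR_diff_right)
    show "integrable lebesgue (\<lambda>y. mollifier \<epsilon> (x - y) * e)" using i by simp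
    fix y
    show "norm (mollifier \<epsilon> (x - y) *\<^sub>R (w y - c)) \<le> mollifier \<epsilon> (x - y) * e"
    proof (cases "y \<in> cball x \<epsilon>")
      case True
      then show ?thesis using e[OF True] mollifier_nonneg[of \<epsilon> "x - y"]
        by (simp add: mult_left_mono)
    next
      case False
      then show ?thesis using mollifier_eq_0[OF assms(1), of "x - y"] by (simp add: dist_norm)
    qed
  qed
  also have "\<dots> = e" using mollifier_integral(1)[OF assms(1), of x] by simp
  finally show ?thesis .
qed

text \<open>
  For fixed \<open>x\<close> the function \<open>y \<mapsto> \<eta>\<^sub>\<epsilon>(x - y)\<close> is a test function, with support in the ball of radius
  \<open>\<epsilon>\<close> around \<open>x\<close>. Inserting it into the definition of the weak gradient moves the derivative from the
  kernel to \<open>w\<close>; values of \<open>w\<close> and \<open>V\<close> outside \<open>S\<close> are not seen.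
\<close>

lemma weak_gradient_mollification:
  fixes w :: "'a::euclidean_space \<Rightarrow> real"
  assumes \<epsilon>: "\<epsilon> > 0" and W: "weak_gradient \<Omega> w V" and S: "cball x \<epsilon> \<subseteq> S" "S \<subseteq> \<Omega>" "\<Omega> \<in> sets lebesgue"
    and b: "b \<in> Basis"
  shows "conv (\<lambda>z. frechet_derivative (mollifier \<epsilon>) (at z) b) (\<lambda>y. if y \<in> S then w y else 0) x
       = conv (mollifier \<epsilon>) (\<lambda>y. if y \<in> S then V y \<bullet> b else 0) x"
proof -
  let ?\<phi> = "\<lambda>y. mollifier \<epsilon> (y - x)"
  have \<phi>: "?\<phi> \<in> test_functions \<Omega>"
    using mollifier_test_function[OF \<epsilon>, of x \<Omega>] S by blast
  note \<eta> = mollifier_test_function_UNIV[OF \<epsilon>, where 'a='a]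
  have sym: "?\<phi> = (\<lambda>y. mollifier \<epsilon> (x - y))"
    using mollifier_minus[of \<epsilon> "x - _"] by auto
  have "((\<lambda>y. mollifier \<epsilon> (x - y)) has_derivative
      (\<lambda>h. frechet_derivative (mollifier \<epsilon>) (at (x - y)) (- h))) (at y)" for y
    by (rule has_derivative_compose[OF _ iffD1[OF frechet_derivative_works
        test_functions_differentiable[OF \<eta>]]]) (auto intro!: derivative_eq_intros)
  then have d: "frechet_derivative ?\<phi> (at y) b = - frechet_derivative (mollifier \<epsilon>) (at (x - y)) b" for y
    unfolding sym
    using frechet_derivative_at linear_neg[OF linear_frechet_derivative[OF
        test_functions_differentiable[OF \<eta>]]] by metis
  have off: "?\<phi> y = 0" "frechet_derivative ?\<phi> (at y) b = 0" if "y \<notin> S" for y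
  proof -
    have *: "mollifier \<epsilon> (z - x) = 0" if "z \<notin> cball x \<epsilon>" for z
      using that mollifier_eq_0[OF \<epsilon>, of "z - x"] by (simp add: dist_norm norm_minus_commute)
    have "y \<notin> cball x \<epsilon>" using that S by blast
    then show "?\<phi> y = 0" "frechet_derivative ?\<phi> (at y) b = 0"
      using * frechet_derivative_at[OF has_derivative_0_off_closed[OF closed_cball *, where x=y]]
      by (auto simp: fun_eq_iff)
  qed
  have "(LINT y|lebesgue_on \<Omega>. w y * frechet_derivative ?\<phi> (at y) b)
      = - (LINT y|lebesgue_on \<Omega>. (V y \<bullet> b) * ?\<phi> y)"
    using W \<phi> b unfolding weak_gradient_def by blast
  moreover have "(LINT y|lebesgue_on \<Omega>. w y * frechet_derivative ?\<phi> (at y) b)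
      = - conv (\<lambda>z. frechet_derivative (mollifier \<epsilon>) (at z) b) (\<lambda>y. if y \<in> S then w y else 0) x"
    unfolding lebesgue_on_integral_eq[OF S(3)] conv_def
    by (subst Bochner_Integration.integral_minus[symmetric])
      (rule Bochner_Integration.integral_cong, use d off S in \<open>auto\<close>)
  moreover have "(LINT y|lebesgue_on \<Omega>. (V y \<bullet> b) * ?\<phi> y)
      = conv (mollifier \<epsilon>) (\<lambda>y. if y \<in> S then V y \<bullet> b else 0) x"
    unfolding lebesgue_on_integral_eq[OF S(3)] conv_def
    by (rule Bochner_Integration.integral_cong)
      (use off S mollifier_minus[of \<epsilon> "x - _"] in auto)
  ultimately show ?thesis by simp
qed

section \<open>Mollification in variable exponent spaces\<close>

text \<open>
  The radial retraction of the space onto the ball of radius \<open>M\<close>. Unlike cutting off to zero it is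
  continuous, so that it turns continuous approximations into bounded continuous ones.
\<close>

definition clip :: "real \<Rightarrow> 'b::euclidean_space \<Rightarrow> 'b" where
  "clip M v = (M / max M (norm v)) *\<^sub>R v"

lemma continuous_on_clip: "M > 0 \<Longrightarrow> continuous_on UNIV (clip M)"
  unfolding clip_def by (intro continuous_intros) auto

lemma norm_clip_le: "M > 0 \<Longrightarrow> norm (clip M v) \<le> M"
  by (auto simp: clip_def max_def field_simps)

lemma clip_eq: "M > 0 \<Longrightarrow> norm v \<le> M \<Longrightarrow> clip M v = v"
  by (simp add: clip_def max_def)

lemma norm_diff_clip_le:
  assumes "M > 0"
  shows "norm (v - clip M v) \<le> norm v"
proof -
  let ?t = "M / max M (norm v)"
  have "0 \<le> ?t" "?t \<le> 1" using assms by auto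
  have "v - clip M v = (1 - ?t) *\<^sub>R v" by (simp add: clip_def scaleR_diff_left)
  also have "norm \<dots> = (1 - ?t) * norm v" using \<open>?t \<le> 1\<close> by simp
  also have "\<dots> \<le> 1 * norm v" using \<open>0 \<le> ?t\<close> by (intro mult_right_mono) auto
  finally show ?thesis by simp
qed

lemma powr_add_le:
  fixes a b :: real
  assumes "0 \<le> a" "0 \<le> b" "1 \<le> p" "p \<le> P"
  shows "(a + b) powr p \<le> 2 powr P * (a powr p + b powr p)"
proof -
  have "(a + b) powr p \<le> (2 * max a b) powr p"
    using assms by (intro powr_mono2) auto
  also have "\<dots> = 2 powr p * max a b powr p"
    using assms by (simp add: powr_mult)
  also have "\<dots> \<le> 2 powr P * (a powr p + b powr p)"
    using assms by (intro mult_mono) (auto simp: max_def)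
  finally show ?thesis .
qed

lemma powr_tendsto_0:
  fixes f :: "nat \<Rightarrow> real"
  assumes "f \<longlonglongrightarrow> 0" "\<And>n. f n \<ge> 0" "p \<ge> 1"
  shows "(\<lambda>n. f n powr p) \<longlonglongrightarrow> 0"
  using tendsto_powr'[OF assms(1) tendsto_const[of p]] assms by simp

lemma dominated_integral_less:
  fixes f :: "nat \<Rightarrow> 'a \<Rightarrow> real"
  assumes "\<And>n. f n \<in> borel_measurable M" "integrable M g"
    and "\<And>n x. 0 \<le> f n x" "\<And>n x. f n x \<le> g x"
    and "AE x in M. (\<lambda>n. f n x) \<longlonglongrightarrow> 0" and "e > 0"
  obtains n where "integrable M (f n)" "(LINT x|M. f n x) < e"
proof -
  have "norm (f n x) \<le> norm (g x)" for n x
    using assms(3)[of n x] assms(4)[of n x] by simp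
  then have 1: "integrable M (f n)" for n
    by (intro Bochner_Integration.integrable_bound[OF assms(2) assms(1)] AE_I2)
  have "(\<lambda>n. LINT x|M. f n x) \<longlonglongrightarrow> (LINT x|M. 0)"
    by (rule integral_dominated_convergence[where w=g])
      (use assms in \<open>auto\<close>)
  then have "\<forall>\<^sub>F n in sequentially. (LINT x|M. f n x) < e"
    using assms(6) by (intro order_tendstoD(2)) auto
  then show ?thesis using 1 that by (auto simp: eventually_sequentially)
qed

text \<open>
  Two dominated limits: first clip \<open>V\<close> at a high level, dominated by \<open>|V|\<^bsup>p\<^esup>\<close>; then replace the clipped
  function by clipped continuous functions that converge to it almost everywhere, dominated by a
  constant on the set \<open>S\<close> of finite measure.
\<close>

lemma modular_dense_continuous:
  fixes V :: "'a::euclidean_space \<Rightarrow> 'b::euclidean_space"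
  assumes S: "S \<in> lmeasurable"
    and V: "V \<in> borel_measurable lebesgue"
    and p: "p \<in> borel_measurable lebesgue" "\<And>x. 1 \<le> p x" "\<And>x. p x \<le> P"
    and int: "integrable lebesgue (\<lambda>x. indicator S x * norm (V x) powr p x)"
    and "\<delta> > 0"
  obtains g where "continuous_on UNIV g"
    "integrable lebesgue (\<lambda>x. indicator S x * norm (V x - g x) powr p x)"
    "(LINT x|lebesgue. indicator S x * norm (V x - g x) powr p x) < \<delta>"
proof -
  have Sm [measurable]: "S \<in> sets lebesgue" using S by auto
  note [measurable] = V p(1)
  have cm: "(\<lambda>x. clip M (f x)) \<in> borel_measurable lebesgue"
    if "f \<in> borel_measurable lebesgue" "M > 0" for f :: "'a \<Rightarrow> 'b" and M
    using measurable_compose[OF that(1)]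
      borel_measurable_continuous_onI[OF continuous_on_clip[OF that(2)]] by blast
  define \<delta>' where "\<delta>' = \<delta> / (2 * 2 powr P)"
  have \<delta>': "\<delta>' > 0" using \<open>\<delta> > 0\<close> by (simp add: \<delta>'_def)
  let ?a = "\<lambda>n x. indicator S x * norm (V x - clip (real (Suc n)) (V x)) powr p x"
  obtain m where m: "integrable lebesgue (?a m)" "(LINT x|lebesgue. ?a m x) < \<delta>'"
  proof (rule dominated_integral_less[of ?a, OF _ int _ _ _ \<delta>'])
    show "?a n \<in> borel_measurable lebesgue" for n
      using cm[OF V, of "real (Suc n)"] by (simp del: of_nat_Suc)
    show "0 \<le> ?a n x" for n x by simp
    show "?a n x \<le> indicator S x * norm (V x) powr p x" for n x
      using p(2)[of x] by (intro mult_left_mono powr_mono2 norm_diff_clip_le) auto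
    show "AE x in lebesgue. (\<lambda>n. ?a n x) \<longlonglongrightarrow> 0"
    proof (intro AE_I2 tendsto_eventually)
      fix x
      obtain k :: nat where k: "norm (V x) \<le> real k" using real_arch_simple by blast
      have "?a n x = 0" if "n \<ge> k" for n
        using k that by (simp add: clip_eq)
      then show "\<forall>\<^sub>F n in sequentially. ?a n x = 0"
        by (auto simp: eventually_sequentially)
    qed
  qed
  define M where "M = real (Suc m)"
  have M: "M \<ge> 1" "M > 0" by (auto simp: M_def)
  have "V measurable_on UNIV" using V by (intro lebesgue_measurable_imp_measurable_on) auto
  then obtain Z g where Z: "negligible Z" and g: "\<And>n. continuous_on UNIV (g n)"
    and lim: "\<And>x. x \<notin> Z \<Longrightarrow> (\<lambda>n. g n x) \<longlonglongrightarrow> V x"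
    unfolding measurable_on_def by auto
  have cg: "continuous_on UNIV (\<lambda>x. clip M (g n x))" for n
    by (rule continuous_on_compose2[OF continuous_on_clip[OF M(2)] g]) auto
  let ?b = "\<lambda>n x. indicator S x * norm (clip M (V x) - clip M (g n x)) powr p x"
  obtain k where k: "integrable lebesgue (?b k)" "(LINT x|lebesgue. ?b k x) < \<delta>'"
  proof (rule dominated_integral_less[of ?b _ "\<lambda>x. (2 * M) powr P * indicator S x", OF _ _ _ _ _ \<delta>'])
    show "?b n \<in> borel_measurable lebesgue" for n
      using cm[OF V M(2)] borel_measurable_lebesgue_continuous[OF cg, of n] by simp
    show "integrable lebesgue (\<lambda>x. (2 * M) powr P * indicator S x)"
      using S by (intro integrable_mult_right integrable_real_indicator) (auto simp: fmeasurable_def)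
    show "0 \<le> ?b n x" for n x by simp
    show "?b n x \<le> (2 * M) powr P * indicator S x" for n x
    proof -
      have "norm (clip M (V x) - clip M (g n x)) \<le> 2 * M"
        using norm_triangle_ineq4[of "clip M (V x)" "clip M (g n x)"]
          norm_clip_le[OF M(2), of "V x"] norm_clip_le[OF M(2), of "g n x"] by linarith
      then have "norm (clip M (V x) - clip M (g n x)) powr p x \<le> (2 * M) powr p x"
        using p(2)[of x] by (intro powr_mono2) auto
      also have "\<dots> \<le> (2 * M) powr P" using M p(3)[of x] by (intro powr_mono) auto
      finally show ?thesis by (auto simp: indicator_def)
    qed
    have "AE x in lebesgue. x \<notin> Z"
      using Z by (simp add: AE_not_in negligible_iff_null_sets)
    then show "AE x in lebesgue. (\<lambda>n. ?b n x) \<longlonglongrightarrow> 0"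
    proof eventually_elim
      case (elim x)
      have "isCont (clip M) (V x)"
        by (rule continuous_on_interior[OF continuous_on_clip[OF M(2)]]) simp
      then have "(\<lambda>n. clip M (g n x)) \<longlonglongrightarrow> clip M (V x)"
        using lim[OF elim] by (rule isCont_tendsto_compose)
      then have "(\<lambda>n. clip M (V x) - clip M (g n x)) \<longlonglongrightarrow> clip M (V x) - clip M (V x)"
        by (intro tendsto_diff tendsto_const)
      then have "(\<lambda>n. norm (clip M (V x) - clip M (g n x))) \<longlonglongrightarrow> 0"
        by (simp add: tendsto_norm_zero_iff)
      from tendsto_mult_right_zero[OF powr_tendsto_0[OF this _ p(2)], of "indicator S x" x]
      show ?case by simp
    qed
  qed
  let ?g = "\<lambda>x. clip M (g k x)"
  let ?c = "\<lambda>x. indicator S x * norm (V x - ?g x) powr p x"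
  have le: "?c x \<le> 2 powr P * (?a m x + ?b k x)" for x
  proof -
    have "norm (V x - ?g x) \<le> norm (V x - clip M (V x)) + norm (clip M (V x) - ?g x)"
      using norm_triangle_ineq[of "V x - clip M (V x)" "clip M (V x) - ?g x"] by simp
    then have "norm (V x - ?g x) powr p x \<le>
        (norm (V x - clip M (V x)) + norm (clip M (V x) - ?g x)) powr p x"
      using p(2)[of x] by (intro powr_mono2) auto
    also have "\<dots> \<le> 2 powr P *
        (norm (V x - clip M (V x)) powr p x + norm (clip M (V x) - ?g x) powr p x)"
      by (intro powr_add_le p) auto
    finally show ?thesis by (auto simp: indicator_def M_def)
  qed
  have ci: "integrable lebesgue (\<lambda>x. 2 powr P * (?a m x + ?b k x))"
    using m(1) k(1) by simp
  show ?thesis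
  proof (rule that[OF cg])
    have "?c \<in> borel_measurable lebesgue"
      using borel_measurable_lebesgue_continuous[OF cg, of k] by simp
    then show i: "integrable lebesgue ?c"
      by (rule Bochner_Integration.integrable_bound[OF ci]) (use le in \<open>fastforce intro: AE_I2\<close>)
    have "(LINT x|lebesgue. ?c x) \<le> (LINT x|lebesgue. 2 powr P * (?a m x + ?b k x))"
      by (rule integral_mono[OF i ci le])
    also have "\<dots> = 2 powr P * ((LINT x|lebesgue. ?a m x) + (LINT x|lebesgue. ?b k x))"
      using m(1) k(1) by simp
    also have "\<dots> < 2 powr P * (\<delta>' + \<delta>')"
      using m(2) k(2) by (intro mult_strict_left_mono add_strict_mono) auto
    also have "\<dots> = \<delta>" by (simp add: \<delta>'_def)
    finally show "(LINT x|lebesgue. ?c x) < \<delta>" .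
  qed
qed

text \<open>
  If \<open>r \<le> s N\<close>, the first term on the right suffices; otherwise \<open>N < r / s\<close> and the second one does.
\<close>

lemma young_powr:
  fixes N r s p P :: real
  assumes "N \<ge> 0" "r \<ge> 0" "0 < s" "s \<le> 1" "1 \<le> p" "p \<le> P"
  shows "N powr (p - 1) * r \<le> s * N powr p + s powr (- P) * r powr p"
proof (cases "r \<le> s * N")
  case True
  have "N powr (p - 1) * r \<le> N powr (p - 1) * (s * N)"
    using True by (intro mult_left_mono) auto
  also have "\<dots> = s * N powr p"
    using assms by (cases "N = 0") (auto simp: powr_diff)
  also have "\<dots> \<le> s * N powr p + s powr (- P) * r powr p" by simp
  finally show ?thesis .
next
  case False
  then have r: "r > 0" using assms by (smt (verit) mult_nonneg_nonneg)
  have "N powr (p - 1) * r \<le> (r / s) powr (p - 1) * r"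
    using False assms by (intro mult_right_mono powr_mono2) (auto simp: field_simps)
  also have "\<dots> = s powr (1 - p) * r powr p"
    using r assms by (simp add: powr_divide powr_diff field_simps)
  also have "\<dots> \<le> s powr (- P) * r powr p"
    using assms by (intro mult_right_mono powr_mono') auto
  also have "\<dots> \<le> s * N powr p + s powr (- P) * r powr p"
    using assms by simp
  finally show ?thesis .
qed

text \<open>
  Tonelli's theorem and the unit mass of the kernel. The product measure theory needs Borel
  functions, so \<open>h\<close> is first replaced by a Borel function equal to it almost everywhere.
\<close>

lemma conv_nonneg_integral:
  fixes h :: "'a::euclidean_space \<Rightarrow> real"
  assumes \<epsilon>: "\<epsilon> > 0" and h: "integrable lebesgue h" "\<And>x. h x \<ge> 0"
  shows "integrable lebesgue (conv (mollifier \<epsilon>) h)"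
    and "(LINT x|lebesgue. conv (mollifier \<epsilon>) h x) = (LINT x|lebesgue. h x)"
proof -
  note \<eta> = mollifier_test_function_UNIV[OF \<epsilon>, where 'a='a]
  have \<eta>m [measurable]: "(mollifier \<epsilon> :: 'a \<Rightarrow> real) \<in> borel_measurable borel"
    by (intro borel_measurable_continuous_onI test_functions_continuous[OF \<eta>])
  have [measurable]: "h \<in> borel_measurable lebesgue" using h(1) by auto
  obtain h' where h'm [measurable]: "h' \<in> borel_measurable lborel" and ae: "AE x in lborel. h x = h' x"
    using completion_ex_borel_measurable_real[of h lborel] h(1) by auto
  have c: "ennreal (conv (mollifier \<epsilon>) h x) =
      (\<integral>\<^sup>+y. ennreal (mollifier \<epsilon> (x - y)) * ennreal (h' y) \<partial>lborel)" for x
  proof -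
    have "ennreal (conv (mollifier \<epsilon>) h x) = (\<integral>\<^sup>+y. ennreal (mollifier \<epsilon> (x - y) * h y) \<partial>lebesgue)"
      unfolding conv_def real_scaleR_def
      by (rule nn_integral_eq_integral[symmetric])
        (use conv_integrable[OF \<eta> h(1), of x] in
          \<open>auto intro!: AE_I2 mult_nonneg_nonneg mollifier_nonneg h(2)\<close>)
    also have "\<dots> = (\<integral>\<^sup>+y. ennreal (mollifier \<epsilon> (x - y) * h y) \<partial>lborel)"
      by (rule nn_integral_completion)
    also have "\<dots> = (\<integral>\<^sup>+y. ennreal (mollifier \<epsilon> (x - y)) * ennreal (h' y) \<partial>lborel)"
      by (rule nn_integral_cong_AE)
        (use ae in eventually_elim, simp add: ennreal_mult mollifier_nonneg h(2) flip: ennreal_mult')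
    finally show ?thesis .
  qed
  have one: "(\<integral>\<^sup>+x. ennreal (mollifier \<epsilon> (x - y)) \<partial>lborel) = 1" for y :: 'a
  proof -
    have "integrable lebesgue (\<lambda>x. mollifier \<epsilon> (x - y))"
      using mollifier_shift_integrable[OF \<epsilon>, of y] mollifier_minus[of \<epsilon> "y - _"] by simp
    then have "(\<integral>\<^sup>+x. ennreal (mollifier \<epsilon> (x - y)) \<partial>lebesgue) = ennreal 1"
      using mollifier_integral(2)[OF \<epsilon>, of y] mollifier_nonneg
      by (subst nn_integral_eq_integral) auto
    then show ?thesis by (simp add: nn_integral_completion)
  qed
  have "(\<integral>\<^sup>+x. ennreal (conv (mollifier \<epsilon>) h x) \<partial>lebesgue) =
      (\<integral>\<^sup>+x. (\<integral>\<^sup>+y. ennreal (mollifier \<epsilon> (x - y)) * ennreal (h' y) \<partial>lborel) \<partial>lborel)"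
    by (simp add: c nn_integral_completion)
  also have "\<dots> = (\<integral>\<^sup>+y. (\<integral>\<^sup>+x. ennreal (mollifier \<epsilon> (x - y)) * ennreal (h' y) \<partial>lborel) \<partial>lborel)"
    by (rule lborel_pair.Fubini') measurable
  also have "\<dots> = (\<integral>\<^sup>+y. ennreal (h' y) \<partial>lborel)"
    by (simp add: nn_integral_multc one)
  also have "\<dots> = (\<integral>\<^sup>+y. ennreal (h y) \<partial>lborel)"
    by (rule nn_integral_cong_AE) (use ae in eventually_elim, simp)
  also have "\<dots> = (\<integral>\<^sup>+y. ennreal (h y) \<partial>lebesgue)"
    by (simp add: nn_integral_completion)
  also have "\<dots> = ennreal (LINT x|lebesgue. h x)"
    using h by (intro nn_integral_eq_integral) auto
  finally have eq: "(\<integral>\<^sup>+x. ennreal (conv (mollifier \<epsilon>) h x) \<partial>lebesgue) = ennreal (LINT x|lebesgue. h x)" .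
  have nn: "conv (mollifier \<epsilon>) h x \<ge> 0" for x
    unfolding conv_def
    by (intro Bochner_Integration.integral_nonneg) (simp add: mollifier_nonneg h(2))
  show 1: "integrable lebesgue (conv (mollifier \<epsilon>) h)"
    by (rule integrableI_nonneg) (use conv_measurable[OF \<eta> h(1)] nn eq in \<open>auto\<close>)
  have "ennreal (LINT x|lebesgue. conv (mollifier \<epsilon>) h x) = ennreal (LINT x|lebesgue. h x)"
    using eq nn by (subst nn_integral_eq_integral[symmetric, OF 1]) auto
  then show "(LINT x|lebesgue. conv (mollifier \<epsilon>) h x) = (LINT x|lebesgue. h x)"
    using nn h(2) by (subst (asm) ennreal_inj) (auto intro!: Bochner_Integration.integral_nonneg)
qed

text \<open>
  Here \<open>|ln a| \<le> ln M + n ln(1/\<epsilon>)\<close>, and multiplication by \<open>|d| \<le> K \<epsilon>\<close> absorbs the logarithm because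
  \<open>\<epsilon> ln(1/\<epsilon>) \<le> 1\<close>. This is the point where the regularity of the exponent enters.
\<close>

lemma powr_exponent_shift_le:
  fixes a d \<epsilon> K M :: real
  assumes "0 < \<epsilon>" "\<epsilon> \<le> 1" "1 \<le> M" "\<epsilon> \<le> a" "a \<le> M / \<epsilon> ^ n" "n \<ge> 1" "\<bar>d\<bar> \<le> K * \<epsilon>"
  shows "a powr d \<le> exp (K * (ln M + real n))"
proof -
  have a: "a > 0" using assms by linarith
  have K: "K \<ge> 0" using assms(1,7) by (smt (verit) mult_neg_pos)
  have le: "ln (1 / \<epsilon>) \<ge> 0" using assms by (simp add: ln_div)
  have "ln a \<le> ln (M / \<epsilon> ^ n)" using assms a by simp
  also have "\<dots> = ln M + real n * ln (1 / \<epsilon>)"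
    using assms by (simp add: ln_div ln_realpow)
  finally have up: "ln a \<le> ln M + real n * ln (1 / \<epsilon>)" .
  have "- ln a \<le> ln (1 / \<epsilon>)" using assms a by (simp add: ln_div)
  also have "\<dots> \<le> real n * ln (1 / \<epsilon>)"
    using mult_right_mono[of 1 "real n", OF _ le] assms(6) by simp
  also have "\<dots> \<le> ln M + real n * ln (1 / \<epsilon>)" using assms(3) by simp
  finally have "\<bar>ln a\<bar> \<le> ln M + real n * ln (1 / \<epsilon>)" using up by linarith
  then have "\<bar>d\<bar> * \<bar>ln a\<bar> \<le> (K * \<epsilon>) * (ln M + real n * ln (1 / \<epsilon>))"
    using assms(7) by (intro mult_mono) auto
  also have "\<dots> = K * (\<epsilon> * ln M + real n * (\<epsilon> * ln (1 / \<epsilon>)))"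
    by (simp add: algebra_simps)
  also have "\<dots> \<le> K * (ln M + real n * 1)"
  proof (intro mult_left_mono[OF _ K] add_mono mult_left_mono)
    show "\<epsilon> * ln M \<le> ln M" using assms by (simp add: mult_left_le_one_le)
    have "\<epsilon> * ln (1 / \<epsilon>) \<le> \<epsilon> * (1 / \<epsilon> - 1)"
      using assms by (intro mult_left_mono ln_le_minus_one) auto
    also have "\<dots> \<le> 1" using assms by (simp add: field_simps)
    finally show "\<epsilon> * ln (1 / \<epsilon>) \<le> 1" .
  qed auto
  finally have "\<bar>d * ln a\<bar> \<le> K * (ln M + real n)" by (simp add: abs_mult)
  then show ?thesis using a by (simp add: powr_def abs_le_iff)
qed

text \<open>
  A substitute for Jensen's inequality that tolerates an exponent varying over the ball of averaging.
  Let \<open>a\<close> be half the modulus of the mollification at \<open>x\<close>. For every \<open>y\<close> one has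
  \<open>|R y| \<le> a + |R y|\<^bsup>p(y)\<^esup> a\<^bsup>1-p(y)\<^esup>\<close>; if \<open>a > \<epsilon>\<close>, then \<open>a\<^bsup>1-p(y)\<^esup>\<close> may be replaced by
  \<open>C a\<^bsup>1-p(x)\<^esup>\<close>. After averaging, the term \<open>a\<close> is absorbed on the left, and what remains is the bound for
  \<open>a\<^bsup>p(x)\<^esup>\<close>. If \<open>a \<le> \<epsilon>\<close>, then \<open>a\<^bsup>p(x)\<^esup> \<le> \<epsilon>\<close> because \<open>p(x) \<ge> 1\<close>.
\<close>

lemma mollification_powr_le:
  fixes R :: "'a::euclidean_space \<Rightarrow> 'b::euclidean_space"
  assumes \<epsilon>: "0 < \<epsilon>" "\<epsilon> \<le> 1"
    and p: "\<And>y. 1 \<le> p y" "\<And>y. p y \<le> P" "\<And>y. y \<in> cball x \<epsilon> \<Longrightarrow> \<bar>p x - p y\<bar> \<le> K * \<epsilon>"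
    and R: "integrable lebesgue R" "integrable lebesgue (\<lambda>y. norm (R y) powr p y)"
    and M: "\<And>z::'a. mollifier \<epsilon> z \<le> M / \<epsilon> ^ DIM('a)" "1 \<le> M'"
      "M * (LINT y|lebesgue. norm (R y)) \<le> M'"
  shows "norm (conv (mollifier \<epsilon>) R x) powr p x \<le>
    2 powr P * (\<epsilon> + exp (K * (ln M' + DIM('a))) * conv (mollifier \<epsilon>) (\<lambda>y. norm (R y) powr p y) x)"
proof -
  define C where "C = exp (K * (ln M' + real DIM('a)))"
  define t where "t = norm (conv (mollifier \<epsilon>) R x)"
  define a where "a = t / 2"
  let ?h = "\<lambda>y. norm (R y) powr p y"
  let ?H = "conv (mollifier \<epsilon>) ?h x"
  note \<eta> = mollifier_test_function_UNIV[OF \<epsilon>(1), where 'a='a]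
  have H: "?H \<ge> 0"
    unfolding conv_def
    by (intro Bochner_Integration.integral_nonneg) (simp add: mollifier_nonneg)
  have Ri: "integrable lebesgue (\<lambda>y. mollifier \<epsilon> (x - y) * norm (R y))"
    using conv_integrable[OF \<eta> integrable_norm[OF R(1)], of x] by simp
  have hi: "integrable lebesgue (\<lambda>y. mollifier \<epsilon> (x - y) * ?h y)"
    using conv_integrable[OF \<eta> R(2), of x] by simp
  have t: "t \<le> (LINT y|lebesgue. mollifier \<epsilon> (x - y) * norm (R y))"
    unfolding t_def conv_def
    using integral_norm_bound[of lebesgue "\<lambda>y. mollifier \<epsilon> (x - y) *\<^sub>R R y"]
    by (simp add: mollifier_nonneg)
  have key: "a powr p x \<le> \<epsilon> + C * ?H"
  proof (cases "a \<le> \<epsilon>")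
    case True
    have "a powr p x \<le> \<epsilon> powr p x"
      using True p(1)[of x] by (intro powr_mono2) (auto simp: a_def t_def)
    also have "\<dots> \<le> \<epsilon> powr 1" using \<epsilon> p(1)[of x] by (intro powr_mono') auto
    also have "\<dots> \<le> \<epsilon> + C * ?H" using \<epsilon> H by (simp add: C_def)
    finally show ?thesis .
  next
    case False
    then have a: "a > \<epsilon>" "a > 0" using \<epsilon> by auto
    have "t \<le> (LINT y|lebesgue. M / \<epsilon> ^ DIM('a) * norm (R y))"
      using t by (rule order_trans) (intro integral_mono Ri integrable_mult_right
          integrable_norm R(1) mult_right_mono M(1) norm_ge_zero)
    also have "\<dots> = M * (LINT y|lebesgue. norm (R y)) / \<epsilon> ^ DIM('a)"
      by simp
    also have "\<dots> \<le> M' / \<epsilon> ^ DIM('a)"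
      using M(3) \<epsilon> by (intro divide_right_mono) auto
    finally have "t \<le> M' / \<epsilon> ^ DIM('a)" .
    moreover have "a \<le> t" using a by (simp add: a_def)
    ultimately have a2: "a \<le> M' / \<epsilon> ^ DIM('a)" by linarith
    have pt: "mollifier \<epsilon> (x - y) * norm (R y) \<le>
        a * mollifier \<epsilon> (x - y) + C * a powr (1 - p x) * (mollifier \<epsilon> (x - y) * ?h y)" for y
    proof (cases "y \<in> cball x \<epsilon>")
      case True
      have "norm (R y) \<le> a + C * a powr (1 - p x) * ?h y"
      proof (cases "norm (R y) \<le> a")
        case True
        then show ?thesis by (simp add: C_def add_increasing2)
      next
        case False
        then have r: "norm (R y) > a" by simp
        have "norm (R y) = norm (R y) powr p y * norm (R y) powr (1 - p y)"
          using r a by (simp flip: powr_add)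
        also have "\<dots> \<le> norm (R y) powr p y * a powr (1 - p y)"
          using r a p(1)[of y] by (intro mult_left_mono powr_mono2') auto
        also have "a powr (1 - p y) = a powr (p x - p y) * a powr (1 - p x)"
          by (simp flip: powr_add)
        also have "\<dots> \<le> C * a powr (1 - p x)"
          unfolding C_def
          by (intro mult_right_mono powr_exponent_shift_le[OF \<epsilon> M(2) _ a2 _ p(3)[OF True]])
            (use a in auto)
        finally have "norm (R y) \<le> norm (R y) powr p y * (C * a powr (1 - p x))"
          by (simp add: mult_left_mono)
        then show ?thesis using a by (simp add: mult_ac)
      qed
      from mult_left_mono[OF this mollifier_nonneg[of \<epsilon> "x - y"]]
      show ?thesis by (simp add: algebra_simps)
    next
      case False
      then have "mollifier \<epsilon> (x - y) = 0"
        by (intro mollifier_eq_0 \<epsilon>) (simp add: dist_norm)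
      then show ?thesis by simp
    qed
    note i1 = mollifier_shift_integrable[OF \<epsilon>(1), of x]
    have "t \<le> (LINT y|lebesgue. a * mollifier \<epsilon> (x - y) +
        C * a powr (1 - p x) * (mollifier \<epsilon> (x - y) * ?h y))"
      using t by (rule order_trans) (intro integral_mono Ri pt Bochner_Integration.integrable_add
          integrable_mult_right i1 hi)
    also have "\<dots> = a + C * a powr (1 - p x) * ?H"
      using i1 hi mollifier_integral(1)[OF \<epsilon>(1), of x] by (simp add: conv_def)
    finally have "a \<le> C * a powr (1 - p x) * ?H" by (simp add: a_def)
    then have "a * a powr (p x - 1) \<le> (C * a powr (1 - p x) * ?H) * a powr (p x - 1)"
      by (intro mult_right_mono) auto
    also have "\<dots> = C * ?H * (a powr (1 - p x) * a powr (p x - 1))" by (simp add: mult_ac)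
    also have "a powr (1 - p x) * a powr (p x - 1) = 1"
      using a by (simp flip: powr_add)
    also have "a * a powr (p x - 1) = a powr p x"
      using a by (simp add: powr_mult_base)
    finally show ?thesis using \<epsilon> by simp
  qed
  have "t powr p x = 2 powr p x * a powr p x"
    by (simp add: a_def t_def powr_divide)
  also have "\<dots> \<le> 2 powr P * (\<epsilon> + C * ?H)"
    using key p(2)[of x] by (intro mult_mono) auto
  finally show ?thesis unfolding t_def C_def .
qed

text \<open>
  Split \<open>V = g + R\<close> with \<open>g\<close> continuous on the closed ball and \<open>R\<close> of small modular. The
  continuous part is mollified with a uniformly small error, and \<open>mollification_powr_le\<close> bounds the
  modular of the mollified \<open>R\<close> by that of \<open>R\<close>. The weight \<open>N\<^bsup>p-1\<^esup>\<close> is removed by Young's inequality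
  at the price of a small multiple of the integral of \<open>N\<^bsup>p\<^esup>\<close>.
\<close>

lemma mollification_error:
  fixes V :: "'a::euclidean_space \<Rightarrow> 'b::euclidean_space"
  assumes r: "r > 0"
    and p: "p \<in> borel_measurable lebesgue" "\<And>x. 1 \<le> p x" "\<And>x. p x \<le> P"
      "\<And>x y. x \<in> cball z (2 * r) \<Longrightarrow> y \<in> cball z (2 * r) \<Longrightarrow> \<bar>p x - p y\<bar> \<le> K * dist x y" "K \<ge> 0"
    and V: "integrable lebesgue V" "\<And>x. x \<notin> cball z (2 * r) \<Longrightarrow> V x = 0"
      "integrable lebesgue (\<lambda>x. norm (V x) powr p x)"
    and N: "N \<in> borel_measurable lebesgue" "\<And>x. N x \<ge> 0"
      "integrable lebesgue (\<lambda>x. indicator (cball z r) x * N x powr p x)"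
    and "\<delta> > 0"
  obtains \<epsilon>0 where "\<epsilon>0 > 0" "\<And>\<epsilon>. 0 < \<epsilon> \<Longrightarrow> \<epsilon> < \<epsilon>0 \<Longrightarrow>
    integrable lebesgue (\<lambda>x. indicator (cball z r) x *
        (N x powr (p x - 1) * norm (conv (mollifier \<epsilon>) V x - V x))) \<and>
    (LINT x|lebesgue. indicator (cball z r) x *
        (N x powr (p x - 1) * norm (conv (mollifier \<epsilon>) V x - V x))) \<le> \<delta>"
proof -
  let ?S = "cball z (2 * r)" and ?B = "cball z r"
  have V0: "integrable lebesgue (\<lambda>x. indicator ?S x * norm (V x) powr p x)"
  proof -
    have "indicator ?S x * norm (V x) powr p x = norm (V x) powr p x" for x
      by (cases "x \<in> ?S") (simp_all add: V(2))
    then have "(\<lambda>x. indicator ?S x * norm (V x) powr p x) = (\<lambda>x. norm (V x) powr p x)"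
      by (rule ext)
    then show ?thesis using V(3) by (simp only:)
  qed
  obtain M where M: "M > 0" "\<And>\<epsilon> y. \<epsilon> > 0 \<Longrightarrow> mollifier \<epsilon> (y::'a) \<le> M / \<epsilon> ^ DIM('a)"
    using mollifier_le[where 'a='a] by metis
  define m where "m = measure lebesgue ?S"
  have m0: "m \<ge> 0" unfolding m_def by simp
  have "measure lebesgue ?B \<le> m"
    unfolding m_def
    by (rule measure_mono_fmeasurable[OF _ _ lmeasurable_cball]) (use r in auto)
  note m = m0 this
  define M' where "M' = max 1 (M * (m + 1))"
  define C where "C = exp (K * (ln M' + real DIM('a)))"
  have C: "C > 0" by (simp add: C_def)
  define A where "A = (LINT x|lebesgue. indicator ?B x * N x powr p x)"
  have A: "A \<ge> 0" unfolding A_def by (intro Bochner_Integration.integral_nonneg) auto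
  \<comment> \<open>Young's inequality is used three times, so the weights \<open>N\<^bsup>p\<^esup>\<close> consume \<open>3 s A \<le> \<delta>/2\<close>.\<close>
  define s where "s = min 1 (\<delta> / (2 * (3 * A + 1)))"
  have s: "0 < s" "s \<le> 1" using A \<open>\<delta> > 0\<close> by (auto simp: s_def)
  have sA: "3 * s * A \<le> \<delta> / 2"
  proof -
    have "s * (3 * A) \<le> \<delta> / (2 * (3 * A + 1)) * (3 * A + 1)"
      using A \<open>\<delta> > 0\<close> by (intro mult_mono) (auto simp: s_def)
    also have "\<dots> = \<delta> / 2" using A by (simp add: field_simps)
    finally show ?thesis by simp
  qed
  define T where "T = s powr (- P)"
  have T: "T > 0" using s by (simp add: T_def)
  \<comment> \<open>The error budget left after the \<open>s N\<^sup>p\<close> terms is split evenly over the three remaining ones.\<close>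
  define \<omega> where "\<omega> = min 1 (\<delta> / (6 * T * (1 + 2 powr P * C)))"
  define \<tau> where "\<tau> = min 1 (\<delta> / (6 * T * (m + 1)))"
  define \<epsilon>1 where "\<epsilon>1 = min 1 (\<delta> / (6 * T * (2 powr P * (m + 1))))"
  have pos: "\<omega> > 0" "\<tau> > 0" "\<epsilon>1 > 0"
    unfolding \<omega>_def \<tau>_def \<epsilon>1_def using T C m \<open>\<delta> > 0\<close>
    by (auto intro!: divide_pos_pos mult_pos_pos add_pos_nonneg add_nonneg_pos)
  have Slm: "?S \<in> lmeasurable" by simp
  obtain g where g: "continuous_on UNIV g"
    "integrable lebesgue (\<lambda>x. indicator ?S x * norm (V x - g x) powr p x)"
    "(LINT x|lebesgue. indicator ?S x * norm (V x - g x) powr p x) < \<omega>"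
    by (rule modular_dense_continuous[OF Slm borel_measurable_integrable[OF V(1)] p(1-3) V0 pos(1)])
      (rule that)
  define g' where "g' x = indicator ?S x *\<^sub>R g x" for x
  define R where "R x = V x - g' x" for x
  have g'i: "integrable lebesgue g'"
  proof -
    have "integrable lborel g'"
      unfolding g'_def
      by (intro borel_integrable_compact compact_cball continuous_on_subset[OF g(1)]) simp
    then show ?thesis
      by (subst integrable_completion) (simp_all only: borel_measurable_integrable)
  qed
  have Ri: "integrable lebesgue R" unfolding R_def using V(1) g'i by simp
  have Rh: "(\<lambda>x. norm (R x) powr p x) = (\<lambda>x. indicator ?S x * norm (V x - g x) powr p x)"
  proof
    fix x
    show "norm (R x) powr p x = indicator ?S x * norm (V x - g x) powr p x"
      by (cases "x \<in> ?S") (simp_all add: V(2) R_def g'_def)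
  qed
  have hi: "integrable lebesgue (\<lambda>x. norm (R x) powr p x)" unfolding Rh by (rule g(2))
  have h\<omega>: "(LINT x|lebesgue. norm (R x) powr p x) < \<omega>" unfolding Rh by (rule g(3))
  have RL1: "(LINT x|lebesgue. norm (R x)) \<le> m + 1"
  proof -
    have "(LINT x|lebesgue. norm (R x)) \<le> (LINT x|lebesgue. indicator ?S x + norm (R x) powr p x)"
    proof (rule integral_mono)
      show "integrable lebesgue (\<lambda>x. indicator ?S x + norm (R x) powr p x)"
        using hi Slm by (intro Bochner_Integration.integrable_add integrable_real_indicator)
          (auto simp: fmeasurable_def)
      fix x
      show "norm (R x) \<le> indicator ?S x + norm (R x) powr p x"
      proof (cases "x \<in> ?S")
        case True
        have "norm (R x) powr 1 \<le> norm (R x) powr p x" if "norm (R x) \<ge> 1"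
          using that p(2) by (intro powr_mono) auto
        then show ?thesis using True by (cases "norm (R x) \<ge> 1") (auto intro: add_increasing2)
      next
        case False
        then show ?thesis using V(2) by (simp add: R_def g'_def)
      qed
    qed (use Ri in auto)
    also have "\<dots> = m + (LINT x|lebesgue. norm (R x) powr p x)"
      using hi Slm by (subst Bochner_Integration.integral_add)
        (auto simp: m_def fmeasurable_def intro!: integrable_real_indicator)
    also have "\<dots> \<le> m + 1" using h\<omega> by (simp add: \<omega>_def)
    finally show ?thesis .
  qed
  have "uniformly_continuous_on ?S g"
    by (intro compact_uniformly_continuous continuous_on_subset[OF g(1)]) auto
  then obtain \<epsilon>2 where \<epsilon>2: "\<epsilon>2 > 0"
    "\<And>x y. x \<in> ?S \<Longrightarrow> y \<in> ?S \<Longrightarrow> dist y x < \<epsilon>2 \<Longrightarrow> dist (g y) (g x) < \<tau>"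
    using pos(2) uniformly_continuous_onE by metis
  \<comment> \<open>Below \<open>r\<close>, averaging at points of the small ball stays inside the large one.\<close>
  show ?thesis
  proof (rule that[of "min (min \<epsilon>1 \<epsilon>2) r"])
    show "min (min \<epsilon>1 \<epsilon>2) r > 0" using pos \<epsilon>2 r by simp
    fix \<epsilon> :: real assume "0 < \<epsilon>" "\<epsilon> < min (min \<epsilon>1 \<epsilon>2) r"
    then have \<epsilon>: "0 < \<epsilon>" "\<epsilon> \<le> \<epsilon>1" "\<epsilon> < \<epsilon>2" "\<epsilon> < r" "\<epsilon> \<le> 1" by (auto simp: \<epsilon>1_def)
    note \<eta> = mollifier_test_function_UNIV[OF \<epsilon>(1), where 'a='a]
    let ?H = "conv (mollifier \<epsilon>) (\<lambda>y. norm (R y) powr p y)"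
    let ?F = "\<lambda>x. indicator ?B x * (N x powr (p x - 1) * norm (conv (mollifier \<epsilon>) V x - V x))"
    let ?Q = "\<lambda>x. 3 * s * (indicator ?B x * N x powr p x) + T * (\<tau> * indicator ?B x +
        2 powr P * (\<epsilon> * indicator ?B x + C * ?H x) + norm (R x) powr p x)"
    have Hnn: "?H x \<ge> 0" for x
      unfolding conv_def
      by (intro Bochner_Integration.integral_nonneg) (simp add: mollifier_nonneg)
    have Hi: "integrable lebesgue ?H" "(LINT x|lebesgue. ?H x) < \<omega>"
      using conv_nonneg_integral[OF \<epsilon>(1) hi] h\<omega> by simp_all
    have FQ: "?F x \<le> ?Q x" for x
    proof (cases "x \<in> ?B")
      case True
      have sub: "cball x \<epsilon> \<subseteq> ?S"
      proof
        fix y assume "y \<in> cball x \<epsilon>"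
        then show "y \<in> ?S" using True \<epsilon>(4) dist_triangle[of z y x] by simp
      qed
      have xS: "x \<in> ?S" using True r by simp
      have e1: "norm (conv (mollifier \<epsilon>) g' x - g' x) \<le> \<tau>"
      proof (rule mollification_close[OF \<epsilon>(1) g'i])
        fix y assume y: "y \<in> cball x \<epsilon>"
        then have "dist (g y) (g x) < \<tau>"
          using \<epsilon>2(2)[OF xS, of y] sub \<epsilon>(3) by (auto simp: dist_commute)
        then show "norm (g' y - g' x) \<le> \<tau>"
          using y sub xS by (auto simp: g'_def dist_norm indicator_def)
      qed
      let ?t = "norm (conv (mollifier \<epsilon>) R x)"
      have e2: "?t powr p x \<le> 2 powr P * (\<epsilon> + C * ?H x)"
        unfolding C_def
      proof (rule mollification_powr_le[OF \<epsilon>(1,5) p(2,3) _ Ri hi M(2)[OF \<epsilon>(1)]])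
        show "\<bar>p x - p y\<bar> \<le> K * \<epsilon>" if "y \<in> cball x \<epsilon>" for y
        proof -
          have "\<bar>p x - p y\<bar> \<le> K * dist x y" using p(4)[OF xS] that sub by blast
          also have "\<dots> \<le> K * \<epsilon>" using that p(5) by (intro mult_left_mono) auto
          finally show ?thesis .
        qed
        show "1 \<le> M'" by (simp add: M'_def)
        have "M * (LINT y|lebesgue. norm (R y)) \<le> M * (m + 1)"
          using M(1) RL1 by (intro mult_left_mono) auto
        then show "M * (LINT y|lebesgue. norm (R y)) \<le> M'" by (simp add: M'_def)
      qed
      have dec: "conv (mollifier \<epsilon>) V x - V x =
          (conv (mollifier \<epsilon>) g' x - g' x) + conv (mollifier \<epsilon>) R x - R x"
      proof -
        have "V = (\<lambda>y. g' y + R y)" by (auto simp: R_def)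
        then have "conv (mollifier \<epsilon>) V x = conv (mollifier \<epsilon>) g' x + conv (mollifier \<epsilon>) R x"
          using conv_add[OF \<eta> g'i Ri] by metis
        then show ?thesis by (simp add: R_def)
      qed
      have tri: "norm (conv (mollifier \<epsilon>) V x - V x) \<le> \<tau> + ?t + norm (R x)"
        unfolding dec using e1
          norm_triangle_ineq4[of "(conv (mollifier \<epsilon>) g' x - g' x) + conv (mollifier \<epsilon>) R x" "R x"]
          norm_triangle_ineq[of "conv (mollifier \<epsilon>) g' x - g' x" "conv (mollifier \<epsilon>) R x"]
        by linarith
      have Y: "N x powr (p x - 1) * q \<le> s * N x powr p x + T * q powr p x" if "q \<ge> 0" for q
        unfolding T_def by (rule young_powr[OF N(2) that s p(2,3)])
      have "\<tau> powr p x \<le> \<tau> powr 1"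
        using pos(2) p(2)[of x] by (intro powr_mono') (auto simp: \<tau>_def)
      then have \<tau>p: "T * \<tau> powr p x \<le> T * \<tau>" using pos(2) T by (intro mult_left_mono) auto
      have "N x powr (p x - 1) * norm (conv (mollifier \<epsilon>) V x - V x) \<le>
          N x powr (p x - 1) * (\<tau> + ?t + norm (R x))"
        using tri by (intro mult_left_mono) auto
      also have "\<dots> = N x powr (p x - 1) * \<tau> + N x powr (p x - 1) * ?t + N x powr (p x - 1) * norm (R x)"
        by (simp add: algebra_simps)
      also have "\<dots> \<le> (s * N x powr p x + T * \<tau>) + (s * N x powr p x + T * (2 powr P * (\<epsilon> + C * ?H x)))
          + (s * N x powr p x + T * norm (R x) powr p x)"
      proof (intro add_mono)
        have Te2: "T * ?t powr p x \<le> T * (2 powr P * (\<epsilon> + C * ?H x))"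
          using e2 T by (intro mult_left_mono) auto
        show "N x powr (p x - 1) * \<tau> \<le> s * N x powr p x + T * \<tau>"
          using Y[of \<tau>] \<tau>p pos(2) by linarith
        show "N x powr (p x - 1) * ?t \<le> s * N x powr p x + T * (2 powr P * (\<epsilon> + C * ?H x))"
          using order_trans[OF Y[OF norm_ge_zero] add_left_mono[OF Te2]] .
        show "N x powr (p x - 1) * norm (R x) \<le> s * N x powr p x + T * norm (R x) powr p x"
          by (rule Y[OF norm_ge_zero])
      qed
      finally show ?thesis using True by (simp add: algebra_simps)
    next
      case False
      then show ?thesis using T C Hnn[of x] by simp
    qed
    have Bi: "integrable lebesgue (\<lambda>x. indicator ?B x :: real)"
      using lmeasurable_cball[of z r] by (intro integrable_real_indicator) (auto simp: fmeasurable_def)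
    have Qi: "integrable lebesgue ?Q"
      using N(3) Bi Hi(1) hi by (intro Bochner_Integration.integrable_add integrable_mult_right)
    note [measurable] = N(1) p(1) conv_measurable[OF \<eta> V(1)] borel_measurable_integrable[OF V(1)]
    have [measurable]: "?B \<in> sets lebesgue" by simp
    have "?F \<in> borel_measurable lebesgue" by measurable
    moreover have "norm (?F x) \<le> norm (?Q x)" for x
    proof -
      have "?F x \<ge> 0" by simp
      then show ?thesis using FQ[of x] by (simp only: real_norm_def)
    qed
    ultimately have Fi: "integrable lebesgue ?F"
      by (intro Bochner_Integration.integrable_bound[OF Qi] AE_I2)
    have "(LINT x|lebesgue. ?F x) \<le> (LINT x|lebesgue. ?Q x)"
      by (rule integral_mono[OF Fi Qi FQ])
    also have "\<dots> = 3 * s * A + T * (\<tau> * measure lebesgue ?B + 2 powr P * (\<epsilon> * measure lebesgue ?B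
        + C * (LINT x|lebesgue. ?H x)) + (LINT x|lebesgue. norm (R x) powr p x))"
      using N(3) Bi Hi(1) hi by (simp add: A_def)
    also have "\<dots> \<le> \<delta> / 2 + T * (\<tau> * (m + 1) + 2 powr P * (\<epsilon>1 * (m + 1) + C * \<omega>) + \<omega>)"
      using sA T C Hi(2) h\<omega> m \<epsilon>(1,2) pos
      by (intro add_mono mult_left_mono mult_mono) auto
    also have "\<dots> = \<delta> / 2 + (\<tau> * (T * (m + 1)) + \<epsilon>1 * (T * (2 powr P * (m + 1)))
        + \<omega> * (T * (1 + 2 powr P * C)))"
      by (simp add: algebra_simps)
    also have "\<dots> \<le> \<delta> / 2 + (\<delta> / 6 + \<delta> / 6 + \<delta> / 6)"
    proof -
      have q: "min 1 (\<delta> / (6 * T * X)) * (T * X) \<le> \<delta> / 6" if "X > 0" for X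
      proof -
        have "min 1 (\<delta> / (6 * T * X)) * (T * X) \<le> \<delta> / (6 * T * X) * (T * X)"
          using that T by (intro mult_right_mono) auto
        also have "\<dots> = \<delta> / 6" using that T by simp
        finally show ?thesis .
      qed
      show ?thesis
        unfolding \<omega>_def \<tau>_def \<epsilon>1_def
        by (intro add_mono q order_refl) (use m C in \<open>auto intro!: add_pos_nonneg add_nonneg_pos\<close>)
    qed
    also have "\<dots> = \<delta>" by simp
    finally show "integrable lebesgue ?F \<and> (LINT x|lebesgue. ?F x) \<le> \<delta>" using Fi by blast
  qed
qed

section \<open>The p(x)-Laplacian in divergence form\<close>

lemma Ck_on_ln: "Ck_on (Suc 0) (ln :: real \<Rightarrow> real) {0<..}"
proof (rule Ck_on_real_openI[where h'=inverse])
  show "(ln has_real_derivative inverse x) (at x)" if "x \<in> {0<..}" for x :: real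
    using that by (auto intro: DERIV_ln)
qed (auto intro!: continuous_intros)

lemma Ck_on_exp: "Ck_on (Suc 0) (exp :: real \<Rightarrow> real) UNIV"
  by (rule Ck_on_real_openI[where h'=exp]) (auto intro!: continuous_intros DERIV_exp)

lemma grad_has_derivative:
  fixes \<psi> :: "'a::euclidean_space \<Rightarrow> real"
  assumes "Ck_on 2 \<psi> U" "x \<in> U"
  shows "(grad \<psi> has_derivative hessian \<psi> x) (at x)"
proof -
  have "Ck_on (Suc (Suc 0)) \<psi> U" using assms(1) by (simp add: numeral_2_eq_2)
  then have "(grad \<psi> has_derivative
      (\<lambda>h. \<Sum>b\<in>Basis. frechet_derivative (\<lambda>x. frechet_derivative \<psi> (at x) b) (at x) h *\<^sub>R b)) (at x)"
    unfolding grad_def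
    by (intro has_derivative_sum has_derivative_scaleR_left)
      (use assms(2) in \<open>simp add: frechet_derivative_works\<close>)
  then have "grad \<psi> differentiable at x" by (rule differentiableI)
  then show ?thesis by (simp add: hessian_def flip: frechet_derivative_works)
qed

text \<open>
  The vector field \<open>|v|\<^bsup>q-2\<^esup> v\<close>, whose divergence along \<open>v = \<nabla>u\<close>, \<open>q = p(x)\<close> is the p(x)-Laplacian.
\<close>

definition pflux :: "real \<Rightarrow> 'a::euclidean_space \<Rightarrow> 'a" where
  "pflux q v = norm v powr (q - 2) *\<^sub>R v"

lemma norm_pflux: "norm (pflux q v) = norm v powr (q - 1)"
  by (cases "v = 0") (auto simp: pflux_def powr_diff powr_numeral power2_eq_square)

lemma inner_pflux_self: "q \<noteq> 0 \<Longrightarrow> pflux q v \<bullet> v = norm v powr q"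
  by (cases "v = 0") (auto simp: pflux_def dot_square_norm powr_diff)

text \<open>
  By the Cauchy-Schwarz inequality the left side is at least
  \<open>(|v|\<^bsup>q-1\<^esup> - |w|\<^bsup>q-1\<^esup>) (|v| - |w|)\<close>, a product of factors of the same sign.
\<close>

lemma pflux_monotone:
  assumes "q \<ge> 1"
  shows "(pflux q v - pflux q w) \<bullet> (v - w) \<ge> 0"
proof -
  have a: "t powr q = t powr (q - 1) * t" if "t \<ge> 0" for t :: real
    using that by (cases "t = 0") (auto simp: powr_diff)
  have "pflux q v \<bullet> w \<le> norm v powr (q - 1) * norm w" "pflux q w \<bullet> v \<le> norm w powr (q - 1) * norm v"
    using norm_cauchy_schwarz[of "pflux q v" w] norm_cauchy_schwarz[of "pflux q w" v]
    by (simp_all add: norm_pflux)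
  moreover have "pflux q v \<bullet> v = norm v powr (q - 1) * norm v" "pflux q w \<bullet> w = norm w powr (q - 1) * norm w"
    using assms a by (simp_all add: inner_pflux_self)
  moreover have "(norm v powr (q - 1) - norm w powr (q - 1)) * (norm v - norm w) \<ge> 0"
  proof (cases "norm v \<le> norm w")
    case True
    then have "norm v powr (q - 1) \<le> norm w powr (q - 1)" using assms by (intro powr_mono2) auto
    with True show ?thesis by (simp add: mult_nonpos_nonpos)
  next
    case False
    then have "norm w powr (q - 1) \<le> norm v powr (q - 1)" using assms by (intro powr_mono2) auto
    with False show ?thesis by simp
  qed
  ultimately show ?thesis by (simp add: inner_diff_left inner_diff_right algebra_simps)
qed

context
  fixes \<psi> p :: "'a::euclidean_space \<Rightarrow> real" and U :: "'a set"
  assumes U: "open U" and \<psi>: "Ck_on 2 \<psi> U" and p: "Ck_on (Suc 0) p U"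
    and nz: "\<And>x. x \<in> U \<Longrightarrow> grad \<psi> x \<noteq> 0"
begin

lemma Ck_on_Suc_\<psi>: "Ck_on (Suc (Suc 0)) \<psi> U"
  using \<psi> by (simp add: numeral_2_eq_2)

lemma norm_grad_powr_eq:
  "x \<in> U \<Longrightarrow> norm (grad \<psi> x) powr (p x - 2) = exp ((p x - 2) * (1/2) * ln (grad \<psi> x \<bullet> grad \<psi> x))"
  using nz[of x] by (simp add: powr_def dot_square_norm ln_realpow)

text \<open>
  Where the gradient does not vanish, \<open>|\<nabla>\<psi>|\<^bsup>p-2\<^esup> = exp((p - 2)/2 ln |\<nabla>\<psi>|\<^sup>2)\<close> is a composition of
  differentiable functions; differentiating \<open>p\<close> in this formula produces the logarithmic term of
  the operator.
\<close>

lemma Ck_on_pflux_grad: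
  assumes "b \<in> Basis"
  shows "Ck_on (Suc 0) (\<lambda>x. pflux (p x) (grad \<psi> x) \<bullet> b) U"
proof -
  have d: "Ck_on (Suc 0) (\<lambda>x. frechet_derivative \<psi> (at x) b) U" if "b \<in> Basis" for b
    using Ck_on_Suc_\<psi> that by simp
  have "Ck_on (Suc 0) (\<lambda>x. \<Sum>b\<in>Basis. frechet_derivative \<psi> (at x) b * frechet_derivative \<psi> (at x) b) U"
    by (intro Ck_on_sum Ck_on_mult d U)
  also have "(\<lambda>x. \<Sum>b\<in>Basis. frechet_derivative \<psi> (at x) b * frechet_derivative \<psi> (at x) b) =
      (\<lambda>x. grad \<psi> x \<bullet> grad \<psi> x)"
    by (rule ext) (simp add: euclidean_inner[of "grad \<psi> _" "grad \<psi> _"] grad_inner_Basis)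
  finally have s: "Ck_on (Suc 0) (\<lambda>x. grad \<psi> x \<bullet> grad \<psi> x) U" .
  have "Ck_on (Suc 0) (\<lambda>x. exp ((p x - 2) * (1/2) * ln (grad \<psi> x \<bullet> grad \<psi> x))) U"
    by (rule Ck_on_compose_real[OF U open_UNIV UNIV_I Ck_on_exp],
        intro Ck_on_mult Ck_on_diff Ck_on_const p U,
        rule Ck_on_compose_real[OF U open_greaterThan _ Ck_on_ln s])
      (use nz in simp)
  from Ck_on_mult[OF U this d[OF assms]] show ?thesis
    by (rule Ck_on_cong[OF U])
      (simp add: pflux_def norm_grad_powr_eq grad_inner_Basis[OF assms])
qed

lemma px_laplacian_eq_divergence:
  assumes x: "x \<in> U"
  shows "(\<Sum>b\<in>Basis. frechet_derivative (\<lambda>x. pflux (p x) (grad \<psi> x) \<bullet> b) (at x) b)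
    = px_laplacian p \<psi> x"
proof -
  let ?g = "grad \<psi> x" and ?H = "hessian \<psi> x"
  let ?W = "norm ?g powr (p x - 2)"
  define D where
    "D h = ?W * ((h \<bullet> grad p x) * ln (norm ?g) + (p x - 2) * ((?H h \<bullet> ?g) / (norm ?g)\<^sup>2))" for h
  have g0: "?g \<bullet> ?g > 0" "norm ?g > 0" using nz[OF x] by simp_all
  have g': "(grad \<psi> has_derivative ?H) (at x)" by (rule grad_has_derivative[OF \<psi> x])
  have p': "(p has_derivative (\<lambda>h. h \<bullet> grad p x)) (at x)"
    using p x by (intro has_derivative_grad) simp
  have i: "((\<lambda>x. grad \<psi> x \<bullet> grad \<psi> x) has_derivative (\<lambda>h. 2 * (?H h \<bullet> ?g))) (at x)"
    by (rule has_derivative_eq_rhs[OF has_derivative_inner[OF g' g']]) (simp add: inner_commute)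
  have "((\<lambda>x. exp ((p x - 2) * (1/2) * ln (grad \<psi> x \<bullet> grad \<psi> x))) has_derivative D) (at x)"
    unfolding D_def
    by (rule has_derivative_eq_rhs, rule derivative_intros,
        rule derivative_intros, rule derivative_intros, rule derivative_intros, rule p',
        rule derivative_intros, rule derivative_intros, rule has_derivative_ln[OF g0(1) i])
      (use g0 in \<open>auto simp: norm_grad_powr_eq[OF x] dot_square_norm ln_realpow field_simps\<close>)
  then have W': "((\<lambda>x. norm (grad \<psi> x) powr (p x - 2)) has_derivative D) (at x)"
    by (rule has_derivative_transform_within_open[OF _ U x]) (simp add: norm_grad_powr_eq)
  have X': "((\<lambda>x. pflux (p x) (grad \<psi> x) \<bullet> b) has_derivative
      (\<lambda>h. ?W * (?H h \<bullet> b) + D h * (?g \<bullet> b))) (at x)" for b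
    unfolding pflux_def inner_scaleR_left
    by (rule has_derivative_mult[OF W' has_derivative_inner_left[OF g']])
  have "(\<Sum>b\<in>Basis. frechet_derivative (\<lambda>x. pflux (p x) (grad \<psi> x) \<bullet> b) (at x) b) =
      (\<Sum>b\<in>Basis. ?W * (?H b \<bullet> b) + D b * (?g \<bullet> b))"
    by (rule sum.cong) (simp_all add: frechet_derivative_at[OF X', symmetric])
  also have "\<dots> = ?W * laplacian \<psi> x + (\<Sum>b\<in>Basis. (?g \<bullet> b) * D b)"
    by (simp add: sum.distrib laplacian_def sum_distrib_left mult.commute[of "?g \<bullet> _"])
  also have "\<dots> = ?W * laplacian \<psi> x + D ?g"
  proof -
    have "D ?g = D (\<Sum>b\<in>Basis. (?g \<bullet> b) *\<^sub>R b)" by (simp only: euclidean_representation)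
    also have "\<dots> = (\<Sum>b\<in>Basis. (?g \<bullet> b) * D b)"
      using has_derivative_linear[OF W'] by (simp add: linear_sum linear_scale)
    finally show ?thesis by simp
  qed
  also have "\<dots> = px_laplacian p \<psi> x"
  proof -
    have "?H (?g /\<^sub>R norm ?g) = ?H ?g /\<^sub>R norm ?g"
      using has_derivative_linear[OF g'] by (rule linear_scale)
    then have q: "?H (?g /\<^sub>R norm ?g) \<bullet> (?g /\<^sub>R norm ?g) = (?H ?g \<bullet> ?g) / (norm ?g)\<^sup>2"
      by (simp add: power2_eq_square divide_inverse)
    show ?thesis
      unfolding px_laplacian_def D_def q
      by (simp add: inner_commute[of ?g "grad p x"] distrib_left)
  qed
  finally show ?thesis .
qed

text \<open>
  The divergence of a continuously differentiable field is continuous.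
\<close>

lemma continuous_on_px_laplacian: "continuous_on U (px_laplacian p \<psi>)"
proof -
  have "continuous_on U
      (\<lambda>x. \<Sum>b\<in>Basis. frechet_derivative (\<lambda>x. pflux (p x) (grad \<psi> x) \<bullet> b) (at x) b)"
    using Ck_on_pflux_grad by (intro continuous_on_sum) simp
  then show ?thesis
    by (rule continuous_on_eq) (rule px_laplacian_eq_divergence)
qed

lemma pflux_integration_by_parts:
  assumes \<theta>: "\<theta> \<in> test_functions U"
  shows "integrable lebesgue (\<lambda>x. pflux (p x) (grad \<psi> x) \<bullet> grad \<theta> x)"
    and "integrable lebesgue (\<lambda>x. \<theta> x * px_laplacian p \<psi> x)"
    and "(LINT x|lebesgue. pflux (p x) (grad \<psi> x) \<bullet> grad \<theta> x)
       = - (LINT x|lebesgue. \<theta> x * px_laplacian p \<psi> x)"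
proof -
  obtain K where K: "compact K" "K \<subseteq> U" "\<And>x. x \<notin> K \<Longrightarrow> \<theta> x = 0"
    "\<And>x. x \<notin> K \<Longrightarrow> frechet_derivative \<theta> (at x) = (\<lambda>h. 0)"
    using test_functionsE[OF \<theta>] by metis
  let ?X = "\<lambda>b x. pflux (p x) (grad \<psi> x) \<bullet> b"
  let ?A = "\<lambda>b x. if x \<in> U then ?X b x * frechet_derivative \<theta> (at x) b else 0"
  let ?B = "\<lambda>b x. if x \<in> U then frechet_derivative (?X b) (at x) b * \<theta> x else 0"
  have A: "integrable lebesgue (?A b)" and B: "integrable lebesgue (?B b)" if "b \<in> Basis" for b
  proof -
    have "Ck_on 0 (?A b) UNIV"
      by (rule Ck_on_mult_test_function[OF U _ test_functions_partial[OF \<theta> that]])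
        (rule Ck_on_Suc_imp[OF Ck_on_pflux_grad[OF that]])
    then show "integrable lebesgue (?A b)"
      by (intro integrable_compact_support[OF _ K(1)]) (use K in auto)
    have "Ck_on 0 (?B b) UNIV"
      by (rule Ck_on_mult_test_function[OF U _ \<theta>]) (use Ck_on_pflux_grad[OF that] that in simp)
    then show "integrable lebesgue (?B b)"
      by (intro integrable_compact_support[OF _ K(1)]) (use K in auto)
  qed
  have AB: "(LINT x|lebesgue. ?A b x) = - (LINT x|lebesgue. ?B b x)" if "b \<in> Basis" for b
    using integration_by_parts_test_function[OF U Ck_on_pflux_grad[OF that] \<theta> that] U
    by (simp add: lebesgue_on_integral_eq borel_open)
  have eqA: "pflux (p x) (grad \<psi> x) \<bullet> grad \<theta> x = (\<Sum>b\<in>Basis. ?A b x)" for x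
  proof (cases "x \<in> U")
    case True
    then show ?thesis
      by (simp add: euclidean_inner[of "pflux _ _" "grad \<theta> _"] grad_inner_Basis)
  next
    case False
    then have "x \<notin> K" using K(2) by blast
    then have "grad \<theta> x = 0" by (simp add: grad_def K(4))
    then show ?thesis using False by simp
  qed
  have eqB: "\<theta> x * px_laplacian p \<psi> x = (\<Sum>b\<in>Basis. ?B b x)" for x
  proof (cases "x \<in> U")
    case True
    then show ?thesis
      by (simp add: px_laplacian_eq_divergence[symmetric] sum_distrib_left mult.commute)
  next
    case False
    then have "x \<notin> K" using K(2) by blast
    then show ?thesis using False by (simp add: K(3))
  qed
  show "integrable lebesgue (\<lambda>x. pflux (p x) (grad \<psi> x) \<bullet> grad \<theta> x)"
    unfolding eqA using A by (intro Bochner_Integration.integrable_sum)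
  show "integrable lebesgue (\<lambda>x. \<theta> x * px_laplacian p \<psi> x)"
    unfolding eqB using B by (intro Bochner_Integration.integrable_sum)
  have "(LINT x|lebesgue. (\<Sum>b\<in>Basis. ?A b x)) = (\<Sum>b\<in>Basis. LINT x|lebesgue. ?A b x)"
    by (rule Bochner_Integration.integral_sum) (rule A)
  also have "\<dots> = - (\<Sum>b\<in>Basis. LINT x|lebesgue. ?B b x)"
    by (subst sum_negf[symmetric]) (rule sum.cong[OF refl AB])
  also have "(\<Sum>b\<in>Basis. LINT x|lebesgue. ?B b x) = (LINT x|lebesgue. (\<Sum>b\<in>Basis. ?B b x))"
    by (rule Bochner_Integration.integral_sum[symmetric]) (rule B)
  finally show "(LINT x|lebesgue. pflux (p x) (grad \<psi> x) \<bullet> grad \<theta> x)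
       = - (LINT x|lebesgue. \<theta> x * px_laplacian p \<psi> x)"
    unfolding eqA eqB .
qed

end

section \<open>Perturbation of the touching function\<close>

text \<open>
  The quartic term vanishes to third order at \<open>z\<close>.
\<close>

lemma quartic_perturbation:
  fixes \<phi> :: "'a::euclidean_space \<Rightarrow> real"
  assumes \<Omega>: "open \<Omega>" and \<phi>: "Ck_on 2 \<phi> \<Omega>" and z: "z \<in> \<Omega>"
  defines "\<psi> \<equiv> \<lambda>x. \<phi> x - ((x - z) \<bullet> (x - z)) * ((x - z) \<bullet> (x - z))"
  shows "Ck_on 2 \<psi> \<Omega>" "grad \<psi> z = grad \<phi> z" "px_laplacian p \<psi> z = px_laplacian p \<phi> z"
proof -
  show C: "Ck_on 2 \<psi> \<Omega>"
    unfolding \<psi>_def by (intro Ck_on_diff Ck_on_mult Ck_on_sq_dist \<Omega> \<phi>)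
  have g: "grad \<psi> x = grad \<phi> x - (4 * ((x - z) \<bullet> (x - z))) *\<^sub>R (x - z)" if "x \<in> \<Omega>" for x
  proof -
    have "Ck_on (Suc (Suc 0)) \<phi> \<Omega>" using \<phi> by (simp add: numeral_2_eq_2)
    then have "(\<phi> has_derivative (\<lambda>h. h \<bullet> grad \<phi> x)) (at x)"
      using that by (intro has_derivative_grad) simp
    then have "(\<psi> has_derivative
        (\<lambda>h. h \<bullet> (grad \<phi> x - (4 * ((x - z) \<bullet> (x - z))) *\<^sub>R (x - z)))) (at x)"
      unfolding \<psi>_def
      by (auto intro!: derivative_eq_intros ext
          simp: inner_diff_right inner_diff_left inner_commute algebra_simps)
    then show ?thesis by (rule grad_eqI)
  qed
  show gz: "grad \<psi> z = grad \<phi> z" using g[OF z] by simp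
  have "((\<lambda>x. grad \<phi> x - (4 * ((x - z) \<bullet> (x - z))) *\<^sub>R (x - z)) has_derivative hessian \<phi> z) (at z)"
    by (rule has_derivative_eq_rhs, rule has_derivative_diff[OF grad_has_derivative[OF \<phi> z]])
      (auto intro!: derivative_eq_intros)
  then have "(grad \<psi> has_derivative hessian \<phi> z) (at z)"
    by (rule has_derivative_transform_within_open[OF _ \<Omega> z]) (simp add: g)
  then have h: "hessian \<psi> z = hessian \<phi> z"
    by (simp add: hessian_def[of \<psi>] frechet_derivative_at[symmetric])
  show "px_laplacian p \<psi> z = px_laplacian p \<phi> z"
    by (simp add: px_laplacian_def laplacian_def gz h)
qed

text \<open>
  Since \<open>W \<le> 0\<close> on the annulus between the radii \<open>s\<close> and \<open>r\<close>, the composition with the flat function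
  vanishes there and can be extended by zero.
\<close>

lemma cutoff_test_function:
  fixes W :: "'a::euclidean_space \<Rightarrow> real"
  assumes W: "\<And>k. Ck_on k W UNIV" and s: "s < r"
    and neg: "\<And>x. dist z x < r \<Longrightarrow> s < dist z x \<Longrightarrow> W x \<le> 0"
  defines "\<theta> \<equiv> \<lambda>x. if x \<in> ball z r then flat 0 (W x) else 0"
  shows "\<theta> \<in> test_functions (ball z r)"
    and "x \<in> ball z r \<Longrightarrow> grad \<theta> x = flat 2 (W x) *\<^sub>R grad W x"
proof -
  show \<theta>: "\<theta> \<in> test_functions (ball z r)"
  proof (rule test_functionsI[OF _ compact_cball[of z s]])
    fix k
    have o: "open (- cball z s)" by (simp add: open_Compl)
    have c: "Ck_on k (\<lambda>x. flat 0 (W x)) UNIV"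
      by (rule Ck_on_compose_real[OF _ _ _ flat_smooth W]) auto
    have "Ck_on k \<theta> (ball z r \<union> - cball z s)"
    proof (rule Ck_on_open_Un[OF open_ball o])
      show "Ck_on k \<theta> (ball z r)"
        by (rule Ck_on_cong[OF open_ball Ck_on_subset[OF c subset_UNIV]]) (simp add: \<theta>_def)
      show "Ck_on k \<theta> (- cball z s)"
        by (rule Ck_on_cong[OF o Ck_on_const[OF o, of k 0]])
          (auto simp: \<theta>_def not_le intro!: flat_eq_0 neg)
    qed
    also have "ball z r \<union> - cball z s = UNIV" using s by auto
    finally show "Ck_on k \<theta> UNIV" .
  next
    show "cball z s \<subseteq> ball z r" using s by auto
    show "\<theta> x = 0" if "x \<notin> cball z s" for x
      using that neg[of x] by (auto simp: \<theta>_def flat_eq_0)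
  qed
  assume x: "x \<in> ball z r"
  have "W differentiable at x" using W[of "Suc 0"] by simp
  from has_derivative_compose[OF has_derivative_grad[OF this]
      flat_deriv[of 0, unfolded has_field_derivative_def]]
  have "((\<lambda>x. flat 0 (W x)) has_derivative (\<lambda>h. h \<bullet> (flat 2 (W x) *\<^sub>R grad W x))) (at x)"
    by (simp add: numeral_2_eq_2)
  then have "(\<theta> has_derivative (\<lambda>h. h \<bullet> (flat 2 (W x) *\<^sub>R grad W x))) (at x)"
    by (rule has_derivative_transform_within_open[OF _ open_ball x]) (simp add: \<theta>_def)
  then show "grad \<theta> x = flat 2 (W x) *\<^sub>R grad W x" by (rule grad_eqI)
qed

section \<open>Weak gradients\<close>

lemma locally_integrable_continuous:
  fixes g :: "'a::euclidean_space \<Rightarrow> 'b::euclidean_space"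
  assumes "continuous_on \<Omega> g"
  shows "locally_integrable \<Omega> g"
  unfolding locally_integrable_def set_integrable_def
proof (intro allI impI, elim conjE)
  fix K assume "compact K" "K \<subseteq> \<Omega>"
  then have "integrable lborel (\<lambda>x. indicator K x *\<^sub>R g x)"
    by (intro borel_integrable_compact continuous_on_subset[OF assms])
  then show "integrable lebesgue (\<lambda>x. indicator K x *\<^sub>R g x)"
    by (subst integrable_completion) (simp_all only: borel_measurable_integrable)
qed

lemma locally_integrable_diff:
  "locally_integrable \<Omega> g \<Longrightarrow> locally_integrable \<Omega> h \<Longrightarrow> locally_integrable \<Omega> (\<lambda>x. g x - h x)"
  unfolding locally_integrable_def by (auto intro: set_integral_diff(1))

lemma locally_integrable_mult_test_function:
  fixes g :: "'a::euclidean_space \<Rightarrow> real"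
  assumes "open \<Omega>" "locally_integrable \<Omega> g" "\<theta> \<in> test_functions \<Omega>"
  shows "integrable (lebesgue_on \<Omega>) (\<lambda>x. g x * \<theta> x)"
proof -
  obtain K where K: "compact K" "K \<subseteq> \<Omega>" "\<And>x. x \<notin> K \<Longrightarrow> \<theta> x = 0"
    using test_functionsE[OF assms(3)] by metis
  obtain M where M: "\<And>x. \<bar>\<theta> x\<bar> \<le> M" using test_functions_bounded[OF assms(3)] by metis
  have "integrable lebesgue (\<lambda>x. indicator K x *\<^sub>R g x)"
    using assms(2) K(1,2) by (simp add: locally_integrable_def set_integrable_def)
  from integrable_bounded_mult[OF borel_measurable_lebesgue_continuous[OF
      test_functions_continuous[OF assms(3)]] M this]
  have "integrable lebesgue (\<lambda>x. \<theta> x *\<^sub>R (indicator K x *\<^sub>R g x))" .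
  also have "(\<lambda>x. \<theta> x *\<^sub>R (indicator K x *\<^sub>R g x)) = (\<lambda>x. indicator \<Omega> x *\<^sub>R (g x * \<theta> x))"
  proof
    fix x
    show "\<theta> x *\<^sub>R (indicator K x *\<^sub>R g x) = indicator \<Omega> x *\<^sub>R (g x * \<theta> x)"
      using K(2,3) by (cases "x \<in> K") (auto simp: subset_iff)
  qed
  finally show ?thesis
    using assms(1) by (subst integrable_restrict_space) (simp_all add: borel_open)
qed

lemma weak_gradient_C1:
  fixes \<psi> :: "'a::euclidean_space \<Rightarrow> real"
  assumes "open \<Omega>" "Ck_on (Suc 0) \<psi> \<Omega>"
  shows "weak_gradient \<Omega> \<psi> (grad \<psi>)"
  unfolding weak_gradient_def
proof (intro conjI ballI)
  show "locally_integrable \<Omega> \<psi>" "locally_integrable \<Omega> (grad \<psi>)"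
    using Ck_on_imp_continuous_on[OF assms(2)] Ck_on_continuous_grad[OF assms(2)]
    by (auto intro: locally_integrable_continuous)
  show "(LINT x|lebesgue_on \<Omega>. \<psi> x * frechet_derivative \<theta> (at x) b) =
      - (LINT x|lebesgue_on \<Omega>. (grad \<psi> x \<bullet> b) * \<theta> x)"
    if "\<theta> \<in> test_functions \<Omega>" "b \<in> Basis" for \<theta> b
    using integration_by_parts_test_function[OF assms that] by (simp add: grad_inner_Basis[OF that(2)])
qed

lemma locally_integrable_inner:
  fixes G :: "'a::euclidean_space \<Rightarrow> 'b::euclidean_space"
  assumes "locally_integrable \<Omega> G"
  shows "locally_integrable \<Omega> (\<lambda>x. G x \<bullet> b)"
  unfolding locally_integrable_def set_integrable_def
proof (intro allI impI)
  fix K assume "compact K \<and> K \<subseteq> \<Omega>"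
  then have "integrable lebesgue (\<lambda>x. indicator K x *\<^sub>R G x)"
    using assms by (simp add: locally_integrable_def set_integrable_def)
  from integrable_inner_left[OF this, of b]
  show "integrable lebesgue (\<lambda>x. indicator K x *\<^sub>R (G x \<bullet> b))" by simp
qed

lemma weak_gradient_diff:
  fixes v w :: "'a::euclidean_space \<Rightarrow> real"
  assumes "open \<Omega>" "weak_gradient \<Omega> v F" "weak_gradient \<Omega> w G"
  shows "weak_gradient \<Omega> (\<lambda>x. v x - w x) (\<lambda>x. F x - G x)"
  unfolding weak_gradient_def
proof (intro conjI ballI)
  note li = assms(2,3)[unfolded weak_gradient_def]
  show "locally_integrable \<Omega> (\<lambda>x. v x - w x)" "locally_integrable \<Omega> (\<lambda>x. F x - G x)"
    using li by (auto intro: locally_integrable_diff)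
  fix \<theta> and b :: 'a assume \<theta>: "\<theta> \<in> test_functions \<Omega>" and b: "b \<in> Basis"
  note i1 = locally_integrable_mult_test_function[OF assms(1) _ test_functions_partial[OF \<theta> b]]
  note i2 = locally_integrable_mult_test_function[OF assms(1) locally_integrable_inner \<theta>]
  have "(LINT x|lebesgue_on \<Omega>. (v x - w x) * frechet_derivative \<theta> (at x) b) =
      (LINT x|lebesgue_on \<Omega>. v x * frechet_derivative \<theta> (at x) b) -
      (LINT x|lebesgue_on \<Omega>. w x * frechet_derivative \<theta> (at x) b)"
    unfolding left_diff_distrib using li by (intro Bochner_Integration.integral_diff i1) auto
  also have "\<dots> = - ((LINT x|lebesgue_on \<Omega>. (F x \<bullet> b) * \<theta> x) - (LINT x|lebesgue_on \<Omega>. (G x \<bullet> b) * \<theta> x))"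
    using li \<theta> b by auto
  also have "(LINT x|lebesgue_on \<Omega>. (F x \<bullet> b) * \<theta> x) - (LINT x|lebesgue_on \<Omega>. (G x \<bullet> b) * \<theta> x)
      = (LINT x|lebesgue_on \<Omega>. ((F x - G x) \<bullet> b) * \<theta> x)"
    unfolding inner_diff_left left_diff_distrib using li
    by (intro Bochner_Integration.integral_diff[symmetric] i2) auto
  finally show "(LINT x|lebesgue_on \<Omega>. (v x - w x) * frechet_derivative \<theta> (at x) b) =
      - (LINT x|lebesgue_on \<Omega>. ((F x - G x) \<bullet> b) * \<theta> x)" .
qed

section \<open>Weak solutions are viscosity solutions\<close>

lemma lebesgue_on_integral_support:
  fixes h :: "'a::euclidean_space \<Rightarrow> real"
  assumes "open \<Omega>" "\<And>x. x \<notin> \<Omega> \<Longrightarrow> h x = 0"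
  shows "(LINT x|lebesgue_on \<Omega>. h x) = (LINT x|lebesgue. h x)"
proof -
  have "(\<lambda>x. if x \<in> \<Omega> then h x else 0) = h" using assms(2) by auto
  then show ?thesis using assms(1) by (simp add: lebesgue_on_integral_eq borel_open)
qed

lemma locally_integrable_extend_0:
  fixes g :: "'a::euclidean_space \<Rightarrow> 'b::euclidean_space"
  assumes "locally_integrable \<Omega> g" "compact S" "S \<subseteq> \<Omega>"
  shows "integrable lebesgue (\<lambda>x. if x \<in> S then g x else 0)"
proof -
  have "(\<lambda>x. indicator S x *\<^sub>R g x) = (\<lambda>x. if x \<in> S then g x else 0)"
    by (auto simp: indicator_def)
  then show ?thesis
    using assms unfolding locally_integrable_def set_integrable_def by metis
qed

lemma measurable_on_extend_0:
  fixes g :: "'a::euclidean_space \<Rightarrow> 'b::euclidean_space"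
  assumes "g \<in> borel_measurable (lebesgue_on \<Omega>)" "\<Omega> \<in> sets lebesgue" "S \<subseteq> \<Omega>" "S \<in> sets lebesgue"
  shows "(\<lambda>x. if x \<in> S then g x else 0) \<in> borel_measurable lebesgue"
proof -
  have "g \<in> borel_measurable (lebesgue_on S)"
    using assms(1,3) by (rule measurable_restrict_mono)
  then show ?thesis using assms(4) by (simp add: borel_measurable_if)
qed

lemma grad_add_const: "grad (\<lambda>x. f x + c) x = grad f x"
proof -
  have "((\<lambda>x. f x + c) has_derivative D) (at x) \<longleftrightarrow> (f has_derivative D) (at x)" for D
    using has_derivative_add_const[of f D "at x" c]
      has_derivative_add_const[of "\<lambda>x. f x + c" D "at x" "- c"] by auto
  then show ?thesis by (simp add: grad_def frechet_derivative_def)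
qed

text \<open>
  The p(x)-Laplacian of \<open>\<psi>\<close> is continuous where the gradient of \<open>\<psi>\<close> does not vanish, so the strict
  inequality at \<open>z\<close> persists in a neighbourhood. There the quartic term separates \<open>\<psi>\<close> from \<open>u\<close>.
\<close>

lemma touching_neighbourhood:
  fixes \<phi> \<psi> u f p :: "'a::euclidean_space \<Rightarrow> real"
  assumes \<Omega>: "open \<Omega>" and \<phi>: "Ck_on 2 \<phi> \<Omega>" and p: "Ck_on (Suc 0) p \<Omega>" and f: "continuous_on \<Omega> f"
    and z: "z \<in> \<Omega>" and touch: "touches_from_below \<phi> u z" and nz: "grad \<phi> z \<noteq> 0"
    and lt: "f z < px_laplacian p \<phi> z"
    and \<psi>_def: "\<psi> = (\<lambda>x. \<phi> x - ((x - z) \<bullet> (x - z)) * ((x - z) \<bullet> (x - z)))"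
  obtains r c where "r > 0" "c > 0" "cball z (2 * r) \<subseteq> \<Omega>"
    "\<And>x. x \<in> cball z (2 * r) \<Longrightarrow> grad \<psi> x \<noteq> 0"
    "\<And>x. x \<in> cball z (2 * r) \<Longrightarrow> f x + c \<le> px_laplacian p \<psi> x"
    "\<And>x. x \<in> cball z (2 * r) \<Longrightarrow> \<psi> x + (dist z x) ^ 4 \<le> u x"
proof -
  have \<psi>: "Ck_on 2 \<psi> \<Omega>" "grad \<psi> z = grad \<phi> z" "px_laplacian p \<psi> z = px_laplacian p \<phi> z"
    unfolding \<psi>_def using quartic_perturbation[OF \<Omega> \<phi> z] by simp_all
  have "Ck_on (Suc (Suc 0)) \<psi> \<Omega>" using \<psi>(1) by (simp add: numeral_2_eq_2)
  then have cg: "continuous_on \<Omega> (grad \<psi>)" by (rule Ck_on_continuous_grad)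
  define U where "U = \<Omega> \<inter> grad \<psi> -` (- {0})"
  have U: "open U" "z \<in> U" "U \<subseteq> \<Omega>"
    unfolding U_def using continuous_open_preimage[OF cg \<Omega>, of "- {0}"] z nz \<psi>(2) by auto
  have cpx: "continuous_on U (px_laplacian p \<psi>)"
    by (rule continuous_on_px_laplacian[OF U(1) Ck_on_subset[OF \<psi>(1) U(3)] Ck_on_subset[OF p U(3)]])
      (simp add: U_def)
  define c where "c = (px_laplacian p \<psi> z - f z) / 2"
  have c: "c > 0" using lt \<psi>(3) by (simp add: c_def)
  have "continuous_on U (\<lambda>x. px_laplacian p \<psi> x - f x)"
    by (intro continuous_intros cpx continuous_on_subset[OF f U(3)])
  then have "isCont (\<lambda>x. px_laplacian p \<psi> x - f x) z"
    using U(1,2) by (simp add: continuous_on_eq_continuous_at)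
  then have "((\<lambda>x. px_laplacian p \<psi> x - f x) \<longlongrightarrow> px_laplacian p \<psi> z - f z) (nhds z)"
    unfolding isCont_def
    by (rule tendsto_at_iff_tendsto_nhds[where g="\<lambda>x. px_laplacian p \<psi> x - f x", THEN iffD1])
  then have "\<forall>\<^sub>F x in nhds z. c < px_laplacian p \<psi> x - f x"
    by (rule order_tendstoD) (use c in \<open>simp add: c_def\<close>)
  moreover have "\<forall>\<^sub>F x in nhds z. \<phi> x \<le> u x" using touch by (simp add: touches_from_below_def)
  moreover have "\<forall>\<^sub>F x in nhds z. x \<in> U" using U(1,2) by (rule eventually_nhds_in_open)
  ultimately have "\<forall>\<^sub>F x in nhds z. x \<in> U \<and> \<phi> x \<le> u x \<and> c < px_laplacian p \<psi> x - f x"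
    by eventually_elim auto
  then obtain d where d: "d > 0"
    "\<And>x. dist x z < d \<Longrightarrow> x \<in> U \<and> \<phi> x \<le> u x \<and> c < px_laplacian p \<psi> x - f x"
    unfolding eventually_nhds_metric by blast
  have in_d: "dist x z < d" if "x \<in> cball z (2 * (d / 4))" for x
    using that d(1) by (simp add: dist_commute)
  have q: "\<psi> x + (dist z x) ^ 4 = \<phi> x" for x
  proof -
    have "(dist z x) ^ 4 = ((dist z x)\<^sup>2)\<^sup>2" by (simp flip: power_mult)
    also have "\<dots> = ((x - z) \<bullet> (x - z)) * ((x - z) \<bullet> (x - z))"
      by (simp add: dist_norm norm_minus_commute dot_square_norm power2_eq_square)
    finally show ?thesis by (simp add: \<psi>_def)
  qed
  show ?thesis
  proof (rule that[of "d / 4" c])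
    show "cball z (2 * (d / 4)) \<subseteq> \<Omega>" using d(2)[OF in_d] U(3) by blast
    show "grad \<psi> x \<noteq> 0" if "x \<in> cball z (2 * (d / 4))" for x
      using d(2)[OF in_d[OF that]] by (auto simp: U_def)
    show "f x + c \<le> px_laplacian p \<psi> x" if "x \<in> cball z (2 * (d / 4))" for x
      using d(2)[OF in_d[OF that]] by simp
    show "\<psi> x + (dist z x) ^ 4 \<le> u x" if "x \<in> cball z (2 * (d / 4))" for x
      using d(2)[OF in_d[OF that]] q[of x] by simp
  qed (use d c in auto)
qed

text \<open>
  The comparison argument described at the beginning, for a fixed small \<open>\<epsilon>\<close>. On the ball of radius
  \<open>2r\<close> all data are defined; the test function lives in the ball of radius \<open>r\<close>, which leaves room for
  mollification with \<open>\<epsilon> < r\<close>.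
\<close>

lemma weak_solution_imp_viscosity_supersolution:
  fixes \<Omega> :: "'a::euclidean_space set" and p f u :: "'a \<Rightarrow> real"
  assumes \<Omega>: "open \<Omega>"
    and pb: "\<And>x. x \<in> \<Omega> \<Longrightarrow> 1 \<le> p x" "\<And>x. x \<in> \<Omega> \<Longrightarrow> p x \<le> P"
    and lip: "K-lipschitz_on \<Omega> p"
    and f: "continuous_on \<Omega> f" and p: "Ck_on (Suc 0) p \<Omega>"
    and u: "continuous_on \<Omega> u" and sol: "weak_solution \<Omega> p f u"
  shows "viscosity_supersolution \<Omega> p f u"
  unfolding viscosity_supersolution_def
proof (intro allI impI, rule ccontr)
  fix \<phi> z
  assume \<phi>: "Ck_on 2 \<phi> \<Omega>" and z: "z \<in> \<Omega>" and touch: "touches_from_below \<phi> u z"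
    and nz: "grad \<phi> z \<noteq> 0" and "\<not> px_laplacian p \<phi> z \<le> f z"
  then have lt: "f z < px_laplacian p \<phi> z" by simp
  define \<psi> where "\<psi> = (\<lambda>x. \<phi> x - ((x - z) \<bullet> (x - z)) * ((x - z) \<bullet> (x - z)))"
  have \<psi>C: "Ck_on 2 \<psi> \<Omega>"
    unfolding \<psi>_def using quartic_perturbation(1)[OF \<Omega> \<phi> z] .
  have \<psi>C1: "Ck_on (Suc 0) \<psi> \<Omega>" by (rule Ck_on_mono[OF \<psi>C]) simp
  obtain r c where r: "r > 0" and c: "c > 0" and S\<Omega>: "cball z (2 * r) \<subseteq> \<Omega>"
    and nz': "\<And>x. x \<in> cball z (2 * r) \<Longrightarrow> grad \<psi> x \<noteq> 0"
    and px: "\<And>x. x \<in> cball z (2 * r) \<Longrightarrow> f x + c \<le> px_laplacian p \<psi> x"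
    and \<psi>u: "\<And>x. x \<in> cball z (2 * r) \<Longrightarrow> \<psi> x + (dist z x) ^ 4 \<le> u x"
    by (rule touching_neighbourhood[OF \<Omega> \<phi> p f z touch nz lt \<psi>_def]) (rule that)
  let ?S = "cball z (2 * r)" and ?B = "ball z r"
  have BS: "?B \<subseteq> ?S" "cball z r \<subseteq> ?S" using r by auto
  obtain G where G: "weak_gradient \<Omega> u G" "G \<in> Lvar \<Omega> p"
    and weak: "\<And>\<theta>. \<theta> \<in> test_functions \<Omega> \<Longrightarrow>
      - (LINT x|lebesgue_on \<Omega>. pflux (p x) (G x) \<bullet> grad \<theta> x) = (LINT x|lebesgue_on \<Omega>. \<theta> x * f x)"
    using sol unfolding weak_solution_def pflux_def by blast
  have sets: "\<Omega> \<in> sets lebesgue" "?S \<in> sets lebesgue" using \<Omega> by (auto simp: borel_open)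

  \<comment> \<open>The competitor \<open>w\<close> is positive near \<open>z\<close> and negative on the annulus \<open>r/2 \<le> |x - z| \<le> 2r\<close>.\<close>
  define m where "m = (r / 2) ^ 4 / 2"
  have m: "m > 0" using r by (simp add: m_def)
  define w where "w x = (\<psi> x + m) - u x" for x
  have wz: "w z = m" using touch by (simp add: w_def \<psi>_def touches_from_below_def)
  have cw: "continuous_on \<Omega> w"
    unfolding w_def by (intro continuous_intros u Ck_on_imp_continuous_on[OF \<psi>C])
  have wneg: "w x \<le> - m" if "x \<in> ?S" "r / 2 \<le> dist z x" for x
  proof -
    have "(r / 2) ^ 4 \<le> (dist z x) ^ 4" using that r by (intro power_mono) auto
    then show ?thesis using \<psi>u[OF that(1)] by (simp add: w_def m_def)
  qed
  have gw: "weak_gradient \<Omega> w (\<lambda>x. grad \<psi> x - G x)"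
  proof -
    have "Ck_on (Suc 0) (\<lambda>x. \<psi> x + m) \<Omega>" by (intro Ck_on_add Ck_on_const \<Omega> \<psi>C1)
    from weak_gradient_diff[OF \<Omega> weak_gradient_C1[OF \<Omega> this] G(1)]
    have "weak_gradient \<Omega> w (\<lambda>x. grad (\<lambda>x. \<psi> x + m) x - G x)" unfolding w_def .
    moreover have "grad (\<lambda>x. \<psi> x + m) = grad \<psi>"
      by (rule ext) (rule grad_add_const)
    ultimately show ?thesis by simp
  qed
  define w0 where "w0 x = (if x \<in> ?S then w x else 0)" for x
  have w0i: "integrable lebesgue w0"
    unfolding w0_def[abs_def]
    by (rule locally_integrable_extend_0[OF locally_integrable_continuous[OF cw] compact_cball S\<Omega>])

  \<comment> \<open>Outside \<open>S\<close> the fields are set to zero and the exponent to 1; then \<open>|V|\<^sup>q\<close> and \<open>N\<^sup>q\<close> vanish there.\<close>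
  define q where "q x = (if x \<in> ?S then p x else 1)" for x
  define P' where "P' = max 1 P"
  have q1: "1 \<le> q x" and qP: "q x \<le> P'" for x
    using pb[of x] S\<Omega> by (auto simp: q_def P'_def)
  have cp: "continuous_on \<Omega> p" using Ck_on_imp_continuous_on[OF p] .
  have qm: "q \<in> borel_measurable lebesgue"
  proof -
    have [measurable]: "(\<lambda>x. if x \<in> ?S then p x else 0) \<in> borel_measurable lebesgue"
      by (rule borel_measurable_integrable[OF locally_integrable_extend_0[OF
              locally_integrable_continuous[OF cp] compact_cball S\<Omega>]])
    have [measurable]: "?S \<in> sets lebesgue" by (rule sets(2))
    have "(\<lambda>x. (if x \<in> ?S then p x else 0) + (1 - indicator ?S x)) \<in> borel_measurable lebesgue"
      by measurable
    also have "(\<lambda>x. (if x \<in> ?S then p x else 0) + (1 - indicator ?S x)) = q"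
      by (auto simp: q_def indicator_def)
    finally show ?thesis .
  qed
  have ql: "\<bar>q x - q y\<bar> \<le> K * dist x y" if "x \<in> ?S" "y \<in> ?S" for x y
    using lipschitz_onD[OF lip subsetD[OF S\<Omega> that(1)] subsetD[OF S\<Omega> that(2)]] that
    by (simp add: q_def dist_real_def)
  have K: "K \<ge> 0" using lipschitz_on_nonneg[OF lip] .
  define V where "V x = (if x \<in> ?S then grad \<psi> x - G x else 0)" for x
  have "bounded (grad \<psi> ` ?S)"
    by (intro compact_imp_bounded compact_continuous_image compact_cball
        continuous_on_subset[OF Ck_on_continuous_grad[OF \<psi>C1] S\<Omega>])
  then obtain k0 where k0: "\<And>x. x \<in> ?S \<Longrightarrow> norm (grad \<psi> x) \<le> k0"
    unfolding bounded_iff by blast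
  \<comment> \<open>With \<open>k \<ge> 1\<close> the weight \<open>N\<close> dominates both gradients and satisfies \<open>N\<^bsup>p-1\<^esup> \<le> N\<^bsup>p\<^esup>\<close> on the ball.\<close>
  define k where "k = max 1 k0"
  have k: "k \<ge> 1" "\<And>x. x \<in> ?S \<Longrightarrow> norm (grad \<psi> x) \<le> k" 
    using k0 by (simp_all add: k_def max.coboundedI2)
  define N where "N x = (if x \<in> ?S then norm (G x) + k else 0)" for x
  have N0: "N x \<ge> 0" for x using k(1) by (simp add: N_def)
  have N1: "N x \<ge> 1" if "x \<in> ?S" for x using k(1) that by (simp add: N_def add_increasing)
  define GS where "GS x = (if x \<in> ?S then G x else 0)" for x
  have GSm [measurable]: "GS \<in> borel_measurable lebesgue"
    unfolding GS_def using G(2) S\<Omega> sets by (intro measurable_on_extend_0[of _ \<Omega>]) (auto simp: Lvar_def)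
  have Nm: "N \<in> borel_measurable lebesgue"
  proof -
    have "(\<lambda>x. norm (GS x) + k * indicator ?S x) \<in> borel_measurable lebesgue"
      using sets(2) by measurable
    also have "(\<lambda>x. norm (GS x) + k * indicator ?S x) = N" by (auto simp: GS_def N_def)
    finally show ?thesis .
  qed
  have Si: "integrable lebesgue (\<lambda>x. indicator ?S x :: real)"
    using lmeasurable_cball[of z "2 * r"] by (intro integrable_real_indicator) (auto simp: fmeasurable_def)
  have GSi: "integrable lebesgue (\<lambda>x. norm (GS x) powr q x)"
  proof (rule integrableI_nonneg)
    show "(\<lambda>x. norm (GS x) powr q x) \<in> borel_measurable lebesgue" using qm by measurable
    have "(\<integral>\<^sup>+x. ennreal (norm (GS x) powr q x) \<partial>lebesgue)
        \<le> (\<integral>\<^sup>+x. ennreal (norm (G x) powr p x) * indicator \<Omega> x \<partial>lebesgue)"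
      using S\<Omega> by (intro nn_integral_mono) (auto simp: GS_def q_def indicator_def)
    also have "\<dots> = (\<integral>\<^sup>+x. ennreal (norm (G x) powr p x) \<partial>lebesgue_on \<Omega>)"
      using sets by (simp add: nn_integral_restrict_space)
    also have "\<dots> < \<infinity>" using G(2) by (simp add: Lvar_def)
    finally show "(\<integral>\<^sup>+x. ennreal (norm (GS x) powr q x) \<partial>lebesgue) < \<infinity>" .
  qed simp
  have Ni: "integrable lebesgue (\<lambda>x. N x powr q x)"
  proof (rule Bochner_Integration.integrable_bound)
    show "integrable lebesgue (\<lambda>x. 2 powr P' * (norm (GS x) powr q x + k powr P' * indicator ?S x))"
      using GSi Si by simp
    show "(\<lambda>x. N x powr q x) \<in> borel_measurable lebesgue" using Nm qm by measurable
    show "AE x in lebesgue. norm (N x powr q x) \<le>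
        norm (2 powr P' * (norm (GS x) powr q x + k powr P' * indicator ?S x))"
    proof (rule AE_I2)
      fix x
      show "norm (N x powr q x) \<le> norm (2 powr P' * (norm (GS x) powr q x + k powr P' * indicator ?S x))"
      proof (cases "x \<in> ?S")
        case True
        have "N x powr q x \<le> 2 powr P' * (norm (GS x) powr q x + k powr q x)"
          using True k(1) powr_add_le[of "norm (GS x)" k "q x" P', OF _ _ q1 qP]
          by (simp add: N_def GS_def)
        also have "\<dots> \<le> 2 powr P' * (norm (GS x) powr q x + k powr P')"
          by (intro mult_left_mono add_left_mono powr_mono[OF qP k(1)]) simp
        finally show ?thesis using True by simp
      qed (simp add: N_def)
    qed
  qed
  have VN: "norm (V x) \<le> N x" for x
  proof (cases "x \<in> ?S")
    case True
    then show ?thesis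
      using norm_triangle_ineq4[of "grad \<psi> x" "G x"] k(2)[OF True] by (simp add: V_def N_def)
  qed (simp add: V_def N_def)
  have Vi: "integrable lebesgue V"
    unfolding V_def[abs_def]
    by (rule locally_integrable_extend_0[OF _ compact_cball S\<Omega>])
      (use gw in \<open>simp add: weak_gradient_def\<close>)
  have Vp: "integrable lebesgue (\<lambda>x. norm (V x) powr q x)"
  proof (rule Bochner_Integration.integrable_bound[OF Ni])
    show "(\<lambda>x. norm (V x) powr q x) \<in> borel_measurable lebesgue"
      using qm borel_measurable_integrable[OF Vi] by measurable
    show "AE x in lebesgue. norm (norm (V x) powr q x) \<le> norm (N x powr q x)"
      using VN order_trans[OF zero_le_one q1] by (intro AE_I2) (simp add: powr_mono2)
  qed
  have V_off: "V x = 0" if "x \<notin> ?S" for x using that by (simp add: V_def)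
  have Nic: "integrable lebesgue (\<lambda>x. indicator (cball z r) x * N x powr q x)"
    using integrable_real_mult_indicator[OF _ Ni, of "cball z r"] by (simp add: mult.commute)

  \<comment> \<open>The constant \<open>\<kappa>\<close> will bound the integral of \<open>\<theta>\<close> from below, whatever \<open>\<epsilon>\<close> is; the error
    tolerance \<open>\<delta>\<close> has to be fixed in terms of it before \<open>\<epsilon>\<close> is chosen.\<close>
  have "isCont w z" using cw \<Omega> z by (simp add: continuous_on_eq_continuous_at)
  then obtain s0 where s0: "s0 > 0" "\<And>x. dist x z < s0 \<Longrightarrow> dist (w x) (w z) < m / 4"
    using m unfolding continuous_at_eps_delta by (metis divide_pos_pos zero_less_numeral)
  define s where "s = min s0 r"
  have s: "s > 0" "s \<le> r" "s \<le> s0" using s0 r by (auto simp: s_def)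
  define \<kappa> where "\<kappa> = flat 0 (m / 2) * measure lebesgue (ball z s)"
  have \<kappa>: "\<kappa> > 0" unfolding \<kappa>_def using m s by (simp add: flat_pos content_ball_pos)
  \<comment> \<open>The error enters with a factor 4: one 2 bounds \<open>H'\<close>, the other counts the two fluxes.\<close>
  define \<delta> where "\<delta> = c * \<kappa> / 8"
  have \<delta>: "\<delta> > 0" using c \<kappa> by (simp add: \<delta>_def)
  obtain \<epsilon>0 where \<epsilon>0: "\<epsilon>0 > 0" and err: "\<And>\<epsilon>. 0 < \<epsilon> \<Longrightarrow> \<epsilon> < \<epsilon>0 \<Longrightarrow>
    integrable lebesgue (\<lambda>x. indicator (cball z r) x *
        (N x powr (q x - 1) * norm (conv (mollifier \<epsilon>) V x - V x))) \<and>
    (LINT x|lebesgue. indicator (cball z r) x *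
        (N x powr (q x - 1) * norm (conv (mollifier \<epsilon>) V x - V x))) \<le> \<delta>"
    by (rule mollification_error[OF r qm q1 qP ql K Vi V_off Vp Nm N0 Nic \<delta>])
      (assumption+, rule that)
  have "uniformly_continuous_on ?S w"
    by (intro compact_uniformly_continuous continuous_on_subset[OF cw S\<Omega>] compact_cball)
  then obtain \<epsilon>1 where \<epsilon>1: "\<epsilon>1 > 0"
    "\<And>x y. x \<in> ?S \<Longrightarrow> y \<in> ?S \<Longrightarrow> dist y x < \<epsilon>1 \<Longrightarrow> dist (w y) (w x) < m / 4"
    using m uniformly_continuous_onE[of ?S w "m / 4"] by (metis divide_pos_pos zero_less_numeral)
  define \<epsilon> where "\<epsilon> = min (min \<epsilon>0 \<epsilon>1) r / 2"
  have \<epsilon>: "0 < \<epsilon>" "\<epsilon> < \<epsilon>0" "\<epsilon> < \<epsilon>1" "\<epsilon> < r" using \<epsilon>0 \<epsilon>1 r by (auto simp: \<epsilon>_def)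
  note \<eta> = mollifier_test_function_UNIV[OF \<epsilon>(1), where 'a='a]
  have ball_sub: "cball x \<epsilon> \<subseteq> ?S" if "x \<in> cball z r" for x
  proof
    fix y assume "y \<in> cball x \<epsilon>"
    then show "y \<in> ?S" using that \<epsilon>(4) dist_triangle[of z y x] by simp
  qed

  define W where "W = conv (mollifier \<epsilon>) w0"
  have WC: "Ck_on j W UNIV" for j unfolding W_def by (rule Ck_on_conv[OF \<eta> w0i])
  have Ww: "\<bar>W x - w x\<bar> \<le> m / 4" if "x \<in> cball z r" for x
  proof -
    have xS: "x \<in> ?S" using that BS by blast
    have "norm (conv (mollifier \<epsilon>) w0 x - w x) \<le> m / 4"
    proof (rule mollification_close[OF \<epsilon>(1) w0i])
      fix y assume y: "y \<in> cball x \<epsilon>"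
      then have yS: "y \<in> ?S" using ball_sub[OF that] by blast
      have "dist (w y) (w x) < m / 4" using \<epsilon>1(2)[OF xS yS] y \<epsilon>(3) by (simp add: dist_commute)
      then show "norm (w0 y - w x) \<le> m / 4" using yS by (simp add: w0_def dist_norm)
    qed
    then show ?thesis by (simp add: W_def)
  qed
  have gW: "grad W x = conv (mollifier \<epsilon>) V x" if "x \<in> cball z r" for x
  proof (rule euclidean_eqI)
    fix b :: 'a assume b: "b \<in> Basis"
    have "grad W x \<bullet> b = conv (\<lambda>y. frechet_derivative (mollifier \<epsilon>) (at y) b) w0 x"
      unfolding W_def grad_inner_Basis[OF b] by (rule frechet_derivative_conv[OF \<eta> w0i b])
    also have "\<dots> = conv (mollifier \<epsilon>) (\<lambda>y. if y \<in> ?S then (grad \<psi> y - G y) \<bullet> b else 0) x"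
      unfolding w0_def[abs_def]
      by (rule weak_gradient_mollification[OF \<epsilon>(1) gw ball_sub[OF that] S\<Omega> sets(1) b])
    also have "(\<lambda>y. if y \<in> ?S then (grad \<psi> y - G y) \<bullet> b else 0) = (\<lambda>y. V y \<bullet> b)"
      by (auto simp: V_def)
    also have "conv (mollifier \<epsilon>) (\<lambda>y. V y \<bullet> b) x = conv (mollifier \<epsilon>) V x \<bullet> b"
      by (rule conv_inner[OF \<eta> Vi, symmetric])
    finally show "grad W x \<bullet> b = conv (mollifier \<epsilon>) V x \<bullet> b" .
  qed
  define \<theta> where "\<theta> x = (if x \<in> ?B then flat 0 (W x) else 0)" for x
  have Wneg: "W x \<le> 0" if "dist z x < r" "r / 2 < dist z x" for x
  proof -
    have "\<bar>W x - w x\<bar> \<le> m / 4" "w x \<le> - m" using Ww[of x] wneg[of x] that r by simp_all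
    then show ?thesis using m by linarith
  qed
  have r2: "r / 2 < r" using r by simp
  have \<theta>B: "\<theta> \<in> test_functions ?B"
    unfolding \<theta>_def[abs_def] by (rule cutoff_test_function(1)[OF WC r2 Wneg])
  have g\<theta>: "grad \<theta> x = flat 2 (W x) *\<^sub>R grad W x" if "x \<in> ?B" for x
    unfolding \<theta>_def[abs_def] by (rule cutoff_test_function(2)[OF WC r2 Wneg that])
  have \<theta>\<Omega>: "\<theta> \<in> test_functions \<Omega>" using test_functions_mono[OF \<theta>B] BS S\<Omega> by blast
  have \<theta>0: "\<theta> x \<ge> 0" for x by (simp add: \<theta>_def flat_nonneg)
  obtain C where C: "compact C" "C \<subseteq> ?B" "\<And>x. x \<notin> C \<Longrightarrow> \<theta> x = 0"
    "\<And>x. x \<notin> C \<Longrightarrow> frechet_derivative \<theta> (at x) = (\<lambda>h. 0)"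
    using test_functionsE[OF \<theta>B] by metis
  have g\<theta>0: "grad \<theta> x = 0" if "x \<notin> ?B" for x
  proof -
    have "x \<notin> C" using that C(2) by blast
    then show ?thesis by (simp add: grad_def C(4))
  qed
  have \<theta>i: "integrable lebesgue \<theta>"
    by (rule integrable_compact_support[OF test_functions_continuous[OF \<theta>B] C(1,3)])
  have mass: "\<kappa> \<le> (LINT x|lebesgue. \<theta> x)"
  proof -
    have bi: "integrable lebesgue (\<lambda>x. indicator (ball z s) x :: real)"
      using lmeasurable_ball[of z s] by (intro integrable_real_indicator) (auto simp: fmeasurable_def)
    have "\<kappa> = (LINT x|lebesgue. flat 0 (m / 2) * indicator (ball z s) x)"
      by (simp add: \<kappa>_def)
    also have "\<dots> \<le> (LINT x|lebesgue. \<theta> x)"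
    proof (rule integral_mono[OF integrable_mult_right[OF bi] \<theta>i])
      fix x
      show "flat 0 (m / 2) * indicator (ball z s) x \<le> \<theta> x"
      proof (cases "x \<in> ball z s")
        case True
        then have "dist (w x) (w z) < m / 4" "x \<in> cball z r" "x \<in> ?B"
          using s0(2)[of x] s by (auto simp: dist_commute)
        then have "m / 2 \<le> W x"
          using Ww[of x] wz m unfolding dist_real_def by linarith
        then show ?thesis using True \<open>x \<in> ?B\<close> by (simp add: \<theta>_def flat_mono)
      qed (simp add: \<theta>0)
    qed
    finally show ?thesis .
  qed

  let ?a = "\<lambda>x. pflux (p x) (grad \<psi> x) \<bullet> grad \<theta> x" and ?b = "\<lambda>x. pflux (p x) (G x) \<bullet> grad \<theta> x"
  have nzB: "\<And>x. x \<in> ?B \<Longrightarrow> grad \<psi> x \<noteq> 0" using nz' BS by blast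
  have B\<Omega>: "?B \<subseteq> \<Omega>" using BS S\<Omega> by blast
  have \<theta>_off: "\<theta> x = 0" "grad \<theta> x = 0" if "x \<notin> \<Omega>" for x
  proof -
    have "x \<notin> ?B" using that B\<Omega> by blast
    then show "\<theta> x = 0" "grad \<theta> x = 0" by (simp add: \<theta>_def, rule g\<theta>0)
  qed
  note ibp = pflux_integration_by_parts[OF open_ball Ck_on_subset[OF \<psi>C B\<Omega>]
      Ck_on_subset[OF p B\<Omega>] nzB \<theta>B]
  have fi: "integrable lebesgue (\<lambda>x. \<theta> x * f x)"
  proof (rule integrable_compact_support[OF _ C(1)])
    have "Ck_on 0 f \<Omega>" using f by simp
    from Ck_on_mult_test_function[OF \<Omega> this \<theta>\<Omega>]
    have "continuous_on UNIV (\<lambda>x. if x \<in> \<Omega> then f x * \<theta> x else 0)" by simp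
    also have "(\<lambda>x. if x \<in> \<Omega> then f x * \<theta> x else 0) = (\<lambda>x. \<theta> x * f x)"
      by (rule ext) (simp add: \<theta>_off)
    finally show "continuous_on UNIV (\<lambda>x. \<theta> x * f x)" .
  qed (simp add: C(3))
  have eqG: "- (LINT x|lebesgue. ?b x) = (LINT x|lebesgue. \<theta> x * f x)"
  proof -
    have "(LINT x|lebesgue_on \<Omega>. ?b x) = (LINT x|lebesgue. ?b x)"
      by (rule lebesgue_on_integral_support[OF \<Omega>]) (simp add: \<theta>_off)
    moreover have "(LINT x|lebesgue_on \<Omega>. \<theta> x * f x) = (LINT x|lebesgue. \<theta> x * f x)"
      by (rule lebesgue_on_integral_support[OF \<Omega>]) (simp add: \<theta>_off)
    ultimately show ?thesis using weak[OF \<theta>\<Omega>] by simp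
  qed
  have NS: "norm (pflux (p x) v) \<le> N x powr (q x - 1)" if "x \<in> ?S" "norm v \<le> N x" for x v
    using that q1[of x] unfolding norm_pflux by (auto simp: q_def intro!: powr_mono2)
  have bi: "integrable lebesgue ?b"
  proof -
    have cg\<theta>: "continuous_on UNIV (grad \<theta>)"
      using Ck_on_continuous_grad[OF test_functions_Ck[OF \<theta>B, of "Suc 0"]] .
    obtain M where M: "M > 0" "\<And>x. norm (grad \<theta> x) \<le> M"
      by (rule bounded_compact_support[OF cg\<theta> C(1)]) (simp_all add: grad_def C(4) that)
    have "?b = (\<lambda>x. (norm (GS x) powr (q x - 2) *\<^sub>R GS x) \<bullet> grad \<theta> x)"
      using g\<theta>0 BS by (force simp: GS_def q_def pflux_def)
    moreover have "(\<lambda>x. (norm (GS x) powr (q x - 2) *\<^sub>R GS x) \<bullet> grad \<theta> x) \<in> borel_measurable lebesgue"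
      using qm borel_measurable_lebesgue_continuous[OF cg\<theta>] by measurable
    ultimately have meas: "?b \<in> borel_measurable lebesgue" by simp
    show ?thesis
    proof (rule Bochner_Integration.integrable_bound[OF integrable_mult_right[OF Ni, of M] meas], rule AE_I2)
      fix x
      show "norm (?b x) \<le> norm (M * N x powr q x)"
      proof (cases "x \<in> ?B")
        case True
        then have xS: "x \<in> ?S" using BS by blast
        have "norm (?b x) \<le> norm (pflux (p x) (G x)) * norm (grad \<theta> x)"
          using Cauchy_Schwarz_ineq2 by simp
        also have "\<dots> \<le> N x powr (q x - 1) * M"
          using xS k(1) by (intro mult_mono NS M(2)) (auto simp: N_def)
        also have "\<dots> \<le> N x powr q x * M"
          using N1[OF xS] M(1) by (intro mult_right_mono powr_mono) auto
        finally show ?thesis using M(1) by (simp add: abs_mult mult.commute)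
      qed (simp add: g\<theta>0)
    qed
  qed
  have upper: "(LINT x|lebesgue. ?a x - ?b x) \<le> - c * \<kappa>"
  proof -
    have "(LINT x|lebesgue. ?a x - ?b x) =
        (LINT x|lebesgue. \<theta> x * f x) - (LINT x|lebesgue. \<theta> x * px_laplacian p \<psi> x)"
      using ibp bi eqG by simp
    also have "\<dots> = (LINT x|lebesgue. \<theta> x * f x - \<theta> x * px_laplacian p \<psi> x)"
      using fi ibp(2) by simp
    also have "\<dots> \<le> (LINT x|lebesgue. - c * \<theta> x)"
    proof (rule integral_mono)
      show "integrable lebesgue (\<lambda>x. \<theta> x * f x - \<theta> x * px_laplacian p \<psi> x)"
        using fi ibp(2) by simp
      show "integrable lebesgue (\<lambda>x. - c * \<theta> x)" using \<theta>i by simp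
      fix x
      show "\<theta> x * f x - \<theta> x * px_laplacian p \<psi> x \<le> - c * \<theta> x"
      proof (cases "x \<in> ?B")
        case True
        then have "f x + c \<le> px_laplacian p \<psi> x" using px BS by blast
        then have "\<theta> x * (f x + c) \<le> \<theta> x * px_laplacian p \<psi> x" using \<theta>0 by (intro mult_left_mono)
        then show ?thesis by (simp add: algebra_simps)
      qed (simp add: \<theta>_def)
    qed
    also have "\<dots> = - c * (LINT x|lebesgue. \<theta> x)" by simp
    also have "\<dots> \<le> - c * \<kappa>" using mass c by simp
    finally show ?thesis .
  qed
  let ?E = "\<lambda>x. indicator (cball z r) x * (N x powr (q x - 1) * norm (conv (mollifier \<epsilon>) V x - V x))"
  have lower: "- 4 * \<delta> \<le> (LINT x|lebesgue. ?a x - ?b x)"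
  proof -
    note E = err[OF \<epsilon>(1,2)]
    have "- 4 * \<delta> \<le> - 4 * (LINT x|lebesgue. ?E x)" using E by simp
    also have "\<dots> = (LINT x|lebesgue. - 4 * ?E x)" by simp
    also have "\<dots> \<le> (LINT x|lebesgue. ?a x - ?b x)"
    proof (rule integral_mono)
      show "integrable lebesgue (\<lambda>x. - 4 * ?E x)" using E by (intro integrable_mult_right) blast
      show "integrable lebesgue (\<lambda>x. ?a x - ?b x)" using ibp(1) bi by simp
      fix x
      show "- 4 * ?E x \<le> ?a x - ?b x"
      proof (cases "x \<in> ?B")
        case True
        then have xS: "x \<in> ?S" and xB: "x \<in> cball z r" using BS by auto
        let ?D = "pflux (p x) (grad \<psi> x) - pflux (p x) (G x)"
        let ?R = "conv (mollifier \<epsilon>) V x - V x"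
        have D: "norm ?D \<le> 2 * N x powr (q x - 1)"
        proof -
          have "norm (grad \<psi> x) \<le> N x" "norm (G x) \<le> N x"
            using k(1) k(2)[OF xS] xS by (auto simp: N_def add_increasing)
          then show ?thesis
            using norm_triangle_ineq4[of "pflux (p x) (grad \<psi> x)" "pflux (p x) (G x)"]
              NS[OF xS, of "grad \<psi> x"] NS[OF xS, of "G x"] by linarith
        qed
        have "p x \<ge> 1" using pb xS S\<Omega> by blast
        then have mono: "?D \<bullet> V x \<ge> 0" using pflux_monotone[of "p x" "grad \<psi> x" "G x"] xS
          by (simp add: V_def)
        have "?a x - ?b x = ?D \<bullet> (flat 2 (W x) *\<^sub>R conv (mollifier \<epsilon>) V x)"
          by (simp add: g\<theta>[OF True] gW[OF xB] inner_diff_left right_diff_distrib)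
        also have "\<dots> = flat 2 (W x) * (?D \<bullet> V x + ?D \<bullet> ?R)"
          by (simp add: inner_diff_right[of ?D "conv (mollifier \<epsilon>) V x" "V x"])
        also have "\<dots> \<ge> flat 2 (W x) * (- (norm ?D * norm ?R))"
          using mono Cauchy_Schwarz_ineq2[of ?D ?R]
          by (intro mult_left_mono flat_nonneg) (auto simp: abs_le_iff)
        finally have 1: "flat 2 (W x) * (- (norm ?D * norm ?R)) \<le> ?a x - ?b x" .
        have "flat 2 (W x) * (norm ?D * norm ?R) \<le> 2 * ((2 * N x powr (q x - 1)) * norm ?R)"
          using D flat_le[of 2 "W x"] by (intro mult_mono) (auto simp: flat_nonneg fact_numeral)
        then have "- 4 * ?E x \<le> flat 2 (W x) * (- (norm ?D * norm ?R))" using xB by simp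
        then show ?thesis using 1 by linarith
      next
        case False
        then show ?thesis by (simp add: g\<theta>0)
      qed
    qed
    finally show ?thesis .
  qed
  have "c * \<kappa> > 0" using c \<kappa> by simp
  moreover have "c * \<kappa> \<le> 4 * \<delta>" using upper lower by linarith
  moreover have "4 * \<delta> = c * \<kappa> / 2" by (simp add: \<delta>_def)
  ultimately show False by linarith
qed

lemma grad_minus:
  assumes "f differentiable at x"
  shows "grad (\<lambda>x. - f x) x = - grad f x"
  by (rule grad_eqI) (use has_derivative_minus[OF has_derivative_grad[OF assms]] in simp)

lemma px_laplacian_minus:
  assumes \<Omega>: "open \<Omega>" and \<phi>: "Ck_on 2 \<phi> \<Omega>" and x: "x \<in> \<Omega>"
  shows "px_laplacian p (\<lambda>x. - \<phi> x) x = - px_laplacian p \<phi> x"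
proof -
  have d: "\<phi> differentiable at y" if "y \<in> \<Omega>" for y
    using Ck_on_mono[OF \<phi>, of "Suc 0"] that by simp
  have "(grad (\<lambda>x. - \<phi> x) has_derivative (\<lambda>h. - hessian \<phi> x h)) (at x)"
    by (rule has_derivative_transform_within_open[OF
          has_derivative_minus[OF grad_has_derivative[OF \<phi> x]] \<Omega> x])
      (simp add: grad_minus d)
  then have h: "hessian (\<lambda>x. - \<phi> x) x = (\<lambda>h. - hessian \<phi> x h)"
    by (simp add: hessian_def[of "\<lambda>x. - \<phi> x"] frechet_derivative_at[symmetric])
  have l: "hessian \<phi> x (- v) = - hessian \<phi> x v" for v
    using linear_neg[OF has_derivative_linear[OF grad_has_derivative[OF \<phi> x]]] .
  show ?thesis
    by (simp add: px_laplacian_def laplacian_def h l grad_minus[OF d[OF x]] sum_negf algebra_simps)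
qed

lemma weak_gradient_minus:
  assumes "weak_gradient \<Omega> u G"
  shows "weak_gradient \<Omega> (\<lambda>x. - u x) (\<lambda>x. - G x)"
  using assms unfolding weak_gradient_def locally_integrable_def set_integrable_def by simp

lemma weak_solution_minus:
  assumes "weak_solution \<Omega> p f u"
  shows "weak_solution \<Omega> p (\<lambda>x. - f x) (\<lambda>x. - u x)"
proof -
  obtain G where G: "weak_gradient \<Omega> u G" "G \<in> Lvar \<Omega> p"
    "\<And>\<phi>. \<phi> \<in> test_functions \<Omega> \<Longrightarrow>
       - (LINT x|lebesgue_on \<Omega>. (norm (G x) powr (p x - 2) *\<^sub>R G x) \<bullet> grad \<phi> x)
             = (LINT x|lebesgue_on \<Omega>. \<phi> x * f x)"
    using assms unfolding weak_solution_def by blast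
  have G': "weak_gradient \<Omega> (\<lambda>x. - u x) (\<lambda>x. - G x)" "(\<lambda>x. - G x) \<in> Lvar \<Omega> p"
    using weak_gradient_minus[OF G(1)] G(2) by (auto simp: Lvar_def)
  have "(\<lambda>x. - u x) \<in> W1var \<Omega> p"
    using assms G' by (auto simp: weak_solution_def W1var_def Lvar_def)
  moreover have "- (LINT x|lebesgue_on \<Omega>. (norm (- G x) powr (p x - 2) *\<^sub>R - G x) \<bullet> grad \<phi> x)
             = (LINT x|lebesgue_on \<Omega>. \<phi> x * - f x)" if "\<phi> \<in> test_functions \<Omega>" for \<phi>
    using G(3)[OF that] by simp
  ultimately show ?thesis unfolding weak_solution_def using G' by blast
qed

text \<open>
  Touching \<open>u\<close> from above by \<open>\<phi>\<close> is touching \<open>- u\<close> from below by \<open>- \<phi>\<close>, and the p(x)-Laplacian is odd.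
\<close>

lemma viscosity_subsolution_if_minus:
  assumes \<Omega>: "open \<Omega>" and super: "viscosity_supersolution \<Omega> p (\<lambda>x. - f x) (\<lambda>x. - u x)"
  shows "viscosity_subsolution \<Omega> p f u"
  unfolding viscosity_subsolution_def
proof (intro allI impI)
  fix \<phi> x assume \<phi>: "Ck_on 2 \<phi> \<Omega>" and x: "x \<in> \<Omega>" and touch: "touches_from_above \<phi> u x"
    and nz: "grad \<phi> x \<noteq> 0"
  have "\<phi> differentiable at x" using Ck_on_mono[OF \<phi>, of "Suc 0"] x by simp
  then have "grad (\<lambda>x. - \<phi> x) x \<noteq> 0" using nz by (simp add: grad_minus)
  moreover have "touches_from_below (\<lambda>x. - \<phi> x) (\<lambda>x. - u x) x"
    using touch by (simp add: touches_from_below_def touches_from_above_def)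
  ultimately have "px_laplacian p (\<lambda>x. - \<phi> x) x \<le> - f x"
    using super Ck_on_minus[OF \<Omega> \<phi>] x unfolding viscosity_supersolution_def by blast
  then show "f x \<le> px_laplacian p \<phi> x" using px_laplacian_minus[OF \<Omega> \<phi> x] by simp
qed

theorem theorem3p2:
  fixes \<Omega> :: "(real ^ 'n) set"
    and p f u :: "real ^ 'n \<Rightarrow> real"
    and pmin pmax L :: real
  assumes "open \<Omega>" and "connected \<Omega>" and "\<Omega> \<noteq> {}" and "bounded \<Omega>"
    and "1 < pmin" and "\<And>x. x \<in> \<Omega> \<Longrightarrow> pmin \<le> p x \<and> p x \<le> pmax"
    and "\<exists>K. K-lipschitz_on \<Omega> p"
    and "L > 0" and "Linf_norm \<Omega> (grad p) \<le> ereal L"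
    and "f \<in> Linf \<Omega>"
    and "continuous_on \<Omega> f"
    and "Ck_on 1 p \<Omega>"
    and "u \<in> W1var \<Omega> p" and "continuous_on \<Omega> u"
    and "weak_solution \<Omega> p f u"
  shows "viscosity_solution \<Omega> p f u"
proof -
  obtain K where K: "K-lipschitz_on \<Omega> p" using assms(7) by blast
  have p: "Ck_on (Suc 0) p \<Omega>" using assms(12) by simp
  have pb: "1 \<le> p x" "p x \<le> pmax" if "x \<in> \<Omega>" for x
    using assms(5) assms(6)[OF that] by auto
  note super = weak_solution_imp_viscosity_supersolution[OF assms(1) pb K _ p]
  have "viscosity_supersolution \<Omega> p f u"
    by (rule super) (use assms in auto)
  moreover have "viscosity_supersolution \<Omega> p (\<lambda>x. - f x) (\<lambda>x. - u x)"
    by (rule super) (use assms(11,14) weak_solution_minus[OF assms(15)] in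
        \<open>auto intro: continuous_intros\<close>)
  then have "viscosity_subsolution \<Omega> p f u"
    by (rule viscosity_subsolution_if_minus[OF assms(1)])
  ultimately show ?thesis using assms(14) by (simp add: viscosity_solution_def)
qed

end
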